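(* Fix an integer $m\ge1$. For $g\ge0$, $n\ge1$, let $C^{(m)}_{g,n}$ be the number of rooted $m$-constellations of genus $g$ with $n$ star vertices. Then for all $g\ge 0$ and $n\ge1$, \[ \binom{n}{2}C^{(m)}_{g,n}=\sum_{\substack{n_1+n_2=n\\ n_1,n_2\geq 1\\ g_1+g_2+g^*=g}} n_1\binom{(m-1)n_2+2-2g_2}{2g^*+2}C^{(m)}_{g_1,n_1}C^{(m)}_{g_2,n_2}, \] where $g_1,g_2,g^*$ range over nonnegative integers.
   Context: A map is a connected multigraph embedded in a compact oriented surface such that the complement of the graph is a disjoint union of open disks (faces), considered up to orientation-preserving homeomorphism; its genus is the genus of the surface. An $m$-constellation is a map with two kinds of vertices: colored vertices, each carrying a color in $\{1,\dots,m\}$, and star vertices; every edge joins a star vertex to a colored vertex, every star vertex has degree $m$ and its neighbors have colors $1,2,\dots,m$ in clockwise cyclic order. An $m$-constellation is rooted if one star vertex is distinguished. *)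

theory Defs
  imports Complex_Main "HOL-Combinatorics.Permutations" "HOL-Combinatorics.Orbits"
begin

text \<open>
  A map (a connected multigraph cellularly embedded in a compact oriented surface, up to
  orientation-preserving homeomorphism) is encoded by its rotation system. The darts are the
  half-edges, \<open>rot d\<close> is the dart following \<open>d\<close> in clockwise order around its vertex, and
  \<open>opp d\<close> is the other half of the edge of \<open>d\<close>. Homeomorphism becomes isomorphism of rotation
  systems. The one map without edges has no darts and is not represented; it has no star
  vertex of degree \<open>m \<ge> 1\<close>, hence is never a constellation with \<open>n \<ge> 1\<close> star vertices.
\<close>

record 'd cmap =
  darts :: "'d set"
  rot :: "'d \<Rightarrow> 'd"
  opp :: "'d \<Rightarrow> 'd"

definition is_map :: "('d, 'z) cmap_scheme \<Rightarrow> bool" where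
  "is_map M \<longleftrightarrow>
     finite (darts M) \<and> darts M \<noteq> {} \<and>
     rot M permutes darts M \<and> opp M permutes darts M \<and>
     (\<forall>d\<in>darts M. opp M d \<noteq> d \<and> opp M (opp M d) = d) \<and>
     (\<forall>d\<in>darts M. \<forall>e\<in>darts M.
        (\<lambda>x y. y = rot M x \<or> y = opp M x)\<^sup>*\<^sup>* d e)"

definition vertex_of :: "('d, 'z) cmap_scheme \<Rightarrow> 'd \<Rightarrow> 'd set" where
  "vertex_of M d = orbit (rot M) d"

definition map_vertices :: "('d, 'z) cmap_scheme \<Rightarrow> 'd set set" where
  "map_vertices M = vertex_of M ` darts M"

definition map_edges :: "('d, 'z) cmap_scheme \<Rightarrow> 'd set set" where
  "map_edges M = (\<lambda>d. {d, opp M d}) ` darts M"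

text \<open>The face to the left of a dart: walk to the other end of the edge, then take the next dart
  in clockwise order.\<close>

definition map_faces :: "('d, 'z) cmap_scheme \<Rightarrow> 'd set set" where
  "map_faces M = orbit (rot M \<circ> opp M) ` darts M"

text \<open>The genus of the underlying surface, read off from its Euler characteristic.\<close>

definition has_genus :: "('d, 'z) cmap_scheme \<Rightarrow> nat \<Rightarrow> bool" where
  "has_genus M g \<longleftrightarrow>
     int (card (map_vertices M)) - int (card (map_edges M)) + int (card (map_faces M))
       = 2 - 2 * int g"

datatype vertex_kind = Star | Colored nat

record 'd kmap = "'d cmap" +
  kind :: "'d set \<Rightarrow> vertex_kind"

definition star_vertices :: "('d, 'z) kmap_scheme \<Rightarrow> 'd set set" where
  "star_vertices M = {v \<in> map_vertices M. kind M v = Star}"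

definition is_constellation :: "nat \<Rightarrow> ('d, 'z) kmap_scheme \<Rightarrow> bool" where
  "is_constellation m M \<longleftrightarrow>
     is_map M \<and>
     (\<forall>v\<in>map_vertices M. kind M v = Star \<or> (\<exists>c\<in>{1..m}. kind M v = Colored c)) \<and>
     (\<forall>d\<in>darts M. kind M (vertex_of M d) = Star \<longleftrightarrow> kind M (vertex_of M (opp M d)) \<noteq> Star) \<and>
     (\<forall>v\<in>star_vertices M.
        card v = m \<and>
        (\<exists>d\<in>v. \<forall>i<m. kind M (vertex_of M (opp M ((rot M ^^ i) d))) = Colored (i + 1)))"

record 'd rkmap = "'d kmap" +
  root_star :: "'d set"

definition is_rooted_constellation :: "nat \<Rightarrow> 'd rkmap \<Rightarrow> bool" where
  "is_rooted_constellation m M \<longleftrightarrow> is_constellation m M \<and> root_star M \<in> star_vertices M"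

definition rooted_iso :: "'d rkmap \<Rightarrow> 'e rkmap \<Rightarrow> bool" where
  "rooted_iso M N \<longleftrightarrow>
     (\<exists>f. bij_betw f (darts M) (darts N) \<and>
          (\<forall>d\<in>darts M. f (rot M d) = rot N (f d) \<and> f (opp M d) = opp N (f d)) \<and>
          (\<forall>v\<in>map_vertices M. kind N (f ` v) = kind M v) \<and>
          f ` root_star M = root_star N)"

text \<open>Darts are taken in \<^typ>\<open>nat\<close>, which is no restriction as the dart sets are finite.\<close>

definition rooted_constellations :: "nat \<Rightarrow> nat \<Rightarrow> nat \<Rightarrow> nat rkmap set" where
  "rooted_constellations m g n =
     {M. is_rooted_constellation m M \<and> has_genus M g \<and> card (star_vertices M) = n}"

definition rooted_iso_rel :: "nat \<Rightarrow> nat \<Rightarrow> nat \<Rightarrow> (nat rkmap \<times> nat rkmap) set" where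
  "rooted_iso_rel m g n =
     {(M, N) \<in> rooted_constellations m g n \<times> rooted_constellations m g n. rooted_iso M N}"

definition num_constellations :: "nat \<Rightarrow> nat \<Rightarrow> nat \<Rightarrow> nat" where
  "num_constellations m g n = card (rooted_constellations m g n // rooted_iso_rel m g n)"

end

theory Submission
  imports Defs "Jordan_Normal_Form.Determinant" "HOL-Library.Poly_Mapping"
    "HOL-Library.Function_Algebras" "HOL-Library.Countable"
    "HOL-Computational_Algebra.Formal_Power_Series"
begin

text \<open>
  Rooted constellations with \<open>n\<close> stars correspond, \<open>(n - 1)!\<close> to one, to transitive \<open>m\<close>-tuples of
  permutations of \<open>n\<close> points, and the genus is determined by the number of cycles of the
  permutations and of their product. Let \<open>Z\<^sub>N\<close> be the exponential generating function of all
  \<open>m\<close>-tuples, weighted by \<open>N\<close> to the total number of cycles. The sum of \<open>N\<close> to the number of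
  cycles of \<open>\<sigma>\<close>, times \<open>\<sigma>\<close>, is the product of the Jucys--Murphy elements shifted by \<open>N\<close>. Since the
  class of transpositions acts on the Frobenius characters (the coefficients of the Vandermonde
  polynomial times a power sum) through the Laplace--Beltrami operator, this element is diagonal
  on them, and \<open>Z\<^sub>N\<close> becomes, up to a constant and a power of the variable \<open>z\<close>, an \<open>N \<times> N\<close>
  determinant of derivatives of one series. The Desnanot--Jacobi identity then gives
  the Toda equation \<open>N\<^sup>m\<^sup>+\<^sup>1 z Z\<^sub>N\<^sub>+\<^sub>1 Z\<^sub>N\<^sub>-\<^sub>1 = Z\<^sub>N \<theta>\<^sup>2 Z\<^sub>N - (\<theta> Z\<^sub>N)\<^sup>2\<close> with \<open>\<theta> = z d/dz\<close>. Logarithmic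
  differentiation turns it into a recursion for the polynomials in \<open>N\<close> that count the
  transitive tuples,
  \<open>n (n - 1) C\<^sub>n(N) = \<Sum> k C\<^sub>k(N) (C\<^sub>l(N + 1) - 2 C\<^sub>l(N) + C\<^sub>l(N - 1))\<close> over \<open>k + l = n\<close>,
  and the theorem compares coefficients. The same recursion shows that these polynomials have the
  degree and the parity demanded by Euler's formula.
\<close>

section \<open>Antisymmetric polynomials and the Laplace--Beltrami operator\<close>

text \<open>Removing a box lowers one exponent \<open>l i\<close>, and \<open>N\<close> plus the
  content of that box is \<open>l i\<close>. Hence the eigenvalue belonging to \<open>l\<close> is
  the product of the quotients of \<open>l i\<close> factorial by \<open>i\<close> factorial, which
  splits over the rows. So do the weights that expand a power of \<open>N\<close> in characters,
  while the character at the identity is a determinant of reciprocal factorials. Multilinearity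
  therefore collects the sum over all exponent vectors in one determinant with entries
  \<open>Gser m i j\<close>.

  Expanding a power of \<open>N\<close> means evaluating a quotient by the Vandermonde polynomial at
  the all-ones point, where it is 0/0; the functional \<open>binom_eval\<close> takes the place of
  this quotient.

  The binomial coefficient of the theorem is born from \<open>(N + 1)^e + (N - 1)^e - 2 N^e\<close>,
  which retains the powers \<open>N^(e - 2h - 2)\<close> only: \<open>e\<close> is the weight of the
  second piece, and \<open>h\<close> is the handle number \<open>g*\<close>. Passing to polynomials
  in \<open>N\<close> is what separates the genera.\<close>

lemma vandermonde_sum:
  fixes x :: "nat \<Rightarrow> 'a::comm_ring_1"
  shows "(\<Sum>w | w permutes {0..<N}. signof w * (\<Prod>i=0..<N. x i ^ w i)) =
    (\<Prod>i=0..<N. \<Prod>j=0..<i. x i - x j)"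
proof -
  \<comment> \<open>The Newton basis: \<open>q j\<close> is monic of degree \<open>j\<close> and
    vanishes at \<open>x 0, ..., x (j - 1)\<close>. Its coefficient matrix \<open>U\<close> is upper
    unitriangular, so \<open>V * U\<close> has the determinant of \<open>V\<close>; it is lower
    triangular, and its diagonal carries the factors of the product.\<close>
  define q where "q j = (\<Prod>k=0..<j. [:- x k, 1:])" for j
  have qdeg: "coeff (q j) j = 1 \<and> (\<forall>k>j. coeff (q j) k = 0)" for j
  proof (induction j)
    case (Suc j)
    have "q (Suc j) = q j * [:- x j, 1:]" by (simp add: q_def)
    then show ?case using Suc
      by (auto simp: mult_pCons_right coeff_pCons split: nat.splits)
  qed (auto simp: q_def)
  define V where "V = mat N N (\<lambda>(i,j). x i ^ j)"
  define U where "U = mat N N (\<lambda>(k,j). coeff (q j) k)"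
  have V[simp]: "V \<in> carrier_mat N N" and U[simp]: "U \<in> carrier_mat N N" by (auto simp: V_def U_def)
  have "V * U = mat N N (\<lambda>(i,j). poly (q j) (x i))"
  proof (rule eq_matI, goal_cases)
    case (1 i j)
    then have ij: "i < N" "j < N" by auto
    have "degree (q j) \<le> j" using qdeg[of j] by (intro degree_le) auto
    then have "poly (q j) (x i) = (\<Sum>k\<le>j. coeff (q j) k * x i ^ k)"
      unfolding poly_altdef by (intro sum.mono_neutral_left) (auto simp: coeff_eq_0)
    also have "\<dots> = (\<Sum>k=0..<N. x i ^ k * coeff (q j) k)"
      using ij qdeg[of j] by (intro sum.mono_neutral_cong_left) auto
    also have "\<dots> = (V * U) $$ (i,j)" using ij by (simp add: V_def U_def scalar_prod_def)
    finally show ?case using ij by simp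
  qed (auto simp: V_def U_def)
  then have "det V * det U = det (mat N N (\<lambda>(i,j). poly (q j) (x i)))"
    using det_mult[OF V U] by simp
  moreover have "det U = 1"
    using qdeg by (subst det_upper_triangular[of _ N])
       (auto simp: upper_triangular_def U_def prod_list_diag_prod)
  moreover have "det (mat N N (\<lambda>(i,j). poly (q j) (x i))) = (\<Prod>i=0..<N. \<Prod>j=0..<i. x i - x j)"
  proof (subst det_lower_triangular[of N])
    fix i j :: nat assume "i < j" "j < N"
    then show "mat N N (\<lambda>(i,j). poly (q j) (x i)) $$ (i,j) = 0"
      by (auto simp: q_def poly_prod intro!: prod_zero bexI[of _ i])
  next
    show "prod_list (diag_mat (mat N N (\<lambda>(i, j). poly (q j) (x i)))) = (\<Prod>i=0..<N. \<Prod>j=0..<i. x i - x j)"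
      by (auto simp: prod_list_diag_prod q_def poly_prod intro!: prod.cong)
  qed auto
  ultimately have "det V = (\<Prod>i=0..<N. \<Prod>j=0..<i. x i - x j)" by simp
  moreover have "det V = (\<Sum>w | w permutes {0..<N}. signof w * (\<Prod>i=0..<N. x i ^ w i))"
    unfolding det_def'[OF V] by (intro sum.cong refl arg_cong2[of _ _ _ _ "(*)"] prod.cong)
      (auto simp: V_def permutes_in_image)
  ultimately show ?thesis by simp
qed

section \<open>Euler operators on polynomials\<close>

type_synonym mpoly = "(nat \<Rightarrow> nat) \<Rightarrow>\<^sub>0 real"

text \<open>Exponents are plain functions, not finitely supported ones: multiplication uses only
  their pointwise addition.\<close>

definition indet :: "nat \<Rightarrow> mpoly" where
  "indet i = Poly_Mapping.single (\<lambda>k. if k = i then 1 else 0) 1"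

text \<open>The operator x_i d/dx_i. Monomials are its eigenvectors, so it can act coefficient by
  coefficient.\<close>

definition theta :: "nat \<Rightarrow> mpoly \<Rightarrow> mpoly" where
  "theta i f = Poly_Mapping.mapp (\<lambda>l c. real (l i) * c) f"

lemma lookup_theta: "Poly_Mapping.lookup (theta i f) l = real (l i) * Poly_Mapping.lookup f l"
  by (auto simp: theta_def lookup_mapp when_def in_keys_iff)

lemma theta_add: "theta i (f + g) = theta i f + theta i g"
  by (intro poly_mapping_eqI) (simp add: lookup_theta lookup_add algebra_simps)

lemma theta_diff: "theta i (f - g) = theta i f - theta i g"
  by (intro poly_mapping_eqI) (simp add: lookup_theta lookup_minus algebra_simps)

lemma theta_zero [simp]: "theta i 0 = 0"
  by (intro poly_mapping_eqI) (simp add: lookup_theta)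

lemma theta_sum: "theta i (sum f A) = (\<Sum>a\<in>A. theta i (f a))"
  by (induction A rule: infinite_finite_induct) (auto simp: theta_add)

lemma theta_single: "theta i (Poly_Mapping.single l c) = Poly_Mapping.single l (real (l i) * c)"
  by (intro poly_mapping_eqI) (auto simp: lookup_theta lookup_single when_def)

lemma mpoly_expand: "f = (\<Sum>l\<in>Poly_Mapping.keys f. Poly_Mapping.single l (Poly_Mapping.lookup f l))"
  for f :: mpoly
proof (rule poly_mapping_eqI)
  fix k
  show "Poly_Mapping.lookup f k = Poly_Mapping.lookup
     (\<Sum>l\<in>Poly_Mapping.keys f. Poly_Mapping.single l (Poly_Mapping.lookup f l)) k"
    by (auto simp: lookup_sum lookup_single when_def sum.delta in_keys_iff)
qed

lemma theta_mult_single: "theta i (Poly_Mapping.single k c * Poly_Mapping.single l d) =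
   theta i (Poly_Mapping.single k c) * Poly_Mapping.single l d +
   Poly_Mapping.single k c * theta i (Poly_Mapping.single l d)"
  by (simp add: mult_single theta_single single_add[symmetric] algebra_simps)

lemma theta_mult: "theta i (f * g) = theta i f * g + f * theta i g"
proof -
  have *: "theta i (Poly_Mapping.single k c * g) =
      theta i (Poly_Mapping.single k c) * g + Poly_Mapping.single k c * theta i g" for k c
    by (subst (1 2 3) mpoly_expand[of g])
      (simp add: sum_distrib_left theta_sum theta_mult_single sum.distrib)
  show ?thesis
    by (subst (1 2 3) mpoly_expand[of f])
      (simp add: sum_distrib_right theta_sum * sum.distrib)
qed

lemma theta_prod: "finite A \<Longrightarrow> theta i (prod f A) = (\<Sum>a\<in>A. theta i (f a) * prod f (A - {a}))"
proof (induction A rule: finite_induct)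
  case empty
  have "theta i (Poly_Mapping.single 0 1) = 0" unfolding theta_single by simp
  then show ?case by simp
next
  case (insert a A)
  have "f a * (\<Sum>b\<in>A. theta i (f b) * prod f (A - {b})) =
     (\<Sum>b\<in>A. theta i (f b) * prod f (insert a A - {b}))"
    unfolding sum_distrib_left
  proof (rule sum.cong[OF refl])
    fix b assume b: "b \<in> A"
    then have "insert a A - {b} = insert a (A - {b})" using insert by auto
    then show "f a * (theta i (f b) * prod f (A - {b})) = theta i (f b) * prod f (insert a A - {b})"
      using insert by (simp add: algebra_simps)
  qed
  then show ?case using insert by (simp add: theta_mult)
qed

lemma theta_indet: "theta i (indet j) = (if i = j then indet j else 0)"
  by (simp add: indet_def theta_single)

definition pairs :: "nat \<Rightarrow> (nat \<times> nat) set" where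
  "pairs N = {(i, j). j < i \<and> i < N}"

lemma finite_pairs [simp]: "finite (pairs N)"
  by (rule finite_subset[of _ "{0..<N} \<times> {0..<N}"]) (auto simp: pairs_def)

lemma pairs_Sigma: "pairs N = Sigma {0..<N} (\<lambda>i. {0..<i})"
  by (auto simp: pairs_def)

definition vdm :: "nat \<Rightarrow> mpoly" where
  "vdm N = (\<Prod>(i, j)\<in>pairs N. indet i - indet j)"

lemma indet_prod_power: "(\<Prod>i\<in>A. indet i ^ w i) = Poly_Mapping.single (\<lambda>i. if i \<in> A then w i else 0) 1"
  if "finite A"
  using that
proof (induction A rule: finite_induct)
  case empty
  have "(\<lambda>i::nat. 0::nat) = 0" by (simp add: zero_fun_def)
  then show ?case by simp
next
  case (insert a A)
  have p: "indet a ^ k = Poly_Mapping.single (\<lambda>i. if i = a then k else 0) 1" for k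
  proof (induction k)
    case 0
    have "(\<lambda>i::nat. 0::nat) = 0" by (simp add: zero_fun_def)
    then show ?case by simp
  next
    case (Suc k)
    then show ?case by (simp add: indet_def mult_single) (rule arg_cong2[of _ _ _ _ Poly_Mapping.single], auto simp: fun_eq_iff)
  qed
  have "(\<lambda>i. if i = a then w a else 0) + (\<lambda>i. if i \<in> A then w i else 0) = (\<lambda>i. if i \<in> insert a A then w i else 0)"
    using insert by (auto simp: fun_eq_iff)
  then show ?case using insert by (simp add: p mult_single)
qed

lemma vdm_sum: "vdm N = (\<Sum>w | w permutes {0..<N}.
    Poly_Mapping.single (\<lambda>i. if i < N then w i else 0) (signof w))"
proof -
  have "vdm N = (\<Prod>i=0..<N. \<Prod>j=0..<i. indet i - indet j)"
    unfolding vdm_def pairs_Sigma by (subst prod.Sigma) auto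
  also have "\<dots> = (\<Sum>w | w permutes {0..<N}. signof w * (\<Prod>i=0..<N. indet i ^ w i))"
    by (rule vandermonde_sum[symmetric])
  also have "\<dots> = (\<Sum>w | w permutes {0..<N}.
    Poly_Mapping.single (\<lambda>i. if i < N then w i else 0) (signof w))"
  proof (rule sum.cong[OF refl], goal_cases)
    case (1 w)
    show ?case by (subst indet_prod_power) (auto simp: sign_def single_uminus)
  qed
  finally show ?thesis .
qed

text \<open>The exponents in any monomial of \<open>vdm N\<close> are a rearrangement of 0, ..., N -
  1, so the operator multiplies all of these monomials by the same number.\<close>

lemma theta_sq_vdm:
  "(\<Sum>k=0..<N. theta k (theta k (vdm N))) = of_nat (\<Sum>k=0..<N. k ^ 2) * vdm N"
proof (rule poly_mapping_eqI)
  fix l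
  have "(\<Sum>k=0..<N. real (l k) * real (l k)) * Poly_Mapping.lookup (vdm N) l
     = real (\<Sum>k=0..<N. k ^ 2) * Poly_Mapping.lookup (vdm N) l"
  proof (cases "\<exists>w. w permutes {0..<N} \<and> l = (\<lambda>i. if i < N then w i else 0)")
    case True
    then obtain w where w: "w permutes {0..<N}" "l = (\<lambda>i. if i < N then w i else 0)" by auto
    have "(\<Sum>k=0..<N. real (l k) * real (l k)) = (\<Sum>k=0..<N. real (w k) * real (w k))"
      by (simp add: w)
    also have "\<dots> = (\<Sum>k=0..<N. real k * real k)"
      by (rule sum.permute[OF w(1), symmetric, unfolded o_def])
    finally show ?thesis by (simp add: power2_eq_square)
  next
    case False
    then have "Poly_Mapping.lookup (vdm N) l = 0"
      by (auto simp: vdm_sum lookup_sum lookup_single when_def intro!: sum.neutral)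
    then show ?thesis by simp
  qed
  moreover have "Poly_Mapping.lookup (of_nat m * f) l = real m * Poly_Mapping.lookup f l" for m and f :: mpoly
    by (induction m) (auto simp: lookup_add algebra_simps)
  ultimately show "Poly_Mapping.lookup (\<Sum>k=0..<N. theta k (theta k (vdm N))) l =
    Poly_Mapping.lookup (of_nat (\<Sum>k=0..<N. k ^ 2) * vdm N) l"
    by (simp add: lookup_sum lookup_theta sum_distrib_right[symmetric] mult.assoc[symmetric] del: of_nat_sum of_nat_power)
qed

lemma sum_pairs_add: "(\<Sum>(i, j)\<in>pairs N. f i + f j) = of_nat (N - 1) * (\<Sum>k=0..<N. f k)"
  for f :: "nat \<Rightarrow> 'a::comm_ring_1"
proof (induction N)
  case (Suc N)
  have "pairs (Suc N) = pairs N \<union> Pair N ` {0..<N}" by (auto simp: pairs_def)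
  moreover have "pairs N \<inter> Pair N ` {0..<N} = {}" by (auto simp: pairs_def)
  ultimately have "(\<Sum>(i, j)\<in>pairs (Suc N). f i + f j) = (\<Sum>(i, j)\<in>pairs N. f i + f j) + (\<Sum>j=0..<N. f N + f j)"
    by (simp add: sum.union_disjoint sum.reindex inj_on_def)
  then show ?case using Suc by (cases N) (auto simp: sum.distrib algebra_simps)
qed (auto simp: pairs_def)

text \<open>This is the Laplace--Beltrami operator: the sum of the squared Euler operators,
  conjugated by the Vandermonde polynomial. The mixed term consists of quotients (x_i theta_i p -
  x_j theta_j p) / (x_i - x_j). Splitting off theta_i p + theta_j p, which Euler's identity sums up,
  leaves the quotient called \<open>A i j\<close>. It is handed in as a given polynomial, so that no
  division occurs.\<close>

lemma theta_sq_vdm_mult: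
  assumes A: "\<And>i j. (i, j) \<in> pairs N \<Longrightarrow>
      (indet i - indet j) * A i j = indet j * theta i p - indet i * theta j p"
    and euler: "(\<Sum>k=0..<N. theta k p) = of_nat n * p"
  shows "(\<Sum>k=0..<N. theta k (theta k (vdm N * p))) =
    vdm N * (of_nat (\<Sum>k=0..<N. k ^ 2) * p + 2 * (\<Sum>(i, j)\<in>pairs N. A i j)
      + 2 * (of_nat (N - 1) * (of_nat n * p)) + (\<Sum>k=0..<N. theta k (theta k p)))"
proof -
  let ?V = "\<lambda>q. \<Prod>(i, j)\<in>pairs N - {q}. indet i - indet j"
  have V: "?V (i, j) * (indet i - indet j) = vdm N" if "(i, j) \<in> pairs N" for i j
    unfolding vdm_def using that by (subst (2) prod.remove[of _ "(i, j)"]) (auto simp: mult.commute)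
  have "(\<Sum>k=0..<N. theta k (vdm N) * theta k p) =
     (\<Sum>k=0..<N. \<Sum>q\<in>pairs N. theta k (case q of (i, j) \<Rightarrow> indet i - indet j) * ?V q * theta k p)"
    unfolding vdm_def by (subst theta_prod) (auto simp: sum_distrib_right)
  also have "\<dots> = (\<Sum>q\<in>pairs N. \<Sum>k=0..<N. theta k (case q of (i, j) \<Rightarrow> indet i - indet j) * ?V q * theta k p)"
    by (rule sum.swap)
  also have "\<dots> = (\<Sum>(i, j)\<in>pairs N. vdm N * (A i j + (theta i p + theta j p)))"
  proof (rule sum.cong[OF refl], clarify)
    fix i j assume ij: "(i, j) \<in> pairs N"
    then have ij': "i < N" "j < N" "i \<noteq> j" by (auto simp: pairs_def)
    have "(\<Sum>k=0..<N. theta k (indet i - indet j) * ?V (i, j) * theta k p) =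
      ?V (i, j) * (\<Sum>k=0..<N. (if k = i then indet i * theta i p else 0) - (if k = j then indet j * theta j p else 0))"
      unfolding sum_distrib_left
      by (rule sum.cong[OF refl]) (simp add: theta_diff theta_indet algebra_simps)
    also have "\<dots> = ?V (i, j) * (indet i * theta i p - indet j * theta j p)"
      using ij' by (simp add: sum_subtractf)
    also have "indet i * theta i p - indet j * theta j p =
      (indet j * theta i p - indet i * theta j p) + (indet i - indet j) * (theta i p + theta j p)"
      by (simp add: algebra_simps)
    also have "\<dots> = (indet i - indet j) * (A i j + (theta i p + theta j p))"
      unfolding A[OF ij, symmetric] by (simp add: algebra_simps)
    finally show "(\<Sum>k=0..<N. theta k (indet i - indet j) * ?V (i, j) * theta k p) =
        vdm N * (A i j + (theta i p + theta j p))"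
      using V[OF ij] by (simp add: mult.assoc[symmetric])
  qed
  also have "\<dots> = vdm N * ((\<Sum>(i, j)\<in>pairs N. A i j) + of_nat (N - 1) * (of_nat n * p))"
    using sum_pairs_add[of "\<lambda>i. theta i p" N] euler
    by (simp add: split_beta sum_distrib_left[symmetric] sum.distrib)
  finally have mix: "(\<Sum>k=0..<N. theta k (vdm N) * theta k p) =
     vdm N * ((\<Sum>(i, j)\<in>pairs N. A i j) + of_nat (N - 1) * (of_nat n * p))" .
  have "(\<Sum>k=0..<N. theta k (theta k (vdm N * p))) =
    (\<Sum>k=0..<N. theta k (theta k (vdm N))) * p + 2 * (\<Sum>k=0..<N. theta k (vdm N) * theta k p)
     + vdm N * (\<Sum>k=0..<N. theta k (theta k p))"
    unfolding sum_distrib_left sum_distrib_right sum.distrib[symmetric]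
    by (rule sum.cong[OF refl]) (simp add: theta_mult theta_add algebra_simps)
  then show ?thesis unfolding mix theta_sq_vdm by (simp add: algebra_simps)
qed

section \<open>Power sums and transpositions\<close>

definition cols :: "nat \<Rightarrow> nat \<Rightarrow> (nat \<Rightarrow> nat) set" where
  "cols N n = ({0..<n} \<rightarrow>\<^sub>E {0..<N})"

definition inv_cols :: "nat \<Rightarrow> nat \<Rightarrow> (nat \<Rightarrow> nat) \<Rightarrow> (nat \<Rightarrow> nat) set" where
  "inv_cols N n \<pi> = {f \<in> cols N n. \<forall>a<n. f (\<pi> a) = f a}"

definition cmono :: "nat \<Rightarrow> (nat \<Rightarrow> nat) \<Rightarrow> mpoly" where
  "cmono n f = (\<Prod>a=0..<n. indet (f a))"

text \<open>The power sum product of the cycle type of \<open>\<pi>\<close>: an invariant colouring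
  chooses one variable for each cycle, and takes it once per point of the cycle. In terms of
  colourings, the effect of multiplying \<open>\<pi>\<close> by a transposition can be read off from
  the colours of two points.\<close>

definition powsum :: "nat \<Rightarrow> nat \<Rightarrow> (nat \<Rightarrow> nat) \<Rightarrow> mpoly" where
  "powsum N n \<pi> = (\<Sum>f\<in>inv_cols N n \<pi>. cmono n f)"

lemma finite_cols [simp]: "finite (cols N n)"
  unfolding cols_def by (intro finite_PiE) auto

lemma finite_inv_cols [simp]: "finite (inv_cols N n \<pi>)"
  by (rule finite_subset[of _ "cols N n"]) (auto simp: inv_cols_def)

lemma cols_less: "f \<in> cols N n \<Longrightarrow> a < n \<Longrightarrow> f a < N"
  by (auto simp: cols_def PiE_def Pi_def)

lemma theta_cmono: "theta k (cmono n f) = of_nat (card {a. a < n \<and> f a = k}) * cmono n f"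
proof -
  have "theta k (cmono n f) = (\<Sum>a=0..<n. if f a = k then cmono n f else 0)"
    unfolding cmono_def
    by (subst theta_prod) (auto simp: theta_indet prod.remove intro!: sum.cong)
  also have "\<dots> = of_nat (card {a. a < n \<and> f a = k}) * cmono n f"
    by (subst sum.inter_filter[symmetric]) auto
  finally show ?thesis .
qed

lemma theta_powsum: "theta k (powsum N n \<pi>) =
   (\<Sum>f\<in>inv_cols N n \<pi>. of_nat (card {a. a < n \<and> f a = k}) * cmono n f)"
  by (simp add: powsum_def theta_sum theta_cmono)

lemma sum_card_colors:
  assumes "f \<in> cols N n"
  shows "(\<Sum>k=0..<N. card {a. a < n \<and> f a = k}) = n"
proof -
  have "(\<Sum>k=0..<N. card {a. a < n \<and> f a = k}) = card (\<Union>k\<in>{0..<N}. {a. a < n \<and> f a = k})"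
    by (rule card_UN_disjoint[symmetric]) auto
  also have "(\<Union>k\<in>{0..<N}. {a. a < n \<and> f a = k}) = {0..<n}"
    using cols_less[OF assms] by auto
  finally show ?thesis by simp
qed

lemma theta_powsum_euler: "(\<Sum>k=0..<N. theta k (powsum N n \<pi>)) = of_nat n * powsum N n \<pi>"
proof -
  have "(\<Sum>k=0..<N. theta k (powsum N n \<pi>)) =
     (\<Sum>f\<in>inv_cols N n \<pi>. of_nat (\<Sum>k=0..<N. card {a. a < n \<and> f a = k}) * cmono n f)"
    unfolding theta_powsum by (subst sum.swap) (simp add: sum_distrib_right)
  also have "\<dots> = (\<Sum>f\<in>inv_cols N n \<pi>. of_nat n * cmono n f)"
    by (intro sum.cong refl) (simp add: sum_card_colors inv_cols_def del: of_nat_sum)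
  finally show ?thesis by (simp add: powsum_def sum_distrib_left)
qed

lemma cmono_upd:
  assumes "d < n"
  shows "indet (f d) * cmono n (f(d := j)) = indet j * cmono n f"
proof -
  have "(\<Prod>a\<in>{0..<n} - {d}. indet ((f(d := j)) a)) = (\<Prod>a\<in>{0..<n} - {d}. indet (f a))"
    by (rule prod.cong) auto
  then show ?thesis
    unfolding cmono_def using assms by (simp add: prod.remove[of _ d])
qed

lemma funpow_less:
  fixes a n :: nat
  assumes "\<pi> permutes {0..<n}" "a < n" shows "(\<pi> ^^ r) a < n"
proof (induction r)
  case (Suc r)
  then show ?case using permutes_in_image[OF assms(1), of "(\<pi> ^^ r) a"] by simp
qed (simp add: assms)

text \<open>Cutting one cycle of \<open>\<pi>\<close>: the invariant colourings of \<open>(a b) \<pi>\<close> with distinct colours at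
  \<open>a\<close> and \<open>b\<close> colour the \<open>\<pi>\<close>-cycle of \<open>a\<close> with two consecutive arcs.\<close>

lemma cut_colorings:
  assumes \<pi>: "\<pi> permutes {0..<n}" and a: "a < n" and ij: "i \<noteq> j" "i < N" "j < N"
  shows "(indet i - indet j) *
     (\<Sum>b\<in>{0..<n}-{a}. \<Sum>f | f \<in> inv_cols N n (transpose a b \<circ> \<pi>) \<and> f a = i \<and> f b = j. cmono n f) =
     indet j * (\<Sum>f | f \<in> inv_cols N n \<pi> \<and> f a = i. cmono n f) -
     indet i * (\<Sum>f | f \<in> inv_cols N n \<pi> \<and> f a = j. cmono n f)"
proof -
  have perm: "permutation \<pi>" using \<pi> by (auto simp: permutation_permutes)
  define L where "L = funpow_dist1 \<pi> a a"
  have self: "a \<in> orbit \<pi> a" by (rule permutation_self_in_orbit[OF perm])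
  have L: "(\<pi> ^^ L) a = a" "L > 0"
    using funpow_dist1_prop[OF self] by (simp_all only: L_def)
  define q where "q r = (\<pi> ^^ r) a" for r
  have qinj: "r = s" if "q r = q s" "r < L" "s < L" for r s
    using funpow_neq_less_funpow_dist1[OF self] that unfolding q_def L_def by blast
  have qless: "q r < n" for r unfolding q_def by (rule funpow_less[OF \<pi> a])
  have qS: "\<pi> (q r) = q (Suc r)" for r by (simp add: q_def)
  have q0: "q 0 = a" "q L = a" using L by (auto simp: q_def)
  define Oa where "Oa = q ` {0..<L}"
  have Oin: "\<pi> c \<in> Oa \<longleftrightarrow> c \<in> Oa" for c
  proof
    assume "c \<in> Oa"
    then obtain r where r: "c = q r" "r < L" by (auto simp: Oa_def)
    show "\<pi> c \<in> Oa"
    proof (cases "Suc r = L")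
      case True then show ?thesis using r q0 L by (auto simp: Oa_def qS intro!: image_eqI[of _ _ 0])
    next
      case False then show ?thesis using r by (auto simp: Oa_def qS)
    qed
  next
    assume "\<pi> c \<in> Oa"
    then obtain r where r: "\<pi> c = q r" "r < L" by (auto simp: Oa_def)
    have "\<exists>s<L. q r = \<pi> (q s)"
    proof (cases r)
      case 0 then show ?thesis using q0 L by (auto simp: qS intro!: exI[of _ "L - 1"])
    next
      case (Suc s) then show ?thesis using r by (intro exI[of _ s]) (simp add: qS)
    qed
    then obtain s where "s < L" "\<pi> c = \<pi> (q s)" using r by auto
    then have "c = q s" using permutes_inj[OF \<pi>] by (simp add: inj_eq)
    then show "c \<in> Oa" using \<open>s < L\<close> by (auto simp: Oa_def)
  qed
  define G where "G = {f \<in> inv_cols N n \<pi>. f a = i}"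
  \<comment> \<open>For \<open>b = q s\<close> the product of the transposition with
    \<open>\<pi>\<close> splits the cycle of \<open>a\<close> into the arcs
    \<open>q 0, ..., q (s - 1)\<close> and \<open>q s, ..., q (L - 1)\<close>. The map
    \<open>ov s\<close> gives the second arc colour \<open>j\<close>, while \<open>fl k\<close>
    floods the whole cycle with \<open>k\<close>; \<open>ov s\<close> and \<open>fl i\<close> are
    inverse to each other between \<open>G\<close> and the colourings of the cut
    permutation.\<close>
  define ov where "ov s g = (\<lambda>c. if c \<in> q ` {s..<L} then j else g c)" for s and g :: "nat \<Rightarrow> nat"
  define fl where "fl k f = (\<lambda>c. if c \<in> Oa then k else f c)" for k and f :: "nat \<Rightarrow> nat"
  have qmem: "q r \<in> q ` {s..<L} \<longleftrightarrow> s \<le> r" if "r < L" for r s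
    using qinj[of r] that by (force simp: image_iff)
  have const: "f (q r) = f a" if "f \<in> inv_cols N n \<pi>" for f r
  proof (induction r)
    case (Suc r)
    then show ?case using that qless[of r] by (simp add: qS[symmetric] inv_cols_def)
  qed (simp add: q0)
  have ov_cols: "ov s g \<in> cols N n" if "g \<in> cols N n" for s g
    using that ij qless by (auto simp: ov_def cols_def PiE_def Pi_def extensional_def)
  have fl_cols: "fl k g \<in> cols N n" if "g \<in> cols N n" "k < N" for k g
    using that ij qless by (auto simp: fl_def Oa_def cols_def PiE_def Pi_def extensional_def)
  have fl_inv: "fl k f \<in> inv_cols N n \<pi>" if "f \<in> cols N n" "k < N" "\<And>c. c < n \<Longrightarrow> c \<notin> Oa \<Longrightarrow> f (\<pi> c) = f c" for k f
    using that fl_cols[of f k] Oin by (auto simp: fl_def inv_cols_def)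
  have aO: "a \<in> Oa" using q0 L by (auto simp: Oa_def image_iff)
  have flG: "fl i g = g" if "g \<in> G" for g
    using const[of g] that by (auto simp: fl_def G_def Oa_def fun_eq_iff)
  have fl_ov: "fl i (ov s g) = fl i g" for s g by (auto simp: fl_def ov_def Oa_def fun_eq_iff)
  have bk: "ov s (fl i f) = f" if s: "0 < s" "s < L"
      and "f \<in> inv_cols N n (transpose a (q s) \<circ> \<pi>)" "f a = i" "f (q s) = j" for s f
  proof -
    have f: "f \<in> cols N n" "f a = i" "f (q s) = j"
      and inv: "\<And>c. c < n \<Longrightarrow> f (transpose a (q s) (\<pi> c)) = f c" using that by (auto simp: inv_cols_def)
    have qsa: "q s \<noteq> a" using qinj[of s 0] s L q0 by auto
    have lo: "f (q r) = i" if "r < s" for r using that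
    proof (induction r)
      case (Suc r)
      then have "\<pi> (q r) \<noteq> a" "\<pi> (q r) \<noteq> q s"
        using qinj[of "Suc r" 0] qinj[of "Suc r" s] s q0 by (auto simp: qS)
      then show ?case using inv[OF qless[of r]] Suc by (simp add: qS transpose_def)
    qed (simp add: q0 f)
    have hi: "f (q (s + r)) = j" if "s + r < L" for r using that
    proof (induction r)
      case (Suc r)
      then have "\<pi> (q (s + r)) \<noteq> a" "\<pi> (q (s + r)) \<noteq> q s"
        using qinj[of "Suc (s + r)" 0] qinj[of "Suc (s + r)" s] s q0 by (auto simp: qS)
      then show ?case using inv[OF qless[of "s + r"]] Suc by (simp add: qS transpose_def)
    qed (simp add: f)
    show ?thesis
    proof
      fix c show "ov s (fl i f) c = f c"
      proof (cases "c \<in> Oa")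
        case True
        then obtain r where r: "c = q r" "r < L" by (auto simp: Oa_def)
        show ?thesis
          using lo[of r] hi[of "r - s"] r True by (cases "r < s") (auto simp: ov_def qmem fl_def)
      next
        case False
        then have "c \<notin> q ` {s..<L}" by (auto simp: Oa_def)
        then show ?thesis using False by (auto simp: ov_def fl_def)
      qed
    qed
  qed
  have arc: "(\<Sum>f | f \<in> inv_cols N n (transpose a (q s) \<circ> \<pi>) \<and> f a = i \<and> f (q s) = j. cmono n f)
      = (\<Sum>g\<in>G. cmono n (ov s g))" if s: "0 < s" "s < L" for s
  proof (rule sum.reindex_bij_witness[of _ "ov s" "fl i"], goal_cases)
    case (1 f)
    then show ?case using bk s by auto
  next
    case (2 f)
    then have f: "f \<in> cols N n"
      and inv: "\<And>c. c < n \<Longrightarrow> f (transpose a (q s) (\<pi> c)) = f c" by (auto simp: inv_cols_def)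
    have "f (\<pi> c) = f c" if "c < n" "c \<notin> Oa" for c
    proof -
      have "\<pi> c \<notin> Oa" using that Oin by blast
      then have "\<pi> c \<noteq> a" "\<pi> c \<noteq> q s" using aO s by (auto simp: Oa_def)
      then show ?thesis using inv[OF that(1)] by (simp add: transpose_def)
    qed
    then show ?case using fl_inv[OF f ij(2)] aO by (auto simp: G_def fl_def)
  next
    case (3 g)
    then show ?case by (simp add: fl_ov flG)
  next
    case (4 g)
    then have g: "g \<in> cols N n" "g a = i" "\<And>c. c < n \<Longrightarrow> g (\<pi> c) = g c" by (auto simp: G_def inv_cols_def)
    have gq: "g (q r) = i" for r using const[of g r] 4 by (simp add: G_def)
    have qa: "q s \<noteq> a" using qinj[of s 0] s L q0 by auto
    have ovq: "ov s g (q r) = (if s \<le> r then j else i)" if "r < L" for r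
      using that gq by (simp add: ov_def qmem)
    have "ov s g (transpose a (q s) (\<pi> c)) = ov s g c" if c: "c < n" for c
    proof (cases "c \<in> Oa")
      case True
      then obtain r where r: "c = q r" "r < L" by (auto simp: Oa_def)
      consider "Suc r = L" | "Suc r < L" "Suc r = s" | "Suc r < L" "Suc r \<noteq> s" using r by linarith
      then show ?thesis
      proof cases
        case 1
        then have "\<pi> c = a" using r q0 by (simp add: qS)
        then show ?thesis using r ovq[of r] ovq[of s] s 1 by auto
      next
        case 2
        then have "\<pi> c = q s" using r by (simp add: qS)
        then show ?thesis using r ovq[of r] ovq[of 0] s 2 q0 by auto
      next
        case 3
        then have "q (Suc r) \<noteq> a" "q (Suc r) \<noteq> q s" using qinj[of "Suc r" 0] qinj[of "Suc r" s] s q0 by auto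
        then show ?thesis using r ovq[of r] ovq[of "Suc r"] 3 by (simp add: qS transpose_def)
      qed
    next
      case False
      then have n: "\<pi> c \<notin> Oa" using Oin by blast
      then have "\<pi> c \<noteq> a" "\<pi> c \<noteq> q s" using aO s by (auto simp: Oa_def)
      moreover have "ov s g (\<pi> c) = g (\<pi> c)" "ov s g c = g c"
        using n False by (auto simp: ov_def Oa_def)
      ultimately show ?thesis using g c by (simp add: transpose_def)
    qed
    moreover have "ov s g a = i" using ovq[of 0] s q0 by simp
    moreover have "ov s g (q s) = j" using ovq[of s] s by simp
    ultimately show ?case using ov_cols[OF g(1)] by (auto simp: inv_cols_def)
  next
    case (5 f)
    then show ?case using bk s by auto
  qed
  \<comment> \<open>Outside the cycle of \<open>a\<close> the transposition joins two cycles. Then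
    \<open>a\<close> and \<open>b\<close> share a cycle and cannot have different colours.\<close>
  have none: "(\<Sum>f | f \<in> inv_cols N n (transpose a b \<circ> \<pi>) \<and> f a = i \<and> f b = j. cmono n f) = 0"
    if b: "b \<notin> Oa" for b
  proof -
    have False if f: "f \<in> inv_cols N n (transpose a b \<circ> \<pi>)" "f a = i" "f b = j" for f
    proof -
      have inv: "\<And>c. c < n \<Longrightarrow> f (transpose a b (\<pi> c)) = f c" using f by (auto simp: inv_cols_def)
      have lo: "f (q r) = i" if "r < L" for r using that
      proof (induction r)
        case (Suc r)
        then have "\<pi> (q r) \<noteq> a" "\<pi> (q r) \<noteq> b"
          using qinj[of "Suc r" 0] q0 b by (auto simp: qS Oa_def)
        then show ?case using inv[OF qless[of r]] Suc by (simp add: qS transpose_def)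
      qed (simp add: q0 f)
      have "\<pi> (q (L - 1)) = a" using L q0 by (simp add: qS)
      then have "f b = f (q (L - 1))" using inv[OF qless[of "L - 1"]] by simp
      then show False using lo[of "L - 1"] L f ij by simp
    qed
    then show ?thesis by (intro sum.neutral) auto
  qed
  have inv0: "(\<Sum>f | f \<in> inv_cols N n \<pi> \<and> f a = j. cmono n f) = (\<Sum>g\<in>G. cmono n (ov 0 g))"
  proof (rule sum.reindex_bij_witness[of _ "ov 0" "fl i"], goal_cases)
    case (1 f)
    then show ?case using const[of f] by (auto simp: ov_def fl_def Oa_def atLeast0LessThan fun_eq_iff)
  next
    case (2 f)
    then show ?case using fl_inv[of f i] ij aO by (auto simp: G_def inv_cols_def fl_def)
  next
    case (3 g)
    then show ?case by (simp add: fl_ov flG)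
  next
    case (4 g)
    have "ov 0 g = fl j g" by (auto simp: ov_def fl_def Oa_def)
    then show ?case using fl_inv[of g j] 4 ij aO by (auto simp: G_def inv_cols_def fl_def)
  next
    case (5 f)
    then show ?case using const[of f] by (auto simp: ov_def fl_def Oa_def atLeast0LessThan fun_eq_iff intro!: arg_cong[of _ _ "cmono n"])
  qed
  have step: "indet i * cmono n (ov s g) = indet j * cmono n (ov (Suc s) g)" if "s < L" "g \<in> G" for s g
  proof -
    have "ov s g = (ov (Suc s) g)(q s := j)"
    proof -
      have "{s..<L} = insert s {Suc s..<L}" using that by auto
      then show ?thesis by (auto simp: ov_def fun_eq_iff)
    qed
    moreover have "ov (Suc s) g (q s) = i"
      using that const[of g s] by (simp add: ov_def qmem G_def)
    ultimately show ?thesis using cmono_upd[OF qless[of s], of "ov (Suc s) g" j] by simp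
  qed
  \<comment> \<open>Moving the border between the arcs by one point exchanges a factor
    \<open>indet j\<close> for \<open>indet i\<close>, so the sum over the border telescopes. At its
    two ends the cycle is entirely coloured \<open>i\<close> or entirely coloured
    \<open>j\<close>.\<close>
  have tel: "(indet i - indet j) * (\<Sum>s=1..<L. cmono n (ov s g)) =
      indet j * cmono n g - indet i * cmono n (ov 0 g)" if g: "g \<in> G" for g
  proof -
    have "(indet i - indet j) * (\<Sum>s=1..<L. cmono n (ov s g)) =
       (\<Sum>s=1..<L. indet j * cmono n (ov (Suc s) g) - indet j * cmono n (ov s g))"
      unfolding sum_distrib_left using step[OF _ g] by (intro sum.cong) (auto simp: left_diff_distrib)
    also have "\<dots> = indet j * cmono n (ov L g) - indet j * cmono n (ov 1 g)"
      using L by (subst sum_Suc_diff') auto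
    also have "ov L g = g" by (auto simp: ov_def)
    also have "indet j * cmono n (ov 1 g) = indet i * cmono n (ov 0 g)"
      using step[of 0 g] L g by simp
    finally show ?thesis .
  qed
  let ?F = "\<lambda>b. \<Sum>f | f \<in> inv_cols N n (transpose a b \<circ> \<pi>) \<and> f a = i \<and> f b = j. cmono n f"
  have "(\<Sum>b\<in>{0..<n}-{a}. ?F b) = (\<Sum>b\<in>q ` {1..<L}. ?F b)"
  proof (rule sum.mono_neutral_right)
    have "q s \<noteq> a" if "s \<in> {1..<L}" for s using qinj[of s 0] q0 that by auto
    then show "q ` {1..<L} \<subseteq> {0..<n} - {a}" using qless by fastforce
    have "{0..<L} = insert 0 {1..<L}" using L by auto
    then have "Oa = insert a (q ` {1..<L})" unfolding Oa_def using q0 by simp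
    then show "\<forall>b\<in>{0..<n} - {a} - q ` {1..<L}. ?F b = 0" using none by auto
  qed auto
  also have "\<dots> = (\<Sum>s=1..<L. ?F (q s))"
    by (subst sum.reindex) (auto intro!: inj_onI qinj)
  also have "\<dots> = (\<Sum>s=1..<L. \<Sum>g\<in>G. cmono n (ov s g))" by (rule sum.cong[OF refl], rule arc) auto
  also have "\<dots> = (\<Sum>g\<in>G. \<Sum>s=1..<L. cmono n (ov s g))" by (rule sum.swap)
  finally have "(indet i - indet j) * (\<Sum>b\<in>{0..<n}-{a}. ?F b) =
     (\<Sum>g\<in>G. indet j * cmono n g - indet i * cmono n (ov 0 g))"
    using tel by (simp add: sum_distrib_left del: One_nat_def cong: sum.cong)
  then show ?thesis unfolding inv0 by (simp add: sum_subtractf sum_distrib_left G_def)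
qed


text \<open>An explicit polynomial that serves as the quotient \<open>A i j\<close> of
  \<open>theta_sq_vdm_mult\<close>; being a sum over colourings, it also appears in the action of
  the transpositions.\<close>

definition cutsum :: "nat \<Rightarrow> nat \<Rightarrow> (nat \<Rightarrow> nat) \<Rightarrow> nat \<Rightarrow> nat \<Rightarrow> mpoly" where
  "cutsum N n \<pi> i j = (\<Sum>a=0..<n. \<Sum>b\<in>{0..<n}-{a}.
     \<Sum>f | f \<in> inv_cols N n (transpose a b \<circ> \<pi>) \<and> f a = i \<and> f b = j. cmono n f)"

lemma cutsum_mult:
  assumes \<pi>: "\<pi> permutes {0..<n}" and ij: "(i, j) \<in> pairs N"
  shows "(indet i - indet j) * cutsum N n \<pi> i j =
    indet j * theta i (powsum N n \<pi>) - indet i * theta j (powsum N n \<pi>)"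
proof -
  have Q: "(\<Sum>a=0..<n. \<Sum>f | f \<in> inv_cols N n \<pi> \<and> f a = k. cmono n f) = theta k (powsum N n \<pi>)" for k
  proof -
    have "(\<Sum>a=0..<n. \<Sum>f | f \<in> inv_cols N n \<pi> \<and> f a = k. cmono n f) =
      (\<Sum>a=0..<n. \<Sum>f\<in>inv_cols N n \<pi>. if f a = k then cmono n f else 0)"
      by (intro sum.cong refl sum.inter_filter) simp
    also have "\<dots> = (\<Sum>f\<in>inv_cols N n \<pi>. \<Sum>a=0..<n. if f a = k then cmono n f else 0)"
      by (rule sum.swap)
    also have "\<dots> = (\<Sum>f\<in>inv_cols N n \<pi>. of_nat (card {a. a < n \<and> f a = k}) * cmono n f)"
    proof (rule sum.cong[OF refl])
      fix f
      have "(\<Sum>a=0..<n. if f a = k then cmono n f else 0) = (\<Sum>a | a \<in> {0..<n} \<and> f a = k. cmono n f)"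
        by (rule sum.inter_filter[symmetric]) simp
      then show "(\<Sum>a=0..<n. if f a = k then cmono n f else 0) = of_nat (card {a. a < n \<and> f a = k}) * cmono n f"
        by simp
    qed
    finally show ?thesis by (simp add: theta_powsum)
  qed
  have "i \<noteq> j" "i < N" "j < N" using ij by (auto simp: pairs_def)
  then have "(indet i - indet j) * cutsum N n \<pi> i j =
    (\<Sum>a=0..<n. indet j * (\<Sum>f | f \<in> inv_cols N n \<pi> \<and> f a = i. cmono n f) -
     indet i * (\<Sum>f | f \<in> inv_cols N n \<pi> \<and> f a = j. cmono n f))"
    unfolding cutsum_def sum_distrib_left[of "indet i - indet j" _ "{0..<n}"]
    by (intro sum.cong refl cut_colorings[OF \<pi>]) auto
  then show ?thesis by (simp only: sum_subtractf sum_distrib_left[symmetric] Q)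
qed

text \<open>Both sides count the ordered pairs of equal colour, diagonal included; the right one
  does so colour by colour.\<close>

lemma card_equal_pairs:
  assumes f: "f \<in> cols N n"
  shows "2 * card {(a, b) \<in> pairs n. f a = f b} + n = (\<Sum>k=0..<N. (card {a. a < n \<and> f a = k})\<^sup>2)"
proof -
  let ?P = "{(a, b) \<in> pairs n. f a = f b}"
  let ?D = "(\<lambda>a. (a, a)) ` {0..<n}"
  have fin: "finite ?P" by (rule finite_subset[OF _ finite_pairs[of n]]) auto
  have "card (\<Union>k\<in>{0..<N}. {a. a < n \<and> f a = k} \<times> {a. a < n \<and> f a = k}) =
     (\<Sum>k=0..<N. card ({a. a < n \<and> f a = k} \<times> {a. a < n \<and> f a = k}))"
    by (rule card_UN_disjoint) auto
  also have "(\<Union>k\<in>{0..<N}. {a. a < n \<and> f a = k} \<times> {a. a < n \<and> f a = k}) = ?P \<union> prod.swap ` ?P \<union> ?D"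
    using cols_less[OF f] by (auto simp: pairs_def image_iff split: prod.splits)
  also have "card \<dots> = card (?P \<union> prod.swap ` ?P) + card ?D"
    using fin by (intro card_Un_disjoint) (auto simp: pairs_def)
  also have "card (?P \<union> prod.swap ` ?P) = card ?P + card (prod.swap ` ?P)"
    using fin by (intro card_Un_disjoint) (auto simp: pairs_def)
  also have "card (prod.swap ` ?P) = card ?P" by (rule card_image) (auto simp: inj_on_def)
  also have "card ?D = n" by (subst card_image) (auto simp: inj_on_def)
  finally show ?thesis by (simp add: card_cartesian_product power2_eq_square)
qed

lemma sum_pairs_sym: "(\<Sum>(a, b)\<in>pairs n. g a b + g b a) = (\<Sum>a=0..<n. \<Sum>b\<in>{0..<n}-{a}. g a b)"
  for g :: "nat \<Rightarrow> nat \<Rightarrow> 'a::comm_monoid_add"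
proof -
  have "(\<Sum>a=0..<n. \<Sum>b\<in>{0..<n}-{a}. g a b) = (\<Sum>(a, b)\<in>Sigma {0..<n} (\<lambda>a. {0..<n}-{a}). g a b)"
    by (subst sum.Sigma) auto
  also have "Sigma {0..<n} (\<lambda>a. {0..<n}-{a}) = pairs n \<union> prod.swap ` pairs n"
    by (auto simp: pairs_def image_iff)
  also have "(\<Sum>(a, b)\<in>pairs n \<union> prod.swap ` pairs n. g a b) =
     (\<Sum>(a, b)\<in>pairs n. g a b) + (\<Sum>(a, b)\<in>prod.swap ` pairs n. g a b)"
    by (rule sum.union_disjoint[OF finite_pairs finite_imageI[OF finite_pairs]]) (auto simp: pairs_def)
  also have "(\<Sum>(a, b)\<in>prod.swap ` pairs n. g a b) = (\<Sum>(a, b)\<in>pairs n. g b a)"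
    by (subst sum.reindex) (auto simp: inj_on_def split_beta intro!: sum.cong)
  finally show ?thesis by (simp add: sum.distrib split_beta)
qed

text \<open>If \<open>f a = f b\<close>, a colouring is invariant under the product with the
  transposition iff it is invariant under \<open>\<pi>\<close>; counting these pairs gives half of
  the second-order term minus half of \<open>n\<close>. If the colours differ, orienting the pair so
  that the larger colour comes first yields the cut sums.\<close>

lemma cut_join:
  assumes \<pi>: "\<pi> permutes {0..<n}"
  shows "2 * (\<Sum>(a, b)\<in>pairs n. powsum N n (transpose a b \<circ> \<pi>)) =
    (\<Sum>k=0..<N. theta k (theta k (powsum N n \<pi>))) - of_nat n * powsum N n \<pi>
     + 2 * (\<Sum>(i, j)\<in>pairs N. cutsum N n \<pi> i j)"
proof -
  define g where "g a b = (\<Sum>f | f \<in> inv_cols N n (transpose a b \<circ> \<pi>) \<and> f b < f a. cmono n f)" for a b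
  have split: "powsum N n (transpose a b \<circ> \<pi>) =
     (\<Sum>f | f \<in> inv_cols N n \<pi> \<and> f a = f b. cmono n f) + (g a b + g b a)" if ab: "a < n" "b < n" for a b
  proof -
    let ?I = "inv_cols N n (transpose a b \<circ> \<pi>)"
    have lt: "\<pi> c < n \<longleftrightarrow> c < n" for c using permutes_in_image[OF \<pi>, of c] by simp
    have e: "{f \<in> ?I. f a = f b} = {f \<in> inv_cols N n \<pi>. f a = f b}"
    proof -
      have tr: "f (transpose a b x) = f x" if "f a = f b" for f :: "nat \<Rightarrow> nat" and x
        using that by (auto simp: transpose_def)
      have "f \<in> ?I \<longleftrightarrow> f \<in> inv_cols N n \<pi>" if "f a = f b" for f
        by (simp add: inv_cols_def tr[OF that])
      then show ?thesis by auto
    qed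
    have "?I = {f \<in> ?I. f a = f b} \<union> ({f \<in> ?I. f b < f a} \<union> {f \<in> ?I. f a < f b})" by auto
    then have "powsum N n (transpose a b \<circ> \<pi>) =
       (\<Sum>f\<in>{f \<in> ?I. f a = f b} \<union> ({f \<in> ?I. f b < f a} \<union> {f \<in> ?I. f a < f b}). cmono n f)"
      by (simp add: powsum_def)
    also have "\<dots> = (\<Sum>f | f \<in> ?I \<and> f a = f b. cmono n f) +
       ((\<Sum>f | f \<in> ?I \<and> f b < f a. cmono n f) + (\<Sum>f | f \<in> ?I \<and> f a < f b. cmono n f))"
      by (subst sum.union_disjoint; (subst sum.union_disjoint)?) auto
    finally show ?thesis unfolding e g_def by (simp add: transpose_commute)
  qed
  have "(\<Sum>(a, b)\<in>pairs n. powsum N n (transpose a b \<circ> \<pi>)) =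
    (\<Sum>(a, b)\<in>pairs n. (\<Sum>f | f \<in> inv_cols N n \<pi> \<and> f a = f b. cmono n f) + (g a b + g b a))"
    by (intro sum.cong refl) (auto simp: split pairs_def)
  also have "\<dots> = (\<Sum>(a, b)\<in>pairs n. \<Sum>f | f \<in> inv_cols N n \<pi> \<and> f a = f b. cmono n f) +
      (\<Sum>(a, b)\<in>pairs n. g a b + g b a)"
    by (simp add: split_beta sum.distrib)
  also have "(\<Sum>(a, b)\<in>pairs n. g a b + g b a) = (\<Sum>a=0..<n. \<Sum>b\<in>{0..<n}-{a}. g a b)"
    by (rule sum_pairs_sym)
  also have "\<dots> = (\<Sum>a=0..<n. \<Sum>b\<in>{0..<n}-{a}. \<Sum>(i, j)\<in>pairs N.
     \<Sum>f | f \<in> inv_cols N n (transpose a b \<circ> \<pi>) \<and> f a = i \<and> f b = j. cmono n f)"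
  proof (intro sum.cong refl)
    fix a b assume ab: "a \<in> {0..<n}" "b \<in> {0..<n} - {a}"
    let ?I = "inv_cols N n (transpose a b \<circ> \<pi>)"
    have "(\<Sum>y\<in>pairs N. sum (cmono n) {x \<in> {f \<in> ?I. f b < f a}. (x a, x b) = y}) =
        sum (cmono n) {f \<in> ?I. f b < f a}"
      using ab by (intro sum.group[OF _ finite_pairs]) (auto simp: pairs_def inv_cols_def intro: cols_less)
    moreover have "(\<Sum>y\<in>pairs N. sum (cmono n) {x \<in> {f \<in> ?I. f b < f a}. (x a, x b) = y}) =
      (\<Sum>(i, j)\<in>pairs N. \<Sum>f | f \<in> ?I \<and> f a = i \<and> f b = j. cmono n f)"
      by (intro sum.cong refl) (auto simp: pairs_def intro!: sum.cong)
    ultimately show "g a b = (\<Sum>(i, j)\<in>pairs N. \<Sum>f | f \<in> ?I \<and> f a = i \<and> f b = j. cmono n f)"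
      by (simp add: g_def)
  qed
  also have "\<dots> = (\<Sum>(i, j)\<in>pairs N. cutsum N n \<pi> i j)"
  proof -
    have "\<dots> = (\<Sum>a=0..<n. \<Sum>(i, j)\<in>pairs N. \<Sum>b\<in>{0..<n}-{a}.
       \<Sum>f | f \<in> inv_cols N n (transpose a b \<circ> \<pi>) \<and> f a = i \<and> f b = j. cmono n f)"
      unfolding split_beta by (intro sum.cong refl sum.swap)
    also have "\<dots> = (\<Sum>(i, j)\<in>pairs N. cutsum N n \<pi> i j)"
      unfolding cutsum_def split_beta by (rule sum.swap)
    finally show ?thesis .
  qed
  also have "(\<Sum>(a, b)\<in>pairs n. \<Sum>f | f \<in> inv_cols N n \<pi> \<and> f a = f b. cmono n f) =
     (\<Sum>q\<in>pairs n. \<Sum>f\<in>inv_cols N n \<pi>. if f (fst q) = f (snd q) then cmono n f else 0)"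
    by (intro sum.cong refl) (simp add: split_beta sum.inter_filter[symmetric])
  also have "\<dots> = (\<Sum>f\<in>inv_cols N n \<pi>. \<Sum>q\<in>pairs n. if f (fst q) = f (snd q) then cmono n f else 0)"
    by (rule sum.swap)
  also have "\<dots> = (\<Sum>f\<in>inv_cols N n \<pi>. of_nat (card {(a, b) \<in> pairs n. f a = f b}) * cmono n f)"
  proof (rule sum.cong[OF refl])
    fix f :: "nat \<Rightarrow> nat"
    have "{(a, b) \<in> pairs n. f a = f b} = {q \<in> pairs n. f (fst q) = f (snd q)}" by auto
    then show "(\<Sum>q\<in>pairs n. if f (fst q) = f (snd q) then cmono n f else 0) =
       of_nat (card {(a, b) \<in> pairs n. f a = f b}) * cmono n f"
      by (simp add: sum.inter_filter[symmetric])
  qed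
  finally have main: "(\<Sum>(a, b)\<in>pairs n. powsum N n (transpose a b \<circ> \<pi>)) =
    (\<Sum>f\<in>inv_cols N n \<pi>. of_nat (card {(a, b) \<in> pairs n. f a = f b}) * cmono n f) +
    (\<Sum>(i, j)\<in>pairs N. cutsum N n \<pi> i j)" .
  have "(\<Sum>k=0..<N. theta k (theta k (powsum N n \<pi>))) =
     (\<Sum>k=0..<N. \<Sum>f\<in>inv_cols N n \<pi>. of_nat ((card {a. a < n \<and> f a = k})\<^sup>2) * cmono n f)"
  proof (rule sum.cong[OF refl])
    fix k
    have s: "theta k (of_nat m * q) = of_nat m * theta k q" for m q
      by (induction m) (auto simp: theta_add algebra_simps)
    show "theta k (theta k (powsum N n \<pi>)) =
        (\<Sum>f\<in>inv_cols N n \<pi>. of_nat ((card {a. a < n \<and> f a = k})\<^sup>2) * cmono n f)"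
      by (simp add: theta_powsum theta_sum s theta_cmono power2_eq_square mult.assoc)
  qed
  also have "\<dots> = (\<Sum>f\<in>inv_cols N n \<pi>. of_nat (\<Sum>k=0..<N. (card {a. a < n \<and> f a = k})\<^sup>2) * cmono n f)"
    by (subst sum.swap) (simp add: sum_distrib_right)
  also have "\<dots> = (\<Sum>f\<in>inv_cols N n \<pi>. of_nat (2 * card {(a, b) \<in> pairs n. f a = f b} + n) * cmono n f)"
    by (intro sum.cong refl) (subst card_equal_pairs[of _ N], auto simp: inv_cols_def)
  also have "\<dots> = 2 * (\<Sum>f\<in>inv_cols N n \<pi>. of_nat (card {(a, b) \<in> pairs n. f a = f b}) * cmono n f)
     + of_nat n * powsum N n \<pi>"
    by (simp add: powsum_def sum_distrib_left sum.distrib algebra_simps)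
  finally show ?thesis unfolding main by (simp add: algebra_simps)
qed

text \<open>By the Frobenius formula, for decreasing \<open>l\<close> this is the character value of \<open>\<pi>\<close> at the
  partition with parts \<open>l i\<close> shifted by the staircase.\<close>

definition chi :: "nat \<Rightarrow> nat \<Rightarrow> (nat \<Rightarrow> nat) \<Rightarrow> (nat \<Rightarrow> nat) \<Rightarrow> real" where
  "chi N n l \<pi> = Poly_Mapping.lookup (vdm N * powsum N n \<pi>) l"

text \<open>The sum of the contents of the partition with shifted parts \<open>l\<close>, which is the eigenvalue of
  the class of transpositions.\<close>

definition content_sum :: "nat \<Rightarrow> nat \<Rightarrow> (nat \<Rightarrow> nat) \<Rightarrow> real" where
  "content_sum N n l = ((\<Sum>k=0..<N. (real (l k))\<^sup>2) - (\<Sum>k=0..<N. (real k)\<^sup>2)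
      - (2 * real (N - 1) + 1) * real n) / 2"

lemma lookup_of_nat_mult: "Poly_Mapping.lookup (of_nat m * f) l = real m * Poly_Mapping.lookup f l"
  for f :: mpoly
  by (induction m) (auto simp: lookup_add algebra_simps)

text \<open>Both \<open>theta_sq_vdm_mult\<close> and \<open>cut_join\<close> contain the cut sums.
  Eliminating them expresses the sum over all transpositions through the operator that multiplies
  the coefficient at \<open>l\<close> by the sum of the squares of the \<open>l k\<close>. Taking
  the coefficient at \<open>l\<close> thus gives an eigenfunction, whatever the order of the entries
  of \<open>l\<close>.\<close>

lemma chi_transpositions:
  assumes \<pi>: "\<pi> permutes {0..<n}"
  shows "(\<Sum>(a, b)\<in>pairs n. chi N n l (transpose a b \<circ> \<pi>)) = content_sum N n l * chi N n l \<pi>"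
proof -
  let ?p = "powsum N n \<pi>"
  define M c where "M = N - 1" and "c = (\<Sum>k=0..<N. k\<^sup>2)"
  have "(\<Sum>k=0..<N. theta k (theta k (vdm N * ?p))) =
    vdm N * (of_nat c * ?p + 2 * (\<Sum>(i, j)\<in>pairs N. cutsum N n \<pi> i j)
      + 2 * (of_nat M * (of_nat n * ?p)) + (\<Sum>k=0..<N. theta k (theta k ?p)))"
    unfolding M_def c_def by (rule theta_sq_vdm_mult[OF cutsum_mult[OF \<pi>] theta_powsum_euler])
  also have "\<dots> = of_nat (c + 2 * M * n + n) * (vdm N * ?p) +
      of_nat 2 * (vdm N * (\<Sum>(a, b)\<in>pairs n. powsum N n (transpose a b \<circ> \<pi>)))"
    using arg_cong[OF cut_join[OF \<pi>, of N], of "\<lambda>x. vdm N * x"]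
    by (simp add: algebra_simps)
  finally have "Poly_Mapping.lookup (\<Sum>k=0..<N. theta k (theta k (vdm N * ?p))) l =
     Poly_Mapping.lookup (of_nat (c + 2 * M * n + n) * (vdm N * ?p) +
      of_nat 2 * (vdm N * (\<Sum>(a, b)\<in>pairs n. powsum N n (transpose a b \<circ> \<pi>)))) l" by simp
  then have "(\<Sum>k=0..<N. (real (l k))\<^sup>2) * chi N n l \<pi> = real (c + 2 * M * n + n) * chi N n l \<pi>
     + 2 * (\<Sum>(a, b)\<in>pairs n. chi N n l (transpose a b \<circ> \<pi>))"
    unfolding lookup_add lookup_of_nat_mult lookup_sum lookup_theta
    by (simp add: chi_def split_beta sum_distrib_left lookup_sum power2_eq_square
        sum_distrib_right mult.assoc)
  then show ?thesis by (simp add: content_sum_def field_simps M_def c_def)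
qed

lemma lookup_single_mult:
  "Poly_Mapping.lookup (Poly_Mapping.single d c * f) (d + l) = c * Poly_Mapping.lookup f l"
  for f :: mpoly
proof -
  have "Poly_Mapping.lookup (Poly_Mapping.single d c * f) (d + l) =
    (\<Sum>k\<in>Poly_Mapping.keys f. c * Poly_Mapping.lookup f k when d + k = d + l)"
    by (subst mpoly_expand[of f]) (simp add: sum_distrib_left mult_single lookup_sum lookup_single)
  also have "\<dots> = (\<Sum>k\<in>Poly_Mapping.keys f. if k = l then c * Poly_Mapping.lookup f k else 0)"
    by (intro sum.cong refl) (auto simp: when_def)
  also have "\<dots> = c * Poly_Mapping.lookup f l" by (simp add: in_keys_iff)
  finally show ?thesis .
qed

lemma lookup_indet_mult: "Poly_Mapping.lookup (indet i * f) l =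
   (if l i > 0 then Poly_Mapping.lookup f (l(i := l i - 1)) else 0)"
proof (cases "l i > 0")
  case True
  then have "l = (\<lambda>k. if k = i then 1 else 0) + l(i := l i - 1)" by (auto simp: fun_eq_iff)
  then have "Poly_Mapping.lookup (indet i * f) l =
     Poly_Mapping.lookup (indet i * f) ((\<lambda>k. if k = i then 1 else 0) + l(i := l i - 1))" by simp
  also have "\<dots> = Poly_Mapping.lookup f (l(i := l i - 1))"
    unfolding indet_def lookup_single_mult by simp
  finally show ?thesis using True by simp
next
  case False
  have "Poly_Mapping.lookup (indet i * f) l =
    (\<Sum>k\<in>Poly_Mapping.keys f. Poly_Mapping.lookup f k when (\<lambda>k. if k = i then 1 else 0) + k = l)"
    by (subst mpoly_expand[of f]) (simp add: indet_def sum_distrib_left mult_single lookup_sum lookup_single)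
  also have "\<dots> = 0" using False by (intro sum.neutral) (auto simp: when_def)
  finally show ?thesis using False by simp
qed

lemma powsum_Suc:
  assumes \<pi>: "\<pi> permutes {0..<n}"
  shows "powsum N (Suc n) \<pi> = (\<Sum>i=0..<N. indet i) * powsum N n \<pi>"
proof -
  have lt: "\<pi> a < n" if "a < n" for a using permutes_in_image[OF \<pi>, of a] that by simp
  have ne: "\<pi> a \<noteq> n" if "a < n" for a using lt[OF that] by simp
  have n: "\<pi> n = n" using permutes_not_in[OF \<pi>, of n] by simp
  have "(\<Sum>i=0..<N. indet i) * powsum N n \<pi> =
      (\<Sum>(i, f)\<in>{0..<N} \<times> inv_cols N n \<pi>. indet i * cmono n f)"
    unfolding powsum_def sum_product by (rule sum.cartesian_product)
  also have "\<dots> = (\<Sum>f\<in>inv_cols N (Suc n) \<pi>. cmono (Suc n) f)"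
  proof (rule sum.reindex_bij_witness[of _ "\<lambda>f. (f n, f(n := undefined))" "\<lambda>(i, f). f(n := i)"], goal_cases)
    case (1 q)
    then show ?case by (auto simp: inv_cols_def cols_def PiE_def extensional_def fun_eq_iff)
  next
    case (2 q)
    then show ?case using lt n ne
      by (auto simp: inv_cols_def cols_def PiE_def extensional_def Pi_def less_Suc_eq)
  next
    case (3 f)
    then show ?case by auto
  next
    case (4 f)
    then show ?case using lt
      by (auto simp: inv_cols_def cols_def PiE_def extensional_def Pi_def less_Suc_eq)
  next
    case (5 q)
    then show ?case by (auto simp: cmono_def mult.commute intro!: prod.cong)
  qed
  finally show ?thesis by (simp add: powsum_def)
qed

text \<open>The branching rule: the additional fixed point contributes the factor x_0 + ... +
  x_{N-1}, each summand of which lowers one exponent.\<close>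

lemma chi_Suc:
  assumes \<pi>: "\<pi> permutes {0..<n}"
  shows "chi N (Suc n) l \<pi> = (\<Sum>i=0..<N. if l i > 0 then chi N n (l(i := l i - 1)) \<pi> else 0)"
proof -
  have "vdm N * powsum N (Suc n) \<pi> = (\<Sum>i=0..<N. indet i * (vdm N * powsum N n \<pi>))"
    by (simp add: powsum_Suc[OF \<pi>] sum_distrib_right sum_distrib_left mult_ac)
  then show ?thesis by (simp add: chi_def lookup_sum lookup_indet_mult cong: if_cong)
qed

lemma chi_0: "chi N 0 l \<pi> =
  (\<Sum>w | w permutes {0..<N}. if l = (\<lambda>i. if i < N then w i else 0) then signof w else 0)"
proof -
  have "inv_cols N 0 \<pi> = {\<lambda>_. undefined}" by (auto simp: inv_cols_def cols_def)
  then have "powsum N 0 \<pi> = 1" by (simp add: powsum_def cmono_def)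
  then show ?thesis by (auto simp: chi_def vdm_sum lookup_sum lookup_single when_def intro!: sum.cong)
qed

text \<open>A linear stand-in for dividing by \<open>vdm N\<close> and setting all variables to 1.
  The weights are chosen so that \<open>vdm N\<close> times any monomial gets the value 1.\<close>

definition binom_eval :: "nat \<Rightarrow> mpoly \<Rightarrow> real" where
  "binom_eval N f = (\<Sum>l\<in>Poly_Mapping.keys f. Poly_Mapping.lookup f l * (\<Prod>i=0..<N. real (l i choose i)))"

lemma binom_eval_add: "binom_eval N (f + g) = binom_eval N f + binom_eval N g"
  unfolding binom_eval_def
  by (rule setsum_keys_plus_distrib[of "\<lambda>l c. c * (\<Prod>i=0..<N. real (l i choose i))"]) (auto simp: algebra_simps)

lemma binom_eval_sum: "binom_eval N (sum f A) = (\<Sum>a\<in>A. binom_eval N (f a))"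
proof (induction A rule: infinite_finite_induct)
  case (insert a A)
  then show ?case by (simp add: binom_eval_add)
qed (simp_all add: binom_eval_def)

lemma binom_eval_single: "binom_eval N (Poly_Mapping.single l c) = c * (\<Prod>i=0..<N. real (l i choose i))"
  by (cases "c = 0") (auto simp: binom_eval_def)

text \<open>By the Chu--Vandermonde convolution the matrix of the binomials is the product of a
  lower and an upper unitriangular matrix, for any shifts \<open>\<alpha> i\<close>.\<close>

lemma det_binomial_shift:
  "(\<Sum>w | w permutes {0..<N}. signof w * (\<Prod>i=0..<N. real ((w i + \<alpha> i) choose i))) = 1"
proof -
  define A where "A = mat N N (\<lambda>(i, k). if k \<le> i then real (\<alpha> i choose (i - k)) else 0)"
  define B where "B = mat N N (\<lambda>(k, j). real (j choose k))"
  have A[simp]: "A \<in> carrier_mat N N" and B[simp]: "B \<in> carrier_mat N N" by (auto simp: A_def B_def)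
  have "A * B = mat N N (\<lambda>(i, j). real ((j + \<alpha> i) choose i))"
  proof (rule eq_matI, goal_cases)
    case (1 i j)
    then have ij: "i < N" "j < N" by auto
    have "(A * B) $$ (i, j) = (\<Sum>k=0..<N. (if k \<le> i then real (\<alpha> i choose (i - k)) else 0) * real (j choose k))"
      using ij by (simp add: A_def B_def scalar_prod_def)
    also have "\<dots> = (\<Sum>k\<le>i. real (j choose k) * real (\<alpha> i choose (i - k)))"
      using ij by (intro sum.mono_neutral_cong_right) auto
    also have "\<dots> = real ((j + \<alpha> i) choose i)"
      by (subst vandermonde[symmetric]) simp
    finally show ?case using ij by simp
  qed (auto simp: A_def B_def)
  then have "det A * det B = det (mat N N (\<lambda>(i, j). real ((j + \<alpha> i) choose i)))"
    using det_mult[OF A B] by simp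
  moreover have "det A = 1"
    by (subst det_lower_triangular[of N]) (auto simp: A_def prod_list_diag_prod)
  moreover have "det B = 1"
    by (subst det_upper_triangular[of _ N]) (auto simp: B_def prod_list_diag_prod upper_triangular_def)
  moreover have "det (mat N N (\<lambda>(i, j). real ((j + \<alpha> i) choose i))) =
     (\<Sum>w | w permutes {0..<N}. signof w * (\<Prod>i=0..<N. real ((w i + \<alpha> i) choose i)))"
    unfolding det_def'[OF mat_carrier]
    by (intro sum.cong refl arg_cong2[of _ _ _ _ "(*)"] prod.cong) (auto simp: permutes_in_image)
  ultimately show ?thesis by simp
qed

lemma cmono_single:
  "cmono n f = Poly_Mapping.single (\<lambda>k. card {a. a < n \<and> f a = k}) 1"
proof (induction n)
  case 0
  have "(\<lambda>k::nat. 0::nat) = 0" by (simp add: zero_fun_def)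
  then show ?case by (simp add: cmono_def)
next
  case (Suc n)
  have "card {a. a < Suc n \<and> f a = k} = card {a. a < n \<and> f a = k} + (if k = f n then 1 else 0)" for k
  proof -
    have "{a. a < Suc n \<and> f a = k} = {a. a < n \<and> f a = k} \<union> (if k = f n then {n} else {})"
      by (auto simp: less_Suc_eq)
    then show ?thesis by (auto simp: card_insert_if)
  qed
  then have "(\<lambda>k. card {a. a < Suc n \<and> f a = k}) =
     (\<lambda>k. card {a. a < n \<and> f a = k}) + (\<lambda>k. if k = f n then 1 else 0)"
    by (simp add: fun_eq_iff)
  moreover have "cmono (Suc n) f = cmono n f * indet (f n)" by (simp add: cmono_def)
  ultimately show ?case using Suc by (simp add: indet_def mult_single)
qed

lemma binom_eval_vdm_powsum: "binom_eval N (vdm N * powsum N n \<pi>) = real (card (inv_cols N n \<pi>))"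
proof -
  have "binom_eval N (vdm N * cmono n f) = 1" for f
  proof -
    let ?\<alpha> = "\<lambda>k. card {a. a < n \<and> f a = k}"
    have "binom_eval N (vdm N * cmono n f) =
       (\<Sum>w | w permutes {0..<N}. signof w * (\<Prod>i=0..<N. real ((w i + ?\<alpha> i) choose i)))"
      unfolding vdm_sum cmono_single sum_distrib_right binom_eval_sum mult_single binom_eval_single
      by (intro sum.cong refl arg_cong2[of _ _ _ _ "(*)"] prod.cong) auto
    then show ?thesis by (simp only: det_binomial_shift)
  qed
  then show ?thesis by (simp add: powsum_def sum_distrib_left binom_eval_sum)
qed

section \<open>Cycle numbers\<close>

definition ncyc :: "'a set \<Rightarrow> ('a \<Rightarrow> 'a) \<Rightarrow> nat" where
  "ncyc S \<pi> = card (orbit \<pi> ` S)"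

lemma card_inv_cols:
  assumes \<pi>: "\<pi> permutes {0..<n}"
  shows "card (inv_cols N n \<pi>) = N ^ ncyc {0..<n} \<pi>"
proof -
  have perm: "permutation \<pi>" using \<pi> by (auto simp: permutation_permutes)
  have lt: "\<pi> a < n \<longleftrightarrow> a < n" for a using permutes_in_image[OF \<pi>, of a] by simp
  have orb: "orbit \<pi> (\<pi> a) = orbit \<pi> a" for a by (rule permutation_orbit_step[OF perm])
  have self: "a \<in> orbit \<pi> a" for a by (rule permutation_self_in_orbit[OF perm])
  let ?C = "orbit \<pi> ` {0..<n}"
  define pick where "pick c = (SOME a. a < n \<and> orbit \<pi> a = c)" for c
  have pick: "pick c < n" "orbit \<pi> (pick c) = c" if "c \<in> ?C" for c
  proof -
    have "\<exists>a. a < n \<and> orbit \<pi> a = c" using that by auto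
    from someI_ex[OF this] show "pick c < n" "orbit \<pi> (pick c) = c" unfolding pick_def by auto
  qed
  have const: "f b = f a" if f: "f \<in> inv_cols N n \<pi>" and a: "a < n" and b: "b \<in> orbit \<pi> a" for f a b
  proof -
    from b have "f b = f a \<and> b < n"
      by induction (use f a lt in \<open>auto simp: inv_cols_def\<close>)
    then show ?thesis ..
  qed
  have "bij_betw (\<lambda>g. \<lambda>a. if a < n then g (orbit \<pi> a) else undefined) (?C \<rightarrow>\<^sub>E {0..<N}) (inv_cols N n \<pi>)"
  proof (rule bij_betw_byWitness[where f' = "\<lambda>f. \<lambda>c. if c \<in> ?C then f (pick c) else undefined"])
    show "\<forall>g\<in>?C \<rightarrow>\<^sub>E {0..<N}. (\<lambda>c. if c \<in> ?C then (\<lambda>a. if a < n then g (orbit \<pi> a) else undefined) (pick c) else undefined) = g"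
      using pick by (auto simp: fun_eq_iff PiE_def extensional_def)
    show "\<forall>f\<in>inv_cols N n \<pi>. (\<lambda>a. if a < n then (\<lambda>c. if c \<in> ?C then f (pick c) else undefined) (orbit \<pi> a) else undefined) = f"
    proof
      fix f assume f: "f \<in> inv_cols N n \<pi>"
      have "f (pick (orbit \<pi> a)) = f a" if "a < n" for a
      proof (rule const[OF f that])
        have "orbit \<pi> a \<in> ?C" using that by auto
        then have "orbit \<pi> (pick (orbit \<pi> a)) = orbit \<pi> a" by (rule pick)
        then show "pick (orbit \<pi> a) \<in> orbit \<pi> a" using self by metis
      qed
      then show "(\<lambda>a. if a < n then (\<lambda>c. if c \<in> ?C then f (pick c) else undefined) (orbit \<pi> a) else undefined) = f"
        using f by (auto simp: fun_eq_iff inv_cols_def cols_def PiE_def extensional_def)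
    qed
    show "(\<lambda>g. \<lambda>a. if a < n then g (orbit \<pi> a) else undefined) ` (?C \<rightarrow>\<^sub>E {0..<N}) \<subseteq> inv_cols N n \<pi>"
      by (auto simp: inv_cols_def cols_def PiE_def extensional_def Pi_def lt orb)
    show "(\<lambda>f. \<lambda>c. if c \<in> ?C then f (pick c) else undefined) ` inv_cols N n \<pi> \<subseteq> ?C \<rightarrow>\<^sub>E {0..<N}"
      using pick by (auto simp: inv_cols_def cols_def PiE_def extensional_def Pi_def)
  qed
  then have "card (inv_cols N n \<pi>) = card (?C \<rightarrow>\<^sub>E {0..<N})" by (simp add: bij_betw_same_card)
  also have "\<dots> = N ^ card ?C" by (simp add: card_PiE)
  finally show ?thesis by (simp add: ncyc_def)
qed

lemma ncyc_fix_last: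
  assumes q: "q permutes {0..<n}"
  shows "ncyc {0..<Suc n} q = Suc (ncyc {0..<n} q)"
proof -
  have perm: "permutation q" using q by (auto simp: permutation_permutes)
  have "q n = n" using permutes_not_in[OF q, of n] by simp
  then have "orbit q n = {n}" by (simp add: orbit_eq_singleton_iff)
  moreover have "{n} \<notin> orbit q ` {0..<n}"
    using permutation_self_in_orbit[OF perm] by (auto simp: set_eq_iff) (metis less_irrefl)
  moreover have "{0..<Suc n} = insert n {0..<n}" by auto
  ultimately show ?thesis by (simp add: ncyc_def)
qed

text \<open>The invariant colourings with two colours determine the number of cycles, as the
  exponent of a power of 2. Here the point \<open>n\<close> is inserted into the cycle of
  \<open>b\<close> and has to take its colour, so both permutations have equally many
  colourings.\<close>

lemma ncyc_insert_last:
  assumes q: "q permutes {0..<n}" and b: "b < n"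
  shows "ncyc {0..<Suc n} (transpose n b \<circ> q) = ncyc {0..<n} q"
proof -
  have lt: "q a < n \<longleftrightarrow> a < n" for a using permutes_in_image[OF q, of a] by simp
  have ne: "q a \<noteq> n" if "a < n" for a using lt[of a] that by auto
  have n: "q n = n" using permutes_not_in[OF q, of n] by simp
  have p: "transpose n b \<circ> q permutes {0..<Suc n}"
    using b by (intro permutes_compose permutes_swap_id permutes_subset[OF q]) auto
  have "bij_betw (\<lambda>f. f(n := undefined)) (inv_cols 2 (Suc n) (transpose n b \<circ> q)) (inv_cols 2 n q)"
  proof (rule bij_betw_byWitness[where f' = "\<lambda>f. f(n := f b)"])
    have fb: "f n = f b" if "f \<in> inv_cols 2 (Suc n) (transpose n b \<circ> q)" for f
      using that n by (auto simp: inv_cols_def dest!: spec[of _ n])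
    show "\<forall>f\<in>inv_cols 2 (Suc n) (transpose n b \<circ> q). (f(n := undefined))(n := (f(n := undefined)) b) = f"
      using fb[symmetric] b by (auto simp: fun_eq_iff)
    show "\<forall>f\<in>inv_cols 2 n q. (f(n := f b))(n := undefined) = f"
      by (auto simp: fun_eq_iff inv_cols_def cols_def PiE_def extensional_def)
    show "(\<lambda>f. f(n := undefined)) ` inv_cols 2 (Suc n) (transpose n b \<circ> q) \<subseteq> inv_cols 2 n q"
    proof (rule image_subsetI)
      fix f assume f: "f \<in> inv_cols 2 (Suc n) (transpose n b \<circ> q)"
      have "f (q a) = f a" if a: "a < n" for a
      proof -
        have "f (transpose n b (q a)) = f a" using f a by (auto simp: inv_cols_def)
        then show ?thesis using fb[OF f] ne[OF a] by (auto simp: transpose_def split: if_splits)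
      qed
      then show "f(n := undefined) \<in> inv_cols 2 n q"
        using f lt ne by (auto simp: inv_cols_def cols_def PiE_def extensional_def Pi_def)
    qed
    show "(\<lambda>f. f(n := f b)) ` inv_cols 2 n q \<subseteq> inv_cols 2 (Suc n) (transpose n b \<circ> q)"
    proof (rule image_subsetI)
      fix f assume f: "f \<in> inv_cols 2 n q"
      let ?f = "f(n := f b)"
      have "?f (transpose n b (q a)) = ?f a" if "a < Suc n" for a
      proof (cases "a = n")
        case True then show ?thesis using n b by simp
      next
        case False
        then have a: "a < n" using that by simp
        then have "f (q a) = f a" using f by (simp add: inv_cols_def)
        then show ?thesis using a ne[OF a] b by (auto simp: transpose_def)
      qed
      then show "?f \<in> inv_cols 2 (Suc n) (transpose n b \<circ> q)"
        using f b by (auto simp: inv_cols_def cols_def PiE_def extensional_def Pi_def less_Suc_eq)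
    qed
  qed
  then have "card (inv_cols 2 (Suc n) (transpose n b \<circ> q)) = card (inv_cols 2 n q)"
    by (rule bij_betw_same_card)
  then show ?thesis by (simp add: card_inv_cols[OF q] card_inv_cols[OF p])
qed

section \<open>Jucys--Murphy elements\<close>

text \<open>The element of the group algebra with coefficient \<open>u ^ ncyc\<close> at each
  permutation, acting on functions by translation. Its iterates run through tuples of permutations
  and evaluate at their product.\<close>

definition Xop :: "real \<Rightarrow> nat \<Rightarrow> ((nat \<Rightarrow> nat) \<Rightarrow> real) \<Rightarrow> (nat \<Rightarrow> nat) \<Rightarrow> real" where
  "Xop u n h \<pi> = (\<Sum>\<sigma> | \<sigma> permutes {0..<n}. u ^ ncyc {0..<n} \<sigma> * h (\<sigma> \<circ> \<pi>))"

text \<open>Multiplication by \<open>u\<close> plus the Jucys--Murphy element of the point \<open>n\<close>.\<close>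

definition Bop :: "real \<Rightarrow> nat \<Rightarrow> ((nat \<Rightarrow> nat) \<Rightarrow> real) \<Rightarrow> (nat \<Rightarrow> nat) \<Rightarrow> real" where
  "Bop u n h \<pi> = u * h \<pi> + (\<Sum>j=0..<n. h (transpose n j \<circ> \<pi>))"

text \<open>A permutation of \<open>n + 1\<close> points is uniquely a transposition of
  \<open>n\<close> and \<open>b\<close> after a permutation fixing \<open>n\<close>. For
  \<open>b = n\<close> it has one more cycle, which gives the factor \<open>u\<close>; any other
  \<open>b\<close> inserts \<open>n\<close> into an existing cycle.\<close>

lemma Xop_Suc: "Xop u (Suc n) h = Xop u n (Bop u n h)"
proof
  fix \<pi>
  let ?P = "{q. q permutes {0..<n}}"
  have ins: "{0..<Suc n} = insert n {0..<n}" by auto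
  have "Xop u (Suc n) h \<pi> =
    (\<Sum>b\<in>insert n {0..<n}. \<Sum>q\<in>?P. u ^ ncyc {0..<Suc n} (transpose n b \<circ> q) * h (transpose n b \<circ> q \<circ> \<pi>))"
    unfolding Xop_def ins by (subst sum_over_permutations_insert) auto
  also have "\<dots> = (\<Sum>q\<in>?P. u ^ ncyc {0..<Suc n} q * h (q \<circ> \<pi>)) +
     (\<Sum>b=0..<n. \<Sum>q\<in>?P. u ^ ncyc {0..<Suc n} (transpose n b \<circ> q) * h (transpose n b \<circ> q \<circ> \<pi>))"
    by simp
  also have "(\<Sum>q\<in>?P. u ^ ncyc {0..<Suc n} q * h (q \<circ> \<pi>)) =
     (\<Sum>q\<in>?P. u ^ ncyc {0..<n} q * (u * h (q \<circ> \<pi>)))"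
    by (intro sum.cong refl) (simp add: ncyc_fix_last)
  also have "(\<Sum>b=0..<n. \<Sum>q\<in>?P. u ^ ncyc {0..<Suc n} (transpose n b \<circ> q) * h (transpose n b \<circ> q \<circ> \<pi>)) =
    (\<Sum>b=0..<n. \<Sum>q\<in>?P. u ^ ncyc {0..<n} q * h (transpose n b \<circ> (q \<circ> \<pi>)))"
    by (intro sum.cong refl) (simp add: ncyc_insert_last o_assoc)
  also have "\<dots> = (\<Sum>q\<in>?P. \<Sum>b=0..<n. u ^ ncyc {0..<n} q * h (transpose n b \<circ> (q \<circ> \<pi>)))"
    by (rule sum.swap)
  finally show "Xop u (Suc n) h \<pi> = Xop u n (Bop u n h) \<pi>"
    by (simp add: Xop_def Bop_def algebra_simps sum.distrib sum_distrib_left o_def)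
qed

text \<open>Conjugation by a permutation that fixes \<open>n\<close> permutes the transpositions
  moving \<open>n\<close>.\<close>

lemma sum_transpose_commute:
  fixes n :: nat
  assumes \<sigma>: "\<sigma> permutes {0..<n}"
  shows "(\<Sum>j=0..<n. h (\<sigma> \<circ> (transpose n j \<circ> \<pi>))) = (\<Sum>j=0..<n. h (transpose n j \<circ> (\<sigma> \<circ> \<pi>)))"
proof -
  have n: "\<sigma> n = n" using permutes_not_in[OF \<sigma>, of n] by simp
  have "\<sigma> \<circ> transpose n j = transpose n (\<sigma> j) \<circ> \<sigma>" for j
    using permutes_inj[OF \<sigma>] n by (auto simp: fun_eq_iff transpose_def inj_eq)
  then have "(\<Sum>j=0..<n. h (\<sigma> \<circ> (transpose n j \<circ> \<pi>))) = (\<Sum>j=0..<n. h (transpose n (\<sigma> j) \<circ> (\<sigma> \<circ> \<pi>)))"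
    by (simp add: o_assoc)
  also have "\<dots> = (\<Sum>j=0..<n. h (transpose n j \<circ> (\<sigma> \<circ> \<pi>)))"
    using sum.permute[OF \<sigma>, of "\<lambda>j. h (transpose n j \<circ> (\<sigma> \<circ> \<pi>))"] by (simp add: o_def)
  finally show ?thesis .
qed

lemma Xop_Bop_commute: "Xop u n (Bop u n h) = Bop u n (Xop u n h)"
proof
  fix \<pi>
  let ?P = "{q. q permutes {0..<n}}"
  have "Bop u n (Xop u n h) \<pi> = (\<Sum>\<sigma>\<in>?P. u ^ ncyc {0..<n} \<sigma> * (u * h (\<sigma> \<circ> \<pi>)))
      + (\<Sum>j=0..<n. \<Sum>\<sigma>\<in>?P. u ^ ncyc {0..<n} \<sigma> * h (\<sigma> \<circ> (transpose n j \<circ> \<pi>)))"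
    by (simp add: Bop_def Xop_def sum_distrib_left mult_ac)
  also have "(\<Sum>j=0..<n. \<Sum>\<sigma>\<in>?P. u ^ ncyc {0..<n} \<sigma> * h (\<sigma> \<circ> (transpose n j \<circ> \<pi>))) =
     (\<Sum>\<sigma>\<in>?P. u ^ ncyc {0..<n} \<sigma> * (\<Sum>j=0..<n. h (\<sigma> \<circ> (transpose n j \<circ> \<pi>))))"
    by (subst sum.swap) (simp add: sum_distrib_left)
  also have "\<dots> = (\<Sum>\<sigma>\<in>?P. u ^ ncyc {0..<n} \<sigma> * (\<Sum>j=0..<n. h (transpose n j \<circ> (\<sigma> \<circ> \<pi>))))"
    by (intro sum.cong refl) (simp add: sum_transpose_commute)
  finally show "Xop u n (Bop u n h) \<pi> = Bop u n (Xop u n h) \<pi>"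
    by (simp add: Xop_def Bop_def sum.distrib algebra_simps o_def)
qed

text \<open>As the last factor commutes with the rest, all its \<open>m\<close> copies can be
  collected and applied first. This lets the recursion over \<open>n\<close> treat all entries of
  the tuple at once.\<close>

lemma Xop_Suc_funpow: "(Xop u (Suc n) ^^ m) h = (Xop u n ^^ m) ((Bop u n ^^ m) h)"
proof (induction m arbitrary: h)
  case (Suc m)
  have c: "(Bop u n ^^ k) (Xop u n h) = Xop u n ((Bop u n ^^ k) h)" for k h
    by (induction k) (auto simp: Xop_Bop_commute)
  have "(Xop u (Suc n) ^^ Suc m) h = (Xop u (Suc n) ^^ m) (Xop u n (Bop u n h))"
    by (simp add: funpow_swap1 Xop_Suc)
  also have "\<dots> = (Xop u n ^^ m) (Xop u n ((Bop u n ^^ m) (Bop u n h)))"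
    by (simp add: Suc c)
  finally show ?case by (simp add: funpow_swap1)
qed simp

lemma Xop_cong:
  assumes "\<pi> permutes {0..<n}" "\<And>\<rho>. \<rho> permutes {0..<n} \<Longrightarrow> h \<rho> = h' \<rho>"
  shows "Xop u n h \<pi> = Xop u n h' \<pi>"
  unfolding Xop_def using assms by (intro sum.cong refl arg_cong2[of _ _ _ _ "(*)"] assms(2)) (auto intro: permutes_compose)

lemma Xop_funpow_cong:
  assumes "\<pi> permutes {0..<n}" "\<And>\<rho>. \<rho> permutes {0..<n} \<Longrightarrow> h \<rho> = h' \<rho>"
  shows "(Xop u n ^^ m) h \<pi> = (Xop u n ^^ m) h' \<pi>"
  using assms(1)
proof (induction m arbitrary: \<pi>)
  case (Suc m)
  then show ?case by (auto intro!: Xop_cong)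
qed (use assms in auto)

lemma Xop_sum: "Xop u n (\<lambda>\<pi>. \<Sum>i\<in>A. c i * h i \<pi>) \<pi> = (\<Sum>i\<in>A. c i * Xop u n (h i) \<pi>)"
  unfolding Xop_def sum_distrib_left by (subst sum.swap) (simp add: mult_ac)

lemma Xop_funpow_sum:
  "(Xop u n ^^ m) (\<lambda>\<pi>. \<Sum>i\<in>A. c i * h i \<pi>) \<pi> = (\<Sum>i\<in>A. c i * (Xop u n ^^ m) (h i) \<pi>)"
proof (induction m arbitrary: \<pi>)
  case (Suc m)
  have "(Xop u n ^^ m) (\<lambda>\<pi>. \<Sum>i\<in>A. c i * h i \<pi>) = (\<lambda>\<pi>. \<Sum>i\<in>A. c i * (Xop u n ^^ m) (h i) \<pi>)"
    using Suc by blast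
  then show ?case by (simp add: Xop_sum)
qed simp

text \<open>The Jucys--Murphy element is the class sum of transpositions on \<open>n + 1\<close>
  points minus the one on \<open>n\<close> points. The former is a scalar on \<open>chi\<close>; the
  latter commutes with \<open>Bop\<close>, so the relation passes on to all powers.\<close>

lemma Bop_chi:
  assumes N: "N \<ge> 1" and \<pi>: "\<pi> permutes {0..<Suc n}"
  shows "(Bop (real N) n ^^ Suc k) (chi N (Suc n) l) \<pi> =
     (real N + content_sum N (Suc n) l) * (Bop (real N) n ^^ k) (chi N (Suc n) l) \<pi>
     - (\<Sum>(a, b)\<in>pairs n. (Bop (real N) n ^^ k) (chi N (Suc n) l) (transpose a b \<circ> \<pi>))"
  using \<pi>
proof (induction k arbitrary: \<pi>)
  case 0
  have "pairs (Suc n) = pairs n \<union> Pair n ` {0..<n}" by (auto simp: pairs_def)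
  moreover have "pairs n \<inter> Pair n ` {0..<n} = {}" by (auto simp: pairs_def)
  ultimately have "(\<Sum>(a, b)\<in>pairs (Suc n). chi N (Suc n) l (transpose a b \<circ> \<pi>)) =
     (\<Sum>(a, b)\<in>pairs n. chi N (Suc n) l (transpose a b \<circ> \<pi>)) + (\<Sum>j=0..<n. chi N (Suc n) l (transpose n j \<circ> \<pi>))"
    by (simp add: sum.union_disjoint sum.reindex inj_on_def)
  then show ?case using chi_transpositions[OF 0, of N l] by (simp add: Bop_def algebra_simps split_beta o_def)
next
  case (Suc k)
  let ?h = "(Bop (real N) n ^^ k) (chi N (Suc n) l)" and ?c = "real N + content_sum N (Suc n) l"
  have tr: "transpose a b \<circ> \<rho> permutes {0..<Suc n}" if "a \<le> n" "b \<le> n" "\<rho> permutes {0..<Suc n}" for a b \<rho>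
    using that by (intro permutes_compose permutes_swap_id) auto
  have "(Bop (real N) n ^^ Suc (Suc k)) (chi N (Suc n) l) \<pi> =
    real N * (Bop (real N) n ^^ Suc k) (chi N (Suc n) l) \<pi>
     + (\<Sum>j=0..<n. (Bop (real N) n ^^ Suc k) (chi N (Suc n) l) (transpose n j \<circ> \<pi>))"
    by (simp add: Bop_def)
  also have "\<dots> = real N * (?c * ?h \<pi> - (\<Sum>(a, b)\<in>pairs n. ?h (transpose a b \<circ> \<pi>)))
     + (\<Sum>j=0..<n. ?c * ?h (transpose n j \<circ> \<pi>) - (\<Sum>(a, b)\<in>pairs n. ?h (transpose a b \<circ> (transpose n j \<circ> \<pi>))))"
    using Suc.prems by (intro arg_cong2[of _ _ _ _ "(+)"] arg_cong2[of _ _ _ _ "(*)"] refl sum.cong Suc.IH tr) auto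
  also have "\<dots> = ?c * Bop (real N) n ?h \<pi> - (real N * (\<Sum>(a, b)\<in>pairs n. ?h (transpose a b \<circ> \<pi>))
      + (\<Sum>j=0..<n. \<Sum>(a, b)\<in>pairs n. ?h (transpose a b \<circ> (transpose n j \<circ> \<pi>))))"
    by (simp add: Bop_def algebra_simps sum_subtractf sum_distrib_left sum.distrib)
  also have "(\<Sum>j=0..<n. \<Sum>(a, b)\<in>pairs n. ?h (transpose a b \<circ> (transpose n j \<circ> \<pi>))) =
     (\<Sum>(a, b)\<in>pairs n. \<Sum>j=0..<n. ?h (transpose a b \<circ> (transpose n j \<circ> \<pi>)))"
    unfolding split_beta by (rule sum.swap)
  also have "\<dots> = (\<Sum>(a, b)\<in>pairs n. \<Sum>j=0..<n. ?h (transpose n j \<circ> (transpose a b \<circ> \<pi>)))"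
    by (intro sum.cong refl) (auto simp: pairs_def intro!: sum_transpose_commute permutes_swap_id)
  also have "real N * (\<Sum>(a, b)\<in>pairs n. ?h (transpose a b \<circ> \<pi>)) + \<dots> =
     (\<Sum>(a, b)\<in>pairs n. Bop (real N) n ?h (transpose a b \<circ> \<pi>))"
    by (simp add: Bop_def split_beta sum.distrib sum_distrib_left)
  finally show ?case by (simp add: split_beta o_def)
qed

text \<open>Restricted to permutations of \<open>n\<close> points, \<open>chi\<close> splits by the
  branching rule into pieces on which the smaller class sum is a scalar too. On the piece with
  \<open>l i\<close> lowered the operator is therefore the scalar given by the difference of two
  content sums.\<close>

lemma Bop_chi_funpow:
  assumes N: "N \<ge> 1" and \<pi>: "\<pi> permutes {0..<n}"
  shows "(Bop (real N) n ^^ k) (chi N (Suc n) l) \<pi> =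
    (\<Sum>i=0..<N. real (l i) ^ k * (if l i > 0 then chi N n (l(i := l i - 1)) \<pi> else 0))"
  using \<pi>
proof (induction k arbitrary: \<pi>)
  case 0
  then show ?case by (simp add: chi_Suc)
next
  case (Suc k)
  let ?c = "real N + content_sum N (Suc n) l"
  let ?g = "\<lambda>i \<rho>. if l i > 0 then chi N n (l(i := l i - 1)) \<rho> else 0"
  have \<pi>': "\<pi> permutes {0..<Suc n}" using Suc.prems by (rule permutes_subset) auto
  have tr: "transpose a b \<circ> \<pi> permutes {0..<n}" if "(a, b) \<in> pairs n" for a b
    using that Suc.prems by (intro permutes_compose permutes_swap_id) (auto simp: pairs_def)
  have "(Bop (real N) n ^^ Suc k) (chi N (Suc n) l) \<pi> =
     ?c * (\<Sum>i=0..<N. real (l i) ^ k * ?g i \<pi>)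
     - (\<Sum>(a, b)\<in>pairs n. \<Sum>i=0..<N. real (l i) ^ k * ?g i (transpose a b \<circ> \<pi>))"
    unfolding Bop_chi[OF N \<pi>'] Suc.IH[OF Suc.prems]
    by (intro arg_cong2[of _ _ _ _ "(-)"] refl sum.cong) (clarsimp, rule Suc.IH[OF tr])
  also have "(\<Sum>(a, b)\<in>pairs n. \<Sum>i=0..<N. real (l i) ^ k * ?g i (transpose a b \<circ> \<pi>)) =
    (\<Sum>i=0..<N. \<Sum>(a, b)\<in>pairs n. real (l i) ^ k * ?g i (transpose a b \<circ> \<pi>))"
    unfolding split_beta by (rule sum.swap)
  also have "\<dots> = (\<Sum>i=0..<N. real (l i) ^ k * (content_sum N n (l(i := l i - 1)) * ?g i \<pi>))"
    using chi_transpositions[OF Suc.prems, of N]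
    by (intro sum.cong refl) (auto simp: split_beta sum_distrib_left[symmetric])
  also have "?c * (\<Sum>i=0..<N. real (l i) ^ k * ?g i \<pi>) - \<dots> = (\<Sum>i=0..<N. real (l i) ^ Suc k * ?g i \<pi>)"
    unfolding sum_distrib_left sum_subtractf[symmetric]
  proof (rule sum.cong[OF refl])
    fix i assume i: "i \<in> {0..<N}"
    show "?c * (real (l i) ^ k * ?g i \<pi>) - real (l i) ^ k * (content_sum N n (l(i := l i - 1)) * ?g i \<pi>) =
       real (l i) ^ Suc k * ?g i \<pi>"
    proof (cases "l i > 0")
      case True
      have "(\<Sum>k=0..<N. (real ((l(i := l i - 1)) k))\<^sup>2) = (real (l i) - 1)\<^sup>2 + (\<Sum>k\<in>{0..<N}-{i}. (real (l k))\<^sup>2)"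
        using i True by (subst sum.remove[of _ i]) (auto intro!: sum.cong)
      moreover have "(\<Sum>k=0..<N. (real (l k))\<^sup>2) = (real (l i))\<^sup>2 + (\<Sum>k\<in>{0..<N}-{i}. (real (l k))\<^sup>2)"
        using i by (subst sum.remove[of _ i]) auto
      \<comment> \<open>The removed box has content \<open>l i - N\<close>, and the summand
        \<open>N\<close> of the operator cancels the shift.\<close>
      ultimately have "?c - content_sum N n (l(i := l i - 1)) = real (l i)"
        using N by (simp add: content_sum_def field_simps power2_eq_square of_nat_diff)
      then have "?c = real (l i) + content_sum N n (l(i := l i - 1))" by linarith
      then show ?thesis by (simp add: algebra_simps)
    qed simp
  qed
  finally show ?case .
qed

section \<open>Closed form of the values at the identity\<close>

definition ychi :: "nat \<Rightarrow> nat \<Rightarrow> nat \<Rightarrow> (nat \<Rightarrow> nat) \<Rightarrow> real" where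
  "ychi m N n l = (Xop (real N) n ^^ m) (chi N n l) id"

lemma ychi_Suc:
  assumes N: "N \<ge> 1"
  shows "ychi m N (Suc n) l =
    (\<Sum>i=0..<N. if l i > 0 then real (l i) ^ m * ychi m N n (l(i := l i - 1)) else 0)"
proof -
  have "ychi m N (Suc n) l = (Xop (real N) n ^^ m)
     (\<lambda>\<pi>. \<Sum>i=0..<N. (if l i > 0 then real (l i) ^ m else 0) * chi N n (l(i := l i - 1)) \<pi>) id"
    unfolding ychi_def Xop_Suc_funpow
    by (rule Xop_funpow_cong) (auto simp: permutes_id Bop_chi_funpow[OF N] intro!: sum.cong)
  also have "\<dots> = (\<Sum>i=0..<N. (if l i > 0 then real (l i) ^ m else 0) * ychi m N n (l(i := l i - 1)))"
    unfolding Xop_funpow_sum ychi_def ..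
  also have "\<dots> = (\<Sum>i=0..<N. if l i > 0 then real (l i) ^ m * ychi m N n (l(i := l i - 1)) else 0)"
    by (intro sum.cong) auto
  finally show ?thesis .
qed

definition exps :: "nat \<Rightarrow> nat \<Rightarrow> (nat \<Rightarrow> nat) set" where
  "exps N M = {l. (\<forall>i\<ge>N. l i = 0) \<and> (\<Sum>i=0..<N. l i) = M}"

lemma exps_Suc: "exps (Suc N) M = (\<Union>k\<in>{0..M}. (\<lambda>l. l(N := k)) ` exps N (M - k))"
proof (intro equalityI subsetI)
  fix l assume l: "l \<in> exps (Suc N) M"
  then have "l(N := 0) \<in> exps N (M - l N)" "l N \<le> M" by (auto simp: exps_def)
  moreover have "l = (l(N := 0))(N := l N)" by simp
  ultimately show "l \<in> (\<Union>k\<in>{0..M}. (\<lambda>l. l(N := k)) ` exps N (M - k))" by fastforce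
next
  fix l assume "l \<in> (\<Union>k\<in>{0..M}. (\<lambda>l. l(N := k)) ` exps N (M - k))"
  then show "l \<in> exps (Suc N) M" by (auto simp: exps_def)
qed

lemma finite_exps [simp]: "finite (exps N M)"
proof (induction N arbitrary: M)
  case 0
  have "exps 0 M \<subseteq> {\<lambda>_. 0}" by (auto simp: exps_def)
  then show ?case by (rule finite_subset) simp
next
  case (Suc N)
  then show ?case by (simp add: exps_Suc)
qed

lemma fps_prod_nth_exps:
  fixes F :: "nat \<Rightarrow> 'a::comm_ring_1 fps"
  shows "fps_nth (\<Prod>i=0..<N. F i) M = (\<Sum>l\<in>exps N M. \<Prod>i=0..<N. fps_nth (F i) (l i))"
proof (induction N arbitrary: M)
  case 0
  have "exps 0 M = (if M = 0 then {\<lambda>_. 0} else {})" by (auto simp: exps_def)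
  then show ?case by simp
next
  case (Suc N)
  have "(\<Sum>l\<in>exps (Suc N) M. \<Prod>i=0..<Suc N. fps_nth (F i) (l i)) =
     (\<Sum>k\<in>{0..M}. \<Sum>l\<in>(\<lambda>l. l(N := k)) ` exps N (M - k). \<Prod>i=0..<Suc N. fps_nth (F i) (l i))"
    unfolding exps_Suc by (rule sum.UNION_disjoint) (auto dest: fun_cong[of _ _ N])
  also have "\<dots> = (\<Sum>k\<in>{0..M}. \<Sum>l\<in>exps N (M - k). fps_nth (F N) k * (\<Prod>i=0..<N. fps_nth (F i) (l i)))"
  proof (rule sum.cong[OF refl])
    fix k
    have "inj_on (\<lambda>l. l(N := k)) (exps N (M - k))"
    proof (rule inj_onI)
      fix l l' assume a: "l \<in> exps N (M - k)" "l' \<in> exps N (M - k)" "l(N := k) = l'(N := k)"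
      have "l x = l' x" for x using a(1,2) fun_cong[OF a(3), of x] by (cases "x = N") (auto simp: exps_def)
      then show "l = l'" by auto
    qed
    then show "(\<Sum>l\<in>(\<lambda>l. l(N := k)) ` exps N (M - k). \<Prod>i=0..<Suc N. fps_nth (F i) (l i)) =
       (\<Sum>l\<in>exps N (M - k). fps_nth (F N) k * (\<Prod>i=0..<N. fps_nth (F i) (l i)))"
      by (subst sum.reindex) (auto simp: mult.commute intro!: sum.cong prod.cong)
  qed
  also have "\<dots> = fps_nth (F N * (\<Prod>i=0..<N. F i)) M"
    by (simp add: fps_mult_nth Suc sum_distrib_left)
  finally show ?case by (simp add: mult.commute)
qed

abbreviation tri :: "nat \<Rightarrow> nat" where "tri N \<equiv> \<Sum>i=0..<N. i"

text \<open>Homogeneity: the Vandermonde polynomial has degree \<open>tri N\<close>, the power sum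
  product degree \<open>n\<close>.\<close>

lemma chi_support:
  assumes "chi N n l \<pi> \<noteq> 0"
  shows "l \<in> exps N (n + tri N)"
proof -
  have "chi N n l \<pi> = (\<Sum>w | w permutes {0..<N}. \<Sum>f\<in>inv_cols N n \<pi>.
     Poly_Mapping.lookup (Poly_Mapping.single ((\<lambda>i. if i < N then w i else 0) +
       (\<lambda>k. card {a. a < n \<and> f a = k})) (signof w)) l)"
    unfolding chi_def vdm_sum powsum_def cmono_single sum_product mult_single lookup_sum by simp
  then obtain w f where wf: "w permutes {0..<N}" "f \<in> inv_cols N n \<pi>"
     "Poly_Mapping.lookup (Poly_Mapping.single ((\<lambda>i. if i < N then w i else 0) +
       (\<lambda>k. card {a. a < n \<and> f a = k})) (signof w)) l \<noteq> (0::real)"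
    using assms by (metis (no_types, lifting) mem_Collect_eq sum.neutral)
  then have l: "l = (\<lambda>i. if i < N then w i else 0) + (\<lambda>k. card {a. a < n \<and> f a = k})"
    by (auto simp: lookup_single when_def split: if_splits)
  have f: "f \<in> cols N n" using wf by (simp add: inv_cols_def)
  have "card {a. a < n \<and> f a = i} = 0" if "i \<ge> N" for i
    using cols_less[OF f] that by fastforce
  moreover have "(\<Sum>i=0..<N. l i) = tri N + n"
  proof -
    have "(\<Sum>i=0..<N. l i) = (\<Sum>i=0..<N. w i) + (\<Sum>i=0..<N. card {a. a < n \<and> f a = i})"
      by (simp add: l sum.distrib)
    also have "(\<Sum>i=0..<N. w i) = tri N"
      by (rule sum.permute[OF wf(1), of "\<lambda>x. x", unfolded o_def, symmetric])
    finally show ?thesis by (simp add: sum_card_colors[OF f])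
  qed
  ultimately show ?thesis by (simp add: exps_def l)
qed

text \<open>The reciprocal of \<open>(a - b)!\<close>, with value 0 at negative arguments as for the Gamma function.\<close>

definition rfac :: "nat \<Rightarrow> nat \<Rightarrow> real" where
  "rfac a b = (if b \<le> a then 1 / fact (a - b) else 0)"

lemma rfac_Suc: "rfac a (Suc b) = (real a - real b) * rfac a b"
proof (cases "Suc b \<le> a")
  case True
  then obtain c where "a = Suc b + c" using le_Suc_ex by blast
  then show ?thesis by (simp add: rfac_def)
qed (auto simp: rfac_def not_less_eq_eq)

lemma rfac_pred: "a > 0 \<Longrightarrow> rfac (a - 1) b = (real a - real b) * rfac a b"
  using rfac_Suc[of a b] by (cases a) (auto simp: rfac_def)

lemma rfac_0_left: "(real 0 - real b) * rfac 0 b = 0"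
  by (auto simp: rfac_def)

lemma binomial_rfac: "real (l choose i) = fact l / fact i * rfac l i"
  by (auto simp: rfac_def binomial_fact)

text \<open>Aitken's determinant. At the shifted parts of a partition of \<open>n\<close> it is, up
  to sign, the number of standard tableaux divided by \<open>n\<close> factorial.\<close>

definition rdet :: "nat \<Rightarrow> (nat \<Rightarrow> nat) \<Rightarrow> real" where
  "rdet N l = (\<Sum>w | w permutes {0..<N}. signof w * (\<Prod>i=0..<N. rfac (l i) (w i)))"

text \<open>Lowering \<open>l i\<close> multiplies the summand of \<open>w\<close> by
  \<open>l i - w i\<close>. Summed over \<open>i\<close> these factors give \<open>n\<close> for
  every \<open>w\<close>, since the \<open>w i\<close> always add up to
  \<open>tri N\<close>.\<close>

lemma rdet_rec:
  assumes l: "(\<Sum>i=0..<N. l i) = n + tri N"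
  shows "(\<Sum>i=0..<N. if l i > 0 then rdet N (l(i := l i - 1)) else 0) = real n * rdet N l"
proof -
  have "(\<Sum>i=0..<N. if l i > 0 then rdet N (l(i := l i - 1)) else 0) =
     (\<Sum>i=0..<N. \<Sum>w | w permutes {0..<N}. signof w * ((real (l i) - real (w i)) * (\<Prod>k=0..<N. rfac (l k) (w k))))"
  proof (rule sum.cong[OF refl])
    fix i assume i: "i \<in> {0..<N}"
    show "(if l i > 0 then rdet N (l(i := l i - 1)) else 0) =
      (\<Sum>w | w permutes {0..<N}. signof w * ((real (l i) - real (w i)) * (\<Prod>k=0..<N. rfac (l k) (w k))))"
    proof (cases "l i > 0")
      case True
      have "(\<Prod>k=0..<N. rfac ((l(i := l i - 1)) k) (w k)) = (real (l i) - real (w i)) * (\<Prod>k=0..<N. rfac (l k) (w k))" for w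
      proof -
        have "(\<Prod>k\<in>{0..<N}-{i}. rfac ((l(i := l i - 1)) k) (w k)) = (\<Prod>k\<in>{0..<N}-{i}. rfac (l k) (w k))"
          by (rule prod.cong) auto
        then show ?thesis using i rfac_pred[OF True]
          by (simp add: prod.remove[of "{0..<N}" i])
      qed
      then show ?thesis using True by (simp add: rdet_def)
    next
      case False
      \<comment> \<open>For \<open>l i = 0\<close> nothing can be lowered, and the term on the right
        must vanish as well: either \<open>w i = 0\<close> and the difference is zero, or the
        reciprocal factorial is.\<close>
      have "(real (l i) - real (w i)) * (\<Prod>k=0..<N. rfac (l k) (w k)) = 0" for w
      proof -
        have "(real (l i) - real (w i)) * rfac (l i) (w i) = 0" using False rfac_0_left[of "w i"] by simp
        moreover have "(\<Prod>k=0..<N. rfac (l k) (w k)) = rfac (l i) (w i) * (\<Prod>k\<in>{0..<N}-{i}. rfac (l k) (w k))"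
          using i by (simp add: prod.remove)
        ultimately show ?thesis by (simp only: mult.assoc[symmetric] mult_zero_left)
      qed
      then show ?thesis using False by (simp only: mult_zero_right sum.neutral_const if_False)
    qed
  qed
  also have "\<dots> = (\<Sum>w | w permutes {0..<N}. \<Sum>i=0..<N. signof w * ((real (l i) - real (w i)) * (\<Prod>k=0..<N. rfac (l k) (w k))))"
    by (rule sum.swap)
  also have "\<dots> = (\<Sum>w | w permutes {0..<N}. real n * (signof w * (\<Prod>k=0..<N. rfac (l k) (w k))))"
  proof (rule sum.cong[OF refl])
    fix w assume "w \<in> {w. w permutes {0..<N}}"
    then have w: "(\<Sum>i=0..<N. w i) = tri N"
      using sum.permute[of w "{0..<N}" "\<lambda>x. x"] by (simp add: o_def)
    have "(\<Sum>i=0..<N. real (l i) - real (w i)) = real (\<Sum>i=0..<N. l i) - real (\<Sum>i=0..<N. w i)"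
      by (simp add: sum_subtractf)
    also have "\<dots> = real n" unfolding l w by simp
    finally have "(\<Sum>i=0..<N. real (l i) - real (w i)) = real n" .
    moreover have "(\<Sum>i=0..<N. signof w * ((real (l i) - real (w i)) * (\<Prod>k=0..<N. rfac (l k) (w k)))) =
        (\<Sum>i=0..<N. real (l i) - real (w i)) * (signof w * (\<Prod>k=0..<N. rfac (l k) (w k)))"
      unfolding sum_distrib_right by (rule sum.cong[OF refl]) (simp only: mult_ac)
    ultimately show "(\<Sum>i=0..<N. signof w * ((real (l i) - real (w i)) * (\<Prod>k=0..<N. rfac (l k) (w k)))) =
        real n * (signof w * (\<Prod>k=0..<N. rfac (l k) (w k)))" by simp
  qed
  finally show ?thesis by (simp add: rdet_def sum_distrib_left)
qed

text \<open>A nonzero product forces \<open>w i \<le> l i\<close> for all \<open>i\<close>, and the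
  bound on the sum then forces equality everywhere.\<close>

lemma rfac_prod_eq_0:
  assumes w: "w permutes {0..<N}" and l: "(\<Sum>i=0..<N. l i) \<le> tri N" and ne: "\<exists>i<N. l i \<noteq> w i"
  shows "(\<Prod>i=0..<N. rfac (l i) (w i)) = 0"
proof -
  have w': "(\<Sum>i=0..<N. w i) = tri N"
    using sum.permute[OF w, of "\<lambda>x. x"] by (simp add: o_def)
  have "\<exists>i<N. \<not> w i \<le> l i"
  proof (rule ccontr)
    assume "\<not> ?thesis"
    then have le: "\<And>i. i < N \<Longrightarrow> w i \<le> l i" by auto
    obtain i where "i < N" "w i < l i" using ne le by (metis le_neq_implies_less)
    then have "(\<Sum>i=0..<N. w i) < (\<Sum>i=0..<N. l i)" using le by (intro sum_strict_mono_ex1) auto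
    then show False using l w' by simp
  qed
  then obtain i where "i < N" "\<not> w i \<le> l i" by auto
  then show ?thesis by (intro prod_zero) (auto simp: rfac_def intro!: bexI[of _ i])
qed

lemma Xop_0: "Xop u 0 h \<pi> = h \<pi>"
  by (simp add: Xop_def ncyc_def)

text \<open>Both sides satisfy the branching recursion. Raising an exponent to \<open>l i\<close>
  multiplies the product of factorials by \<open>l i\<close>, which accounts for the
  \<open>m\<close>-th power of the eigenvalue, and \<open>fact n * rdet N l\<close> obeys the
  unweighted recursion by \<open>rdet_rec\<close>.\<close>

lemma ychi_closed:
  assumes N: "N \<ge> 1" and l: "l \<in> exps N (n + tri N)"
  shows "ychi m N n l = fact n * (\<Prod>i=0..<N. fact (l i) / fact i) ^ m * rdet N l"
  using l
proof (induction n arbitrary: l)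
  case 0
  have "(Xop (real N) 0 ^^ m) h \<pi> = h \<pi>" for h \<pi> by (induction m arbitrary: \<pi>) (auto simp: Xop_0)
  then have "ychi m N 0 l = chi N 0 l id" by (simp add: ychi_def)
  also have "\<dots> = (\<Sum>w | w permutes {0..<N}. (\<Prod>i=0..<N. fact (l i) / fact i) ^ m * (signof w * (\<Prod>i=0..<N. rfac (l i) (w i))))"
    unfolding chi_0
  proof (rule sum.cong[OF refl])
    fix w assume "w \<in> {w. w permutes {0..<N}}"
    then have w: "w permutes {0..<N}" by simp
    show "(if l = (\<lambda>i. if i < N then w i else 0) then signof w else 0) =
      (\<Prod>i=0..<N. fact (l i) / fact i) ^ m * (signof w * (\<Prod>i=0..<N. rfac (l i) (w i)))"
    proof (cases "l = (\<lambda>i. if i < N then w i else 0)")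
      case True
      have "(\<Prod>i=0..<N. fact (w i) :: real) = (\<Prod>i=0..<N. fact i)"
        using prod.permute[OF w, of "fact :: nat \<Rightarrow> real"] by (simp add: o_def)
      then have "(\<Prod>i=0..<N. fact (l i) / fact i :: real) = 1" using True by (simp add: prod_dividef)
      moreover have "(\<Prod>i=0..<N. rfac (l i) (w i)) = 1" using True by (simp add: rfac_def)
      ultimately show ?thesis using True by simp
    next
      case False
      have "\<exists>i<N. l i \<noteq> w i"
      proof (rule ccontr)
        assume "\<not> ?thesis"
        then have "l = (\<lambda>i. if i < N then w i else 0)" using 0 by (auto simp: fun_eq_iff exps_def)
        then show False using False by contradiction
      qed
      then show ?thesis using False 0 rfac_prod_eq_0[OF w, of l] by (simp add: exps_def)
    qed
  qed
  finally show ?case by (simp add: rdet_def sum_distrib_left)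
next
  case (Suc n)
  let ?R = "\<lambda>l. \<Prod>i=0..<N. fact (l i) / fact i :: real"
  have "ychi m N (Suc n) l = (\<Sum>i=0..<N. fact n * ?R l ^ m * (if l i > 0 then rdet N (l(i := l i - 1)) else 0))"
    unfolding ychi_Suc[OF N]
  proof (rule sum.cong[OF refl])
    fix i assume i: "i \<in> {0..<N}"
    show "(if l i > 0 then real (l i) ^ m * ychi m N n (l(i := l i - 1)) else 0) =
      fact n * ?R l ^ m * (if l i > 0 then rdet N (l(i := l i - 1)) else 0)"
    proof (cases "l i > 0")
      case True
      let ?l = "l(i := l i - 1)"
      have "(\<Sum>k=0..<N. ?l k) + 1 = (\<Sum>k=0..<N. l k)"
      proof -
        have "(\<Sum>k\<in>{0..<N}-{i}. ?l k) = (\<Sum>k\<in>{0..<N}-{i}. l k)" by (rule sum.cong) auto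
        then show ?thesis using i True by (simp add: sum.remove[of "{0..<N}" i])
      qed
      then have "?l \<in> exps N (n + tri N)" using Suc.prems i by (auto simp: exps_def)
      then have "ychi m N n ?l = fact n * ?R ?l ^ m * rdet N ?l" by (rule Suc.IH)
      moreover have "real (l i) * ?R ?l = ?R l"
      proof -
        have "(\<Prod>k\<in>{0..<N}-{i}. fact (?l k) / fact k :: real) = (\<Prod>k\<in>{0..<N}-{i}. fact (l k) / fact k)"
          by (rule prod.cong) auto
        then show ?thesis using i True by (simp add: prod.remove[of "{0..<N}" i] fact_reduce[of "l i"])
      qed
      then have "real (l i) ^ m * ?R ?l ^ m = ?R l ^ m" by (metis power_mult_distrib)
      ultimately show ?thesis using True by (simp add: mult_ac)
    qed simp
  qed
  also have "\<dots> = fact n * ?R l ^ m * (real (Suc n) * rdet N l)"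
    using Suc.prems by (subst sum_distrib_left[symmetric], subst rdet_rec[of _ _ "Suc n"]) (auto simp: exps_def)
  finally show ?case by (simp add: mult_ac)
qed

section \<open>The generating function as a determinant\<close>

definition tups :: "nat \<Rightarrow> 'a set \<Rightarrow> ('a \<Rightarrow> 'a) list set" where
  "tups m S = {ss. length ss = m \<and> (\<forall>\<sigma>\<in>set ss. \<sigma> permutes S)}"

text \<open>The head of the list acts first. This is the order produced by iterating
  \<open>Xop\<close>, and also the order in which a face meets the colours.\<close>

definition lprod :: "('a \<Rightarrow> 'a) list \<Rightarrow> 'a \<Rightarrow> 'a" where
  "lprod ss = foldr (\<lambda>\<sigma> p. p \<circ> \<sigma>) ss id"

text \<open>For the constellation encoded by \<open>ss\<close> this is the number of coloured
  vertices plus the number of faces.\<close>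

definition wt :: "'a set \<Rightarrow> ('a \<Rightarrow> 'a) list \<Rightarrow> nat" where
  "wt S ss = sum_list (map (ncyc S) ss) + ncyc S (lprod ss)"

lemma tups_Suc: "tups (Suc m) S = (\<lambda>(\<sigma>, ss). \<sigma> # ss) ` ({\<sigma>. \<sigma> permutes S} \<times> tups m S)"
  by (auto simp: tups_def length_Suc_conv image_iff)

lemma finite_tups: "finite S \<Longrightarrow> finite (tups m S)"
proof (induction m)
  case 0
  have "tups 0 S = {[]}" by (auto simp: tups_def)
  then show ?case by simp
next
  case (Suc m)
  then show ?case by (simp add: tups_Suc finite_permutations)
qed

lemma lprod_permutes: "ss \<in> tups m S \<Longrightarrow> lprod ss permutes S"
proof (induction ss arbitrary: m)
  case (Cons \<sigma> ss)
  then have "lprod ss permutes S" by (auto simp: tups_def)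
  then show ?case using Cons.prems using permutes_compose[of \<sigma> S "lprod ss"]
    by (auto simp: lprod_def tups_def o_def)
qed (auto simp: lprod_def permutes_id)

lemma Xop_funpow_tups: "(Xop u n ^^ m) h \<pi> =
  (\<Sum>ss\<in>tups m {0..<n}. u ^ sum_list (map (ncyc {0..<n}) ss) * h (lprod ss \<circ> \<pi>))"
proof (induction m arbitrary: \<pi>)
  case 0
  have "tups 0 {0..<n} = {[]}" by (auto simp: tups_def)
  then show ?case by (simp add: lprod_def)
next
  case (Suc m)
  have "(Xop u n ^^ Suc m) h \<pi> = (\<Sum>\<sigma> | \<sigma> permutes {0..<n}. u ^ ncyc {0..<n} \<sigma> *
     (\<Sum>ss\<in>tups m {0..<n}. u ^ sum_list (map (ncyc {0..<n}) ss) * h (lprod ss \<circ> (\<sigma> \<circ> \<pi>))))"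
    by (simp add: Xop_def[of u n "(Xop u n ^^ m) h"] Suc o_def)
  also have "\<dots> = (\<Sum>(\<sigma>, ss)\<in>{\<sigma>. \<sigma> permutes {0..<n}} \<times> tups m {0..<n}.
      u ^ sum_list (map (ncyc {0..<n}) (\<sigma> # ss)) * h (lprod (\<sigma> # ss) \<circ> \<pi>))"
    by (simp add: sum.cartesian_product[symmetric] sum_distrib_left power_add lprod_def o_assoc mult_ac)
  also have "\<dots> = (\<Sum>ss\<in>tups (Suc m) {0..<n}. u ^ sum_list (map (ncyc {0..<n}) ss) * h (lprod ss \<circ> \<pi>))"
    unfolding tups_Suc by (subst sum.reindex) (auto simp: inj_on_def intro!: sum.cong)
  finally show ?case .
qed

definition total :: "nat \<Rightarrow> real \<Rightarrow> nat \<Rightarrow> real" where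
  "total m u n = (\<Sum>ss\<in>tups m {0..<n}. u ^ wt {0..<n} ss)"

text \<open>The cycles of the entries are accounted for by \<open>Xop\<close>. Those of the product
  enter as the function to which it is applied, and \<open>binom_eval\<close> expands this function
  in the eigenfunctions \<open>chi\<close>.\<close>

lemma total_eq_ychi:
  "total m (real N) n = (\<Sum>l\<in>exps N (n + tri N). (\<Prod>i=0..<N. real (l i choose i)) * ychi m N n l)"
proof -
  have eval: "real N ^ ncyc {0..<n} \<pi> = (\<Sum>l\<in>exps N (n + tri N). (\<Prod>i=0..<N. real (l i choose i)) * chi N n l \<pi>)"
    if \<pi>: "\<pi> permutes {0..<n}" for \<pi>
  proof -
    have "real N ^ ncyc {0..<n} \<pi> = binom_eval N (vdm N * powsum N n \<pi>)"
      by (simp add: binom_eval_vdm_powsum card_inv_cols[OF \<pi>])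
    also have "\<dots> = (\<Sum>l\<in>exps N (n + tri N). chi N n l \<pi> * (\<Prod>i=0..<N. real (l i choose i)))"
      unfolding binom_eval_def chi_def[symmetric]
    proof (rule sum.mono_neutral_left)
      show "Poly_Mapping.keys (vdm N * powsum N n \<pi>) \<subseteq> exps N (n + tri N)"
        using chi_support[of N n _ \<pi>] by (auto simp: in_keys_iff chi_def)
    qed (auto simp: in_keys_iff chi_def)
    finally show ?thesis by (simp add: mult.commute)
  qed
  have "total m (real N) n = (Xop (real N) n ^^ m) (\<lambda>\<pi>. real N ^ ncyc {0..<n} \<pi>) id"
    by (simp add: Xop_funpow_tups total_def wt_def power_add)
  also have "\<dots> = (Xop (real N) n ^^ m) (\<lambda>\<pi>. \<Sum>l\<in>exps N (n + tri N). (\<Prod>i=0..<N. real (l i choose i)) * chi N n l \<pi>) id"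
    by (rule Xop_funpow_cong) (auto simp: permutes_id eval)
  also have "\<dots> = (\<Sum>l\<in>exps N (n + tri N). (\<Prod>i=0..<N. real (l i choose i)) * ychi m N n l)"
    unfolding Xop_funpow_sum ychi_def ..
  finally show ?thesis .
qed

definition Zser :: "nat \<Rightarrow> real \<Rightarrow> real fps" where
  "Zser m u = Abs_fps (\<lambda>n. total m u n / fact n)"

text \<open>The single-row contribution of an exponent \<open>l\<close>: \<open>m\<close> factorials
  come from the eigenvalue and one from the binomial weight, whose denominator supplies
  \<open>rfac l i\<close>; the factor \<open>rfac l j\<close> is an entry of
  \<open>rdet\<close>.\<close>

definition Gser :: "nat \<Rightarrow> nat \<Rightarrow> nat \<Rightarrow> real fps" where
  "Gser m i j = Abs_fps (\<lambda>l. fact l ^ Suc m * rfac l i * rfac l j)"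

definition Gdet :: "nat \<Rightarrow> nat \<Rightarrow> real fps" where
  "Gdet m N = (\<Sum>w | w permutes {0..<N}. signof w * (\<Prod>i=0..<N. Gser m i (w i)))"

lemma fps_signof_mult_nth: "fps_nth (signof w * f) n = signof w * fps_nth f n"
  for f :: "real fps"
  by (auto simp: sign_def)

text \<open>Extracting a coefficient from the product over the rows distributes the degree over an
  exponent vector, one exponent per row, and the signed sum over \<open>w\<close> reassembles
  \<open>rdet\<close>. The power of \<open>fps_X\<close> is the degree \<open>tri N\<close> of the
  Vandermonde polynomial; the constant clears the denominators \<open>fact i\<close>.\<close>

lemma Gdet_eq:
  assumes N: "N \<ge> 1"
  shows "Gdet m N = fps_const (\<Prod>i=0..<N. fact i ^ Suc m) * fps_X ^ tri N * Zser m (real N)"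
proof (rule fps_ext)
  fix M
  have G: "fps_nth (Gdet m N) M = (\<Sum>l\<in>exps N M. (\<Prod>i=0..<N. fact (l i) ^ Suc m * rfac (l i) i) * rdet N l)"
  proof -
    have "fps_nth (Gdet m N) M = (\<Sum>w | w permutes {0..<N}. signof w *
       (\<Sum>l\<in>exps N M. \<Prod>i=0..<N. fact (l i) ^ Suc m * rfac (l i) i * rfac (l i) (w i)))"
      by (simp add: Gdet_def fps_sum_nth fps_signof_mult_nth fps_prod_nth_exps Gser_def)
    also have "\<dots> = (\<Sum>l\<in>exps N M. \<Sum>w | w permutes {0..<N}. signof w *
       (\<Prod>i=0..<N. fact (l i) ^ Suc m * rfac (l i) i * rfac (l i) (w i)))"
      unfolding sum_distrib_left by (rule sum.swap)
    also have "\<dots> = (\<Sum>l\<in>exps N M. (\<Prod>i=0..<N. fact (l i) ^ Suc m * rfac (l i) i) * rdet N l)"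
      by (simp add: rdet_def sum_distrib_left prod.distrib mult_ac)
    finally show ?thesis .
  qed
  show "fps_nth (Gdet m N) M =
     fps_nth (fps_const (\<Prod>i=0..<N. fact i ^ Suc m) * fps_X ^ tri N * Zser m (real N)) M"
  proof (cases "M < tri N")
    case True
    \<comment> \<open>The power of \<open>fps_X\<close> predicts zero coefficients here. Indeed,
      with so small a degree every product of reciprocal factorials has a vanishing factor.\<close>
    have "rdet N l = 0" if "l \<in> exps N M" for l
    proof -
      have "(\<Prod>i=0..<N. rfac (l i) (w i)) = 0" if w: "w permutes {0..<N}" for w
      proof (rule rfac_prod_eq_0[OF w])
        have s: "(\<Sum>i=0..<N. l i) = M" using \<open>l \<in> exps N M\<close> by (simp add: exps_def)
        then show "(\<Sum>i=0..<N. l i) \<le> tri N" using True by simp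
        have "(\<Sum>i=0..<N. w i) = tri N"
          using sum.permute[OF w, of "\<lambda>x. x"] by (simp add: o_def)
        then show "\<exists>i<N. l i \<noteq> w i" using s True by (metis atLeastLessThan_iff nat_neq_iff sum.cong)
      qed
      then show ?thesis unfolding rdet_def by (intro sum.neutral) auto
    qed
    then have "fps_nth (Gdet m N) M = 0" by (simp add: G)
    then show ?thesis using True by (simp add: fps_X_power_mult_nth mult.assoc)
  next
    case False
    define n where "n = M - tri N"
    have M: "M = n + tri N" using False by (simp add: n_def)
    let ?c = "\<Prod>i=0..<N. fact i ^ Suc m :: real"
    have "?c * (total m (real N) n / fact n) = (\<Sum>l\<in>exps N M. ?c * ((\<Prod>i=0..<N. real (l i choose i)) * (ychi m N n l / fact n)))"
      unfolding total_eq_ychi M by (simp add: sum_distrib_left sum_divide_distrib)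
    also have "\<dots> = (\<Sum>l\<in>exps N M. (\<Prod>i=0..<N. fact (l i) ^ Suc m * rfac (l i) i) * rdet N l)"
    proof (rule sum.cong[OF refl])
      fix l assume l: "l \<in> exps N M"
      have "?c * (\<Prod>i=0..<N. real (l i choose i)) * (\<Prod>i=0..<N. fact (l i) / fact i) ^ m =
         (\<Prod>i=0..<N. fact i ^ Suc m * real (l i choose i) * (fact (l i) / fact i) ^ m)"
        by (simp add: prod.distrib prod_power_distrib)
      also have "\<dots> = (\<Prod>i=0..<N. fact (l i) ^ Suc m * rfac (l i) i)"
        by (rule prod.cong[OF refl]) (simp add: binomial_rfac power_divide)
      finally show "?c * ((\<Prod>i=0..<N. real (l i choose i)) * (ychi m N n l / fact n)) =
         (\<Prod>i=0..<N. fact (l i) ^ Suc m * rfac (l i) i) * rdet N l"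
        using ychi_closed[OF N, of l n m] l by (simp add: M mult_ac)
    qed
    finally have "fps_nth (Gdet m N) M = ?c * (total m (real N) n / fact n)" by (simp add: G)
    then show ?thesis using False by (simp add: fps_X_power_mult_nth mult.assoc Zser_def n_def)
  qed
qed

section \<open>The Toda equation\<close>

lemma det_2x2: "det (mat 2 2 f) = f (0, 0) * f (1, 1) - f (0, 1) * f (1, 0)"
  for f :: "nat \<times> nat \<Rightarrow> 'a::comm_ring_1"
proof -
  have s: "{0..<2::nat} = insert 0 {1}" by auto
  have p1: "{p. p permutes {1::nat}} = {id}" by (auto simp: permutes_sing)
  have sg: "signof (transpose 0 (1::nat)) = (-1 :: 'a)" by (simp add: sign_swap_id)
  have "det (mat 2 2 f) = (\<Sum>p | p permutes {0..<2}. signof p * (\<Prod>i=0..<2. mat 2 2 f $$ (i, p i)))"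
    by (rule det_def') simp
  also have "\<dots> = (\<Sum>b\<in>insert 0 {1}. \<Sum>q | q permutes {1}. signof (transpose 0 b \<circ> q) *
      (\<Prod>i\<in>insert 0 {1}. mat 2 2 f $$ (i, (transpose 0 b \<circ> q) i)))"
    unfolding s by (rule sum_over_permutations_insert) auto
  also have "\<dots> = f (0, 0) * f (1, 1) - f (0, 1) * f (1, 0)"
    unfolding p1 using sg by (simp add: sign_id)
  finally show ?thesis .
qed

text \<open>The Schur complement without division: the adjugate takes the place of the inverse, and
  the block-triangular multiplier contributes the power of \<open>det A\<close>. The matrices to
  come have power series as entries.\<close>

lemma det_schur_adj:
  fixes A :: "'a::idom mat"
  assumes A: "A \<in> carrier_mat n n" and B: "B \<in> carrier_mat n k"
    and C: "C \<in> carrier_mat k n" and D: "D \<in> carrier_mat k k"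
  shows "det (four_block_mat A B C D) * det A ^ k =
     det A * det (C * (- (adj_mat A * B)) + D * (det A \<cdot>\<^sub>m 1\<^sub>m k))"
proof -
  let ?J = "adj_mat A" and ?d = "det A"
  note J = adj_mat[OF A]
  let ?U = "four_block_mat (1\<^sub>m n) (- (?J * B)) (0\<^sub>m k n) (?d \<cdot>\<^sub>m 1\<^sub>m k)"
  have U: "?U \<in> carrier_mat (n + k) (n + k)" by (intro four_block_carrier_mat) auto
  have M: "four_block_mat A B C D \<in> carrier_mat (n + k) (n + k)" using A D by (intro four_block_carrier_mat) auto
  have z: "A * (- (?J * B)) + B * (?d \<cdot>\<^sub>m 1\<^sub>m k) = 0\<^sub>m n k"
  proof -
    have "A * (- (?J * B)) = - (A * (?J * B))" using A B J by simp
    also have "A * (?J * B) = (A * ?J) * B" by (rule assoc_mult_mat[OF A J(1) B, symmetric])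
    also have "\<dots> = ?d \<cdot>\<^sub>m B"
      unfolding J(2) using mult_smult_assoc_mat[OF one_carrier_mat B, of ?d] B by simp
    finally show ?thesis using B by auto
  qed
  have "four_block_mat A B C D * ?U =
     four_block_mat A (0\<^sub>m n k) C (C * (- (?J * B)) + D * (?d \<cdot>\<^sub>m 1\<^sub>m k))"
  proof -
    have "A * 1\<^sub>m n + B * 0\<^sub>m k n = A" "C * 1\<^sub>m n + D * 0\<^sub>m k n = C" using A B C D by auto
    then show ?thesis using z A B C D J
      by (subst mult_four_block_mat[of _ n n _ k _ k]) auto
  qed
  then have "det (four_block_mat A B C D) * det ?U =
     det (four_block_mat A (0\<^sub>m n k) C (C * (- (?J * B)) + D * (?d \<cdot>\<^sub>m 1\<^sub>m k)))"
    using det_mult[OF M U] by simp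
  also have "\<dots> = det A * det (C * (- (?J * B)) + D * (?d \<cdot>\<^sub>m 1\<^sub>m k))"
    using A B C D J by (intro det_four_block_mat_upper_right_zero[of _ n _ k]) auto
  also have "det ?U = det (1\<^sub>m n :: 'a mat) * det (?d \<cdot>\<^sub>m 1\<^sub>m k)"
    using A B J by (intro det_four_block_mat_lower_left_zero[of _ n _ k]) auto
  finally show ?thesis by simp
qed

definition bminor :: "(nat \<Rightarrow> nat \<Rightarrow> 'a::comm_ring_1) \<Rightarrow> nat \<Rightarrow> nat \<Rightarrow> nat \<Rightarrow> 'a" where
  "bminor a n p q = det (mat (Suc n) (Suc n) (\<lambda>(i, j). a (if i = n then p else i) (if j = n then q else j)))"

text \<open>Apply \<open>det_schur_adj\<close> with borders of width 1 and 2. The bordered minors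
  are the entries of the 2 x 2 Schur complement, whose determinant belongs to the full matrix; what
  is left is to cancel \<open>det A\<close>.\<close>

lemma desnanot_jacobi:
  fixes a :: "nat \<Rightarrow> nat \<Rightarrow> 'a::idom"
  assumes nz: "det (mat n n (\<lambda>(i, j). a i j)) \<noteq> 0"
  shows "det (mat (n + 2) (n + 2) (\<lambda>(i, j). a i j)) * det (mat n n (\<lambda>(i, j). a i j)) =
     bminor a n n n * bminor a n (Suc n) (Suc n) - bminor a n n (Suc n) * bminor a n (Suc n) n"
proof -
  define A where "A = mat n n (\<lambda>(i, j). a i j)"
  have A: "A \<in> carrier_mat n n" by (simp add: A_def)
  have J: "adj_mat A \<in> carrier_mat n n" using adj_mat[OF A] by simp
  define S where "S p q = (\<Sum>i=0..<n. a p i * (- (\<Sum>j=0..<n. adj_mat A $$ (i, j) * a j q))) + a p q * det A" for p q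
  have minor: "bminor a n p q = S p q" for p q
  proof -
    let ?B = "mat n 1 (\<lambda>(i, j). a i q)" and ?C = "mat 1 n (\<lambda>(i, j). a p j)" and ?D = "mat 1 1 (\<lambda>(i, j). a p q)"
    have "mat (Suc n) (Suc n) (\<lambda>(i, j). a (if i = n then p else i) (if j = n then q else j)) =
       four_block_mat A ?B ?C ?D"
      by (rule eq_matI) (auto simp: A_def)
    then have "bminor a n p q * det A ^ 1 = det A * det (?C * (- (adj_mat A * ?B)) + ?D * (det A \<cdot>\<^sub>m 1\<^sub>m 1))"
      unfolding bminor_def by (simp only:) (rule det_schur_adj[OF A]; simp)
    also have "det (?C * (- (adj_mat A * ?B)) + ?D * (det A \<cdot>\<^sub>m 1\<^sub>m 1)) = S p q"
      using J by (subst det_single) (auto simp: S_def scalar_prod_def sum_negf)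
    finally show ?thesis using nz by (simp add: A_def)
  qed
  let ?B = "mat n 2 (\<lambda>(i, j). a i (n + j))" and ?C = "mat 2 n (\<lambda>(i, j). a (n + i) j)"
    and ?D = "mat 2 2 (\<lambda>(i, j). a (n + i) (n + j))"
  have "mat (n + 2) (n + 2) (\<lambda>(i, j). a i j) = four_block_mat A ?B ?C ?D"
    by (rule eq_matI) (auto simp: A_def)
  then have "det (mat (n + 2) (n + 2) (\<lambda>(i, j). a i j)) * det A ^ 2 =
     det A * det (?C * (- (adj_mat A * ?B)) + ?D * (det A \<cdot>\<^sub>m 1\<^sub>m 2))"
    by (simp only:) (rule det_schur_adj[OF A]; simp)
  also have "?C * (- (adj_mat A * ?B)) + ?D * (det A \<cdot>\<^sub>m 1\<^sub>m 2) = mat 2 2 (\<lambda>(i, j). S (n + i) (n + j))"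
  proof (rule eq_matI, goal_cases)
    case (1 i j)
    then have ij: "i < 2" "j < 2" by auto
    have "(\<Sum>k=0..<2. a (n + i) (n + k) * (det A * (if k = j then 1 else 0))) = a (n + i) (n + j) * det A"
      using ij by (simp add: mult_delta_right if_distrib sum.delta cong: if_cong)
    then show ?case using ij J by (auto simp: S_def scalar_prod_def sum_negf)
  qed (use J in auto)
  also have "det \<dots> = S n n * S (Suc n) (Suc n) - S n (Suc n) * S (Suc n) n"
    by (simp add: det_2x2)
  finally have "det A * (det (mat (n + 2) (n + 2) (\<lambda>(i, j). a i j)) * det A) =
     det A * (S n n * S (Suc n) (Suc n) - S n (Suc n) * S (Suc n) n)"
    by (simp add: power2_eq_square mult_ac)
  then show ?thesis using nz unfolding minor A_def[symmetric] by (simp add: A_def[symmetric])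
qed

definition fps_theta :: "'a::comm_ring_1 fps \<Rightarrow> 'a fps" where
  "fps_theta f = fps_X * fps_deriv f"

lemma fps_theta_nth [simp]: "fps_nth (fps_theta f) n = of_nat n * fps_nth f n"
  by (cases n) (auto simp: fps_theta_def)

lemma fps_theta_mult: "fps_theta (f * g) = fps_theta f * g + f * fps_theta g"
  by (simp add: fps_theta_def algebra_simps)

lemma fps_theta_of_int [simp]: "fps_theta (of_int c) = 0"
  by (simp add: fps_theta_def)

lemma fps_theta_sum: "fps_theta (sum f A) = (\<Sum>a\<in>A. fps_theta (f a))"
  by (simp add: fps_theta_def fps_deriv_sum sum_distrib_left)

lemma fps_theta_prod: "finite A \<Longrightarrow> fps_theta (prod f A) = (\<Sum>a\<in>A. fps_theta (f a) * prod f (A - {a}))"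
proof (induction A rule: finite_induct)
  case (insert a A)
  have "f a * (\<Sum>b\<in>A. fps_theta (f b) * prod f (A - {b})) =
     (\<Sum>b\<in>A. fps_theta (f b) * prod f (insert a A - {b}))"
    unfolding sum_distrib_left
  proof (rule sum.cong[OF refl])
    fix b assume b: "b \<in> A"
    then have "insert a A - {b} = insert a (A - {b})" using insert by auto
    then show "f a * (fps_theta (f b) * prod f (A - {b})) = fps_theta (f b) * prod f (insert a A - {b})"
      using insert by (simp add: algebra_simps)
  qed
  then show ?case using insert by (simp add: fps_theta_mult)
qed (simp add: fps_theta_def)

text \<open>Differentiating column by column: every column but the last turns into its right neighbour.\<close>

lemma fps_theta_det:
  fixes a :: "nat \<Rightarrow> nat \<Rightarrow> real fps"
  assumes a: "\<And>i j. fps_theta (a i j) = a i (Suc j) + of_nat j * a i j"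
  shows "fps_theta (det (mat (Suc n) (Suc n) (\<lambda>(i, j). a (r i) j))) =
    det (mat (Suc n) (Suc n) (\<lambda>(i, j). a (r i) (if j = n then Suc n else j))) +
    of_nat (tri (Suc n)) * det (mat (Suc n) (Suc n) (\<lambda>(i, j). a (r i) j))"
proof -
  let ?N = "Suc n"
  let ?P = "{p. p permutes {0..<?N}}"
  let ?b = "\<lambda>k j. if j = k then Suc k else j"
  let ?M = "\<lambda>k. mat ?N ?N (\<lambda>(i, j). a (r i) (?b k j))"
  have expand: "det (mat ?N ?N (\<lambda>(i, j). a (r i) (c j))) = (\<Sum>p\<in>?P. signof p * (\<Prod>j\<in>{0..<?N}. a (r (p j)) (c j)))" for c
    by (subst det_col[of _ ?N])
      (auto simp: permutes_in_image intro!: sum.cong prod.cong arg_cong2[of _ _ _ _ "(*)"])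
  have "fps_theta (det (mat ?N ?N (\<lambda>(i, j). a (r i) j))) =
     (\<Sum>p\<in>?P. signof p * (\<Sum>k\<in>{0..<?N}. (a (r (p k)) (Suc k) + of_nat k * a (r (p k)) k) * (\<Prod>j\<in>{0..<?N} - {k}. a (r (p j)) j)))"
    by (simp add: expand fps_theta_sum fps_theta_mult fps_theta_prod a del: prod.op_ivl_Suc sum.op_ivl_Suc)
  also have "\<dots> = (\<Sum>p\<in>?P. \<Sum>k\<in>{0..<?N}. signof p * (\<Prod>j\<in>{0..<?N}. a (r (p j)) (?b k j)) +
      of_nat k * (signof p * (\<Prod>j\<in>{0..<?N}. a (r (p j)) j)))"
  proof (rule sum.cong[OF refl], unfold sum_distrib_left, rule sum.cong[OF refl])
    fix p k assume k: "k \<in> {0..<?N}"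
    have "(\<Prod>j\<in>{0..<?N} - {k}. a (r (p j)) (?b k j)) = (\<Prod>j\<in>{0..<?N} - {k}. a (r (p j)) j)"
      by (rule prod.cong) auto
    then have "(\<Prod>j\<in>{0..<?N}. a (r (p j)) (?b k j)) = a (r (p k)) (Suc k) * (\<Prod>j\<in>{0..<?N} - {k}. a (r (p j)) j)"
      using k by (subst prod.remove[of _ k]) auto
    moreover have "(\<Prod>j\<in>{0..<?N}. a (r (p j)) j) = a (r (p k)) k * (\<Prod>j\<in>{0..<?N} - {k}. a (r (p j)) j)"
      using k by (subst prod.remove[of _ k]) auto
    ultimately show "signof p * ((a (r (p k)) (Suc k) + of_nat k * a (r (p k)) k) * (\<Prod>j\<in>{0..<?N} - {k}. a (r (p j)) j)) =
      signof p * (\<Prod>j\<in>{0..<?N}. a (r (p j)) (?b k j)) + of_nat k * (signof p * (\<Prod>j\<in>{0..<?N}. a (r (p j)) j))"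
      by (simp only:) (simp add: algebra_simps)
  qed
  also have "\<dots> = (\<Sum>k\<in>{0..<?N}. \<Sum>p\<in>?P. signof p * (\<Prod>j\<in>{0..<?N}. a (r (p j)) (?b k j)) +
      of_nat k * (signof p * (\<Prod>j\<in>{0..<?N}. a (r (p j)) j)))"
    by (rule sum.swap)
  also have "\<dots> = (\<Sum>k\<in>{0..<?N}. det (?M k)) + (\<Sum>k\<in>{0..<?N}. of_nat k * det (mat ?N ?N (\<lambda>(i, j). a (r i) j)))"
    unfolding expand[of "\<lambda>j. j"] expand[of "?b _"] sum.distrib[symmetric] sum_distrib_left ..
  also have "(\<Sum>k\<in>{0..<?N}. det (?M k)) = det (?M n)"
  proof -
    have "det (?M k) = 0" if "k < n" for k
    proof (rule det_identical_columns[of _ ?N k "Suc k"])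
      show "col (?M k) k = col (?M k) (Suc k)" using that by (auto intro!: eq_vecI)
    qed (use that in auto)
    then show ?thesis by (simp add: sum.neutral)
  qed
  finally show ?thesis by (simp only: of_nat_sum sum_distrib_right)
qed

text \<open>Write the factor \<open>l\<close> as \<open>(l - j) + j\<close>; the first part shortens
  the reciprocal factorial of \<open>l - j\<close>.\<close>

lemma fps_theta_Gser: "fps_theta (Gser m i j) = Gser m i (Suc j) + of_nat j * Gser m i j"
proof (rule fps_ext)
  fix l
  have "of_nat l * fps_nth (Gser m i j) l = fps_nth (Gser m i (Suc j)) l + of_nat j * fps_nth (Gser m i j) l"
    by (simp add: Gser_def rfac_Suc algebra_simps)
  then show "fps_nth (fps_theta (Gser m i j)) l = fps_nth (Gser m i (Suc j) + of_nat j * Gser m i j) l"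
    by (simp add: fps_of_nat[symmetric] fps_mult_left_const_nth)
qed

lemma Gser_commute: "Gser m i j = Gser m j i"
  by (simp add: Gser_def mult_ac)

lemma Gdet_det: "Gdet m N = det (mat N N (\<lambda>(i, j). Gser m i j))"
  unfolding Gdet_def by (subst det_def'[of _ N])
    (auto simp: permutes_in_image intro!: sum.cong prod.cong arg_cong2[of _ _ _ _ "(*)"])

text \<open>By \<open>fps_theta_det\<close> the operator \<open>D\<close> moves the bordering column
  from \<open>n\<close> to \<open>n + 1\<close>. As \<open>Gser\<close> is symmetric in its indices,
  the same holds for the bordering row, so the four minors in the Desnanot--Jacobi identity are one
  determinant and its derivatives under \<open>D\<close>.\<close>

lemma Gdet_toda:
  fixes m n :: nat
  defines "D \<equiv> \<lambda>f. fps_theta f - of_nat (tri (Suc n)) * f"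
  assumes nz: "Gdet m n \<noteq> 0"
  shows "Gdet m (n + 2) * Gdet m n =
     Gdet m (Suc n) * D (D (Gdet m (Suc n))) - (D (Gdet m (Suc n)))\<^sup>2"
proof -
  let ?a = "Gser m"
  have tr: "bminor ?a n p q = bminor ?a n q p" for p q
  proof -
    let ?M = "\<lambda>p q. mat (Suc n) (Suc n) (\<lambda>(i, j). ?a (if i = n then p else i) (if j = n then q else j))"
    have "transpose_mat (?M p q) = ?M q p"
    proof (rule eq_matI, goal_cases)
      case (1 i j)
      then show ?case
        using Gser_commute[of m "if j = n then p else j" "if i = n then q else i"] by simp
    qed auto
    moreover have "det (transpose_mat (?M p q)) = det (?M p q)" by (rule det_transpose[of _ "Suc n"]) simp
    ultimately show ?thesis unfolding bminor_def by simp
  qed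
  have D: "D (bminor ?a n p n) = bminor ?a n p (Suc n)" for p
  proof -
    have "mat (Suc n) (Suc n) (\<lambda>(i, j). ?a (if i = n then p else i) (if j = n then n else j)) =
       mat (Suc n) (Suc n) (\<lambda>(i, j). ?a (if i = n then p else i) j)"
      by (rule eq_matI) auto
    then show ?thesis
      unfolding D_def bminor_def
      by (simp only: fps_theta_det[of ?a n "\<lambda>i. if i = n then p else i", OF fps_theta_Gser] add_diff_cancel_right')
  qed
  have "mat (Suc n) (Suc n) (\<lambda>(i, j). ?a (if i = n then n else i) (if j = n then n else j)) =
       mat (Suc n) (Suc n) (\<lambda>(i, j). ?a i j)"
    by (rule eq_matI) auto
  then have G: "bminor ?a n n n = Gdet m (Suc n)" by (simp add: bminor_def Gdet_det)
  have "Gdet m (n + 2) * Gdet m n =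
     bminor ?a n n n * bminor ?a n (Suc n) (Suc n) - bminor ?a n n (Suc n) * bminor ?a n (Suc n) n"
    using desnanot_jacobi[of n ?a, OF nz[unfolded Gdet_det]] unfolding Gdet_det .
  also have "bminor ?a n (Suc n) n = bminor ?a n n (Suc n)" by (rule tr)
  also have "bminor ?a n (Suc n) (Suc n) = D (D (bminor ?a n n n))"
    by (simp only: D tr[of n "Suc n"])
  also have "bminor ?a n n (Suc n) = D (bminor ?a n n n)" by (simp only: D)
  finally show ?thesis unfolding G by (simp add: power2_eq_square)
qed

lemma ncyc_pos:
  assumes "finite S" "S \<noteq> {}" shows "ncyc S \<pi> > 0"
  using assms by (simp add: ncyc_def card_gt_0_iff)

lemma total_0: "total m u 0 = 1"
proof -
  have "tups m ({} :: nat set) = {replicate m id}"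
    by (auto simp: tups_def replicate_length_same)
  then show ?thesis by (simp add: total_def wt_def ncyc_def sum_list_replicate)
qed

text \<open>Without colours only the empty set contributes. This matches the empty determinant and
  makes the Toda equation start at \<open>N = 1\<close>, whose lower neighbour is 0.\<close>

lemma Zser_0: "Zser m 0 = 1"
proof (rule fps_ext)
  fix n
  have "total m 0 n = 0" if "n > 0"
    using that ncyc_pos[of "{0..<n}"] by (auto simp: total_def wt_def intro!: sum.neutral)
  then show "fps_nth (Zser m 0) n = fps_nth 1 n"
    by (cases "n = 0") (auto simp: Zser_def total_0)
qed

lemma Gdet_eq': "Gdet m N = fps_const (\<Prod>i=0..<N. fact i ^ Suc m) * fps_X ^ tri N * Zser m (real N)"
proof (cases "N = 0")
  case True
  then show ?thesis by (simp add: Gdet_def Zser_0)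
next
  case False
  then show ?thesis using Gdet_eq[of N m] by simp
qed

lemma Zser_nonzero: "Zser m u \<noteq> 0"
proof
  assume "Zser m u = 0"
  then have "fps_nth (Zser m u) 0 = 0" by simp
  then show False by (simp add: Zser_def total_0)
qed

text \<open>The powers of \<open>fps_X\<close> turn \<open>D\<close> into \<open>fps_theta\<close>.
  They nearly cancel, as \<open>tri (n + 2) + tri n\<close> exceeds twice \<open>tri (n + 1)\<close>
  by 1, which leaves one \<open>fps_X\<close>. From the constants there remains the quotient of the
  factorials of \<open>n + 1\<close> and \<open>n\<close>, raised to the power
  \<open>m + 1\<close>.\<close>

lemma toda_Suc:
  "fps_const (real (Suc n) ^ Suc m) * fps_X * (Zser m (real (n + 2)) * Zser m (real n)) =
   Zser m (real (Suc n)) * fps_theta (fps_theta (Zser m (real (Suc n)))) - (fps_theta (Zser m (real (Suc n))))\<^sup>2"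
proof -
  let ?c = "\<lambda>N. (\<Prod>i=0..<N. fact i ^ Suc m) :: real"
  let ?Z = "\<lambda>N. Zser m (real N)"
  let ?b = "tri (Suc n)"
  define D where "D f = fps_theta f - of_nat ?b * f" for f :: "real fps"
  have thX: "fps_theta (fps_X ^ b) = of_nat b * (fps_X ^ b :: real fps)" for b
    by (rule fps_ext) (auto simp: fps_of_nat[symmetric] fps_mult_left_const_nth)
  have thc: "fps_theta (fps_const c) = 0" for c :: real by (simp add: fps_theta_def)
  have D: "D (fps_const c * fps_X ^ ?b * f) = fps_const c * fps_X ^ ?b * fps_theta f" for c f
    unfolding D_def by (simp only: fps_theta_mult thX thc) (simp add: algebra_simps)
  have cpos: "?c N \<noteq> 0" for N by simp
  have "Gdet m n \<noteq> 0"
    unfolding Gdet_eq' using Zser_nonzero by (simp only: mult_eq_0_iff fps_const_eq_0_iff cpos) simp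
  then have "Gdet m (n + 2) * Gdet m n = Gdet m (Suc n) * D (D (Gdet m (Suc n))) - (D (Gdet m (Suc n)))\<^sup>2"
    unfolding D_def by (rule Gdet_toda)
  then have eq: "fps_const (?c (n + 2)) * fps_X ^ tri (n + 2) * ?Z (n + 2) * (fps_const (?c n) * fps_X ^ tri n * ?Z n) =
     fps_const (?c (Suc n)) * fps_X ^ ?b * ?Z (Suc n) * (fps_const (?c (Suc n)) * fps_X ^ ?b * fps_theta (fps_theta (?Z (Suc n))))
     - (fps_const (?c (Suc n)) * fps_X ^ ?b * fps_theta (?Z (Suc n)))\<^sup>2"
    unfolding Gdet_eq' D .
  have c2: "?c (n + 2) * ?c n = (?c (Suc n))\<^sup>2 * real (Suc n) ^ Suc m"
    by (simp add: power2_eq_square power_mult_distrib mult_ac)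
  have t2: "tri (n + 2) + tri n = Suc (2 * ?b)" by simp
  have "fps_const ((?c (Suc n))\<^sup>2) * fps_X ^ (2 * ?b) *
      (fps_const (real (Suc n) ^ Suc m) * fps_X * (?Z (n + 2) * ?Z n)) =
      fps_const (?c (n + 2) * ?c n) * fps_X ^ (tri (n + 2) + tri n) * (?Z (n + 2) * ?Z n)"
    unfolding c2 t2 fps_const_mult[symmetric] power_Suc[of fps_X] by (simp only: mult_ac)
  also have "\<dots> = fps_const (?c (n + 2)) * fps_X ^ tri (n + 2) * ?Z (n + 2) * (fps_const (?c n) * fps_X ^ tri n * ?Z n)"
    by (simp only: power_add fps_const_mult[symmetric] mult_ac)
  also have "\<dots> = fps_const ((?c (Suc n))\<^sup>2) * fps_X ^ (2 * ?b) *
     (?Z (Suc n) * fps_theta (fps_theta (?Z (Suc n))) - (fps_theta (?Z (Suc n)))\<^sup>2)"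
    unfolding eq by (simp only: power2_eq_square mult_2 power_add fps_const_mult[symmetric] right_diff_distrib mult_ac)
  finally have "fps_const ((?c (Suc n))\<^sup>2) * fps_X ^ (2 * ?b) *
      (fps_const (real (Suc n) ^ Suc m) * fps_X * (?Z (n + 2) * ?Z n)) =
     fps_const ((?c (Suc n))\<^sup>2) * fps_X ^ (2 * ?b) *
     (?Z (Suc n) * fps_theta (fps_theta (?Z (Suc n))) - (fps_theta (?Z (Suc n)))\<^sup>2)" .
  moreover have "fps_const ((?c (Suc n))\<^sup>2) * fps_X ^ (2 * ?b) \<noteq> (0 :: real fps)"
    using cpos[of "Suc n"] by (simp only: mult_eq_0_iff fps_const_eq_0_iff power_eq_0_iff) simp
  ultimately show ?thesis by (simp only: mult_cancel_left) simp
qed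

section \<open>Transitive tuples\<close>

inductive_set reach :: "('a \<Rightarrow> 'a) list \<Rightarrow> 'a \<Rightarrow> 'a set" for ss r where
  base: "r \<in> reach ss r"
| step: "x \<in> reach ss r \<Longrightarrow> \<sigma> \<in> set ss \<Longrightarrow> \<sigma> x \<in> reach ss r"

lemma reach_subset:
  assumes "ss \<in> tups m S" "r \<in> S" shows "reach ss r \<subseteq> S"
proof
  fix x assume "x \<in> reach ss r"
  then show "x \<in> S" by induction (use assms in \<open>auto simp: tups_def permutes_in_image\<close>)
qed

text \<open>Only forward steps generate \<open>reach\<close>. On a finite set an injective map of
  \<open>reach\<close> into itself is onto, so backward steps stay inside too.\<close>

lemma reach_closed:
  assumes ss: "ss \<in> tups m S" and fin: "finite S" and \<sigma>: "\<sigma> \<in> set ss" and r: "r \<in> S"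
  shows "\<sigma> x \<in> reach ss r \<longleftrightarrow> x \<in> reach ss r"
proof
  have p: "\<sigma> permutes S" using ss \<sigma> by (auto simp: tups_def)
  assume x: "\<sigma> x \<in> reach ss r"
  have "\<sigma> ` reach ss r = reach ss r"
  proof (rule endo_inj_surj)
    show "finite (reach ss r)" by (rule finite_subset[OF reach_subset[OF ss r] fin])
    show "\<sigma> ` reach ss r \<subseteq> reach ss r" using reach.step[OF _ \<sigma>] by blast
    show "inj_on \<sigma> (reach ss r)" by (rule permutes_inj_on[OF p])
  qed
  then have "\<sigma> x \<in> \<sigma> ` reach ss r" using x by simp
  then obtain y where y: "y \<in> reach ss r" "\<sigma> x = \<sigma> y" by blast
  then have "x = y" using permutes_inj[OF p] by (simp add: inj_eq)
  then show "x \<in> reach ss r" using y by simp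
qed (rule reach.step[OF _ \<sigma>])

lemma reach_trans:
  assumes "y \<in> reach ss x" "z \<in> reach ss y" shows "z \<in> reach ss x"
  using assms(2)
proof induction
  case base
  then show ?case by (rule assms(1))
next
  case (step z \<sigma>)
  then show ?case by (auto intro: reach.step[of z])
qed

lemma perm_restrict_permutes:
  assumes "\<sigma> permutes S" "B \<subseteq> S" "\<And>x. \<sigma> x \<in> B \<longleftrightarrow> x \<in> B"
  shows "perm_restrict \<sigma> B permutes B"
proof (rule bij_imp_permutes)
  have "\<sigma> ` B = B"
  proof (intro equalityI subsetI)
    fix y assume "y \<in> B"
    moreover obtain x where "y = \<sigma> x" using permutes_surj[OF assms(1)] by blast
    ultimately show "y \<in> \<sigma> ` B" using assms(3) by blast
  qed (use assms(3) in auto)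
  then have "bij_betw \<sigma> B B"
    using permutes_inj[OF assms(1)] by (auto simp: bij_betw_def intro: inj_on_subset)
  then show "bij_betw (perm_restrict \<sigma> B) B B"
    by (rule bij_betw_cong[THEN iffD1, rotated]) (simp add: perm_restrict_def)
qed (auto simp: perm_restrict_def)

lemma disjoint_comp_apply:
  assumes "\<sigma> permutes B" "\<tau> permutes B'" "B \<inter> B' = {}"
  shows "x \<in> B \<Longrightarrow> (\<sigma> \<circ> \<tau>) x = \<sigma> x" "x \<in> B' \<Longrightarrow> (\<sigma> \<circ> \<tau>) x = \<tau> x"
    "x \<notin> B \<Longrightarrow> x \<notin> B' \<Longrightarrow> (\<sigma> \<circ> \<tau>) x = x"
proof -
  show "(\<sigma> \<circ> \<tau>) x = \<sigma> x" if "x \<in> B"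
  proof -
    have "x \<notin> B'" using that assms(3) by auto
    then show ?thesis using permutes_not_in[OF assms(2)] by simp
  qed
  show "(\<sigma> \<circ> \<tau>) x = \<tau> x" if "x \<in> B'"
  proof -
    have "\<tau> x \<in> B'" using that permutes_in_image[OF assms(2)] by auto
    then have "\<tau> x \<notin> B" using assms(3) by auto
    then show ?thesis using permutes_not_in[OF assms(1)] by simp
  qed
  show "(\<sigma> \<circ> \<tau>) x = x" if "x \<notin> B" "x \<notin> B'"
    using that permutes_not_in[OF assms(1), of x] permutes_not_in[OF assms(2), of x] by simp
qed

lemma ncyc_union:
  assumes fin: "finite B" "finite B'" and p: "\<sigma> permutes B" "\<tau> permutes B'" "B \<inter> B' = {}"
  shows "ncyc (B \<union> B') (\<sigma> \<circ> \<tau>) = ncyc B \<sigma> + ncyc B' \<tau>"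
proof -
  note ap = disjoint_comp_apply[OF p]
  have o1: "orbit (\<sigma> \<circ> \<tau>) x = orbit \<sigma> x" if "x \<in> B" for x
    using that p(1) ap by (intro orbit_cong0[of _ B]) (auto simp: permutes_in_image)
  have o2: "orbit (\<sigma> \<circ> \<tau>) x = orbit \<tau> x" if "x \<in> B'" for x
    using that p(2) ap by (intro orbit_cong0[of _ B']) (auto simp: permutes_in_image)
  have "orbit (\<sigma> \<circ> \<tau>) ` (B \<union> B') = orbit \<sigma> ` B \<union> orbit \<tau> ` B'"
    using o1 o2 by (auto simp: image_Un)
  moreover have "orbit \<sigma> ` B \<inter> orbit \<tau> ` B' = {}"
  proof (rule ccontr)
    assume "\<not> ?thesis"
    then obtain x y where xy: "x \<in> B" "y \<in> B'" "orbit \<sigma> x = orbit \<tau> y" by auto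
    have "\<sigma> x \<in> orbit \<sigma> x" by (rule orbit.base)
    then show False
      using xy permutes_orbit_subset[OF p(1) xy(1)] permutes_orbit_subset[OF p(2) xy(2)] p(3) by blast
  qed
  ultimately show ?thesis using fin by (simp add: ncyc_def card_Un_disjoint)
qed

lemma lprod_Cons: "lprod (\<sigma> # ss) = lprod ss \<circ> \<sigma>"
  by (simp add: lprod_def)

lemma lprod_map2_comp:
  assumes "length ss = length ts" "\<forall>\<sigma>\<in>set ss. \<sigma> permutes B" "\<forall>\<tau>\<in>set ts. \<tau> permutes B'" "B \<inter> B' = {}"
  shows "lprod (map2 (\<circ>) ss ts) = lprod ss \<circ> lprod ts"
  using assms
proof (induction ss ts rule: list_induct2)
  case (Cons \<sigma> ss \<tau> ts)
  have p: "lprod ts permutes B'" using Cons.prems lprod_permutes[of ts "length ts" B'] by (auto simp: tups_def)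
  have s: "\<sigma> permutes B" using Cons.prems by simp
  have c: "lprod ts \<circ> \<sigma> = \<sigma> \<circ> lprod ts"
  proof
    fix x
    show "(lprod ts \<circ> \<sigma>) x = (\<sigma> \<circ> lprod ts) x"
      using disjoint_comp_apply[OF s p Cons.prems(3), of x] disjoint_comp_apply[OF p s, of x] Cons.prems(3)
      by (cases "x \<in> B"; cases "x \<in> B'") (auto simp: Int_commute)
  qed
  have "lprod (map2 (\<circ>) (\<sigma> # ss) (\<tau> # ts)) = lprod ss \<circ> lprod ts \<circ> (\<sigma> \<circ> \<tau>)"
    using Cons by (simp add: lprod_Cons o_def)
  also have "\<dots> = lprod ss \<circ> (lprod ts \<circ> \<sigma>) \<circ> \<tau>" by (simp only: o_assoc)
  also have "\<dots> = lprod (\<sigma> # ss) \<circ> lprod (\<tau> # ts)" by (simp only: c lprod_Cons o_assoc)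
  finally show ?case .
qed (simp add: lprod_def)

lemma wt_map2_comp:
  assumes "ss \<in> tups m B" "ts \<in> tups m B'" "B \<inter> B' = {}" "finite B" "finite B'"
  shows "wt (B \<union> B') (map2 (\<circ>) ss ts) = wt B ss + wt B' ts"
proof -
  have len: "length ss = length ts" using assms by (simp add: tups_def)
  have p: "\<forall>\<sigma>\<in>set ss. \<sigma> permutes B" "\<forall>\<tau>\<in>set ts. \<tau> permutes B'" using assms by (auto simp: tups_def)
  have "sum_list (map (ncyc (B \<union> B')) (map2 (\<circ>) ss ts)) = sum_list (map (ncyc B) ss) + sum_list (map (ncyc B') ts)"
    using len p
  proof (induction ss ts rule: list_induct2)
    case (Cons \<sigma> ss \<tau> ts)
    then have "ncyc (B \<union> B') (\<sigma> \<circ> \<tau>) = ncyc B \<sigma> + ncyc B' \<tau>"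
      using assms by (intro ncyc_union) auto
    then show ?case using Cons by (simp add: o_def)
  qed simp
  moreover have "ncyc (B \<union> B') (lprod (map2 (\<circ>) ss ts)) = ncyc B (lprod ss) + ncyc B' (lprod ts)"
    unfolding lprod_map2_comp[OF len p assms(3)]
    using assms by (intro ncyc_union lprod_permutes) auto
  ultimately show ?thesis by (simp add: wt_def)
qed

lemma reach_map2_comp:
  assumes ss: "ss \<in> tups m B" and ts: "ts \<in> tups m B'" and dis: "B \<inter> B' = {}" and r: "r \<in> B"
  shows "reach (map2 (\<circ>) ss ts) r = reach ss r"
proof -
  have len: "length ss = m" "length ts = m" using ss ts by (auto simp: tups_def)
  have p: "ss ! i permutes B" "ts ! i permutes B'" if "i < m" for i
    using that ss ts by (auto simp: tups_def)
  have ap: "(ss ! i \<circ> ts ! i) x = (ss ! i) x" if "i < m" "x \<in> B" for i x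
    using disjoint_comp_apply(1)[OF p[OF that(1)] dis that(2)] .
  have nth: "map2 (\<circ>) ss ts ! i = ss ! i \<circ> ts ! i" if "i < m" for i using that len by simp
  show ?thesis
  proof (intro equalityI subsetI)
    fix x assume "x \<in> reach (map2 (\<circ>) ss ts) r"
    then show "x \<in> reach ss r"
    proof induction
      case (step x \<sigma>)
      then obtain i where "i < length (map2 (\<circ>) ss ts)" and i2: "\<sigma> = map2 (\<circ>) ss ts ! i"
        unfolding in_set_conv_nth by blast
      then have i: "i < m" "\<sigma> = map2 (\<circ>) ss ts ! i" using len by auto
      have "x \<in> B" using step reach_subset[OF ss r] by auto
      then have "\<sigma> x = (ss ! i) x" using i ap nth by simp
      moreover have "(ss ! i) x \<in> reach ss r" using reach.step[OF step.IH, of "ss ! i"] i len by simp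
      ultimately show ?case by simp
    qed (rule reach.base)
  next
    fix x assume "x \<in> reach ss r"
    then show "x \<in> reach (map2 (\<circ>) ss ts) r"
    proof induction
      case (step x \<sigma>)
      then obtain i where i: "i < m" "\<sigma> = ss ! i" using len unfolding in_set_conv_nth by blast
      have "x \<in> B" using step reach_subset[OF ss r] by auto
      then have "\<sigma> x = (map2 (\<circ>) ss ts ! i) x" using i ap nth by simp
      moreover have "map2 (\<circ>) ss ts ! i \<in> set (map2 (\<circ>) ss ts)" using i len by (intro nth_mem) simp
      ultimately show ?case using reach.step[OF step.IH, of "map2 (\<circ>) ss ts ! i"] by metis
    qed (rule reach.base)
  qed
qed

text \<open>All entries preserve the orbit \<open>B\<close> of \<open>r\<close>. A tuple with this
  orbit is therefore a pair of restrictions: a transitive tuple on \<open>B\<close> and an arbitrary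
  one on the complement.\<close>

lemma split_tups:
  assumes fin: "finite S" and r: "r \<in> B" and B: "B \<subseteq> S"
  shows "bij_betw (\<lambda>(ss, ts). map2 (\<circ>) ss ts) ({ss \<in> tups m B. reach ss r = B} \<times> tups m (S - B))
    {ss \<in> tups m S. reach ss r = B}"
proof (rule bij_betw_byWitness[where f' = "\<lambda>ss. (map (\<lambda>\<sigma>. perm_restrict \<sigma> B) ss, map (\<lambda>\<sigma>. perm_restrict \<sigma> (S - B)) ss)"])
  have dis: "B \<inter> (S - B) = {}" by auto
  have restr: "perm_restrict (\<sigma> \<circ> \<tau>) B = \<sigma>" "perm_restrict (\<sigma> \<circ> \<tau>) (S - B) = \<tau>"
    if "\<sigma> permutes B" "\<tau> permutes (S - B)" for \<sigma> \<tau>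
  proof -
    note ap = disjoint_comp_apply[OF that dis]
    show "perm_restrict (\<sigma> \<circ> \<tau>) B = \<sigma>"
    proof
      fix x show "perm_restrict (\<sigma> \<circ> \<tau>) B x = \<sigma> x"
        using ap(1)[of x] permutes_not_in[OF that(1), of x] by (cases "x \<in> B") (auto simp: perm_restrict_def)
    qed
    show "perm_restrict (\<sigma> \<circ> \<tau>) (S - B) = \<tau>"
    proof
      fix x show "perm_restrict (\<sigma> \<circ> \<tau>) (S - B) x = \<tau> x"
        using ap(2)[of x] permutes_not_in[OF that(2), of x] by (cases "x \<in> S - B") (auto simp: perm_restrict_def)
    qed
  qed
  show "\<forall>a\<in>{ss \<in> tups m B. reach ss r = B} \<times> tups m (S - B).
    (map (\<lambda>\<sigma>. perm_restrict \<sigma> B) (case a of (ss, ts) \<Rightarrow> map2 (\<circ>) ss ts),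
     map (\<lambda>\<sigma>. perm_restrict \<sigma> (S - B)) (case a of (ss, ts) \<Rightarrow> map2 (\<circ>) ss ts)) = a"
  proof (rule ballI)
    fix q assume "q \<in> {ss \<in> tups m B. reach ss r = B} \<times> tups m (S - B)"
    then obtain ss ts where q: "q = (ss, ts)" and a: "ss \<in> tups m B" "ts \<in> tups m (S - B)" by auto
    have "\<And>i. i < m \<Longrightarrow> ss ! i permutes B" "\<And>i. i < m \<Longrightarrow> ts ! i permutes (S - B)"
      using a by (auto simp: tups_def)
    then have "map (\<lambda>\<sigma>. perm_restrict \<sigma> B) (map2 (\<circ>) ss ts) = ss \<and>
       map (\<lambda>\<sigma>. perm_restrict \<sigma> (S - B)) (map2 (\<circ>) ss ts) = ts"
      using a restr by (simp add: tups_def list_eq_iff_nth_eq)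
    then show "(map (\<lambda>\<sigma>. perm_restrict \<sigma> B) (case q of (ss, ts) \<Rightarrow> map2 (\<circ>) ss ts),
     map (\<lambda>\<sigma>. perm_restrict \<sigma> (S - B)) (case q of (ss, ts) \<Rightarrow> map2 (\<circ>) ss ts)) = q"
      by (simp only: q prod.case)
  qed
  have closed: "\<sigma> x \<in> B \<longleftrightarrow> x \<in> B" if "ss \<in> tups m S" "reach ss r = B" "\<sigma> \<in> set ss" for ss \<sigma> x
    using reach_closed[OF that(1) fin that(3), of r x] that(2) r B by auto
  show "\<forall>ss\<in>{ss \<in> tups m S. reach ss r = B}. (case (map (\<lambda>\<sigma>. perm_restrict \<sigma> B) ss, map (\<lambda>\<sigma>. perm_restrict \<sigma> (S - B)) ss)
      of (ss, ts) \<Rightarrow> map2 (\<circ>) ss ts) = ss"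
  proof (rule ballI)
    fix ss assume "ss \<in> {ss \<in> tups m S. reach ss r = B}"
    then have ss: "ss \<in> tups m S" "reach ss r = B" by auto
    have "perm_restrict \<sigma> B \<circ> perm_restrict \<sigma> (S - B) = \<sigma>" if "\<sigma> \<in> set ss" for \<sigma>
    proof
      fix x
      have "\<sigma> permutes S" using ss that by (auto simp: tups_def)
      then have "x \<in> S \<longleftrightarrow> \<sigma> x \<in> S" "x \<notin> S \<Longrightarrow> \<sigma> x = x"
        by (auto simp: permutes_in_image permutes_not_in)
      then show "(perm_restrict \<sigma> B \<circ> perm_restrict \<sigma> (S - B)) x = \<sigma> x"
        using closed[OF ss that, of x] B by (auto simp: perm_restrict_def)
    qed
    then have "map2 (\<circ>) (map (\<lambda>\<sigma>. perm_restrict \<sigma> B) ss) (map (\<lambda>\<sigma>. perm_restrict \<sigma> (S - B)) ss) = ss"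
      by (simp add: list_eq_iff_nth_eq)
    then show "(case (map (\<lambda>\<sigma>. perm_restrict \<sigma> B) ss, map (\<lambda>\<sigma>. perm_restrict \<sigma> (S - B)) ss)
      of (ss, ts) \<Rightarrow> map2 (\<circ>) ss ts) = ss" by (simp only: prod.case)
  qed
  have un: "B \<union> (S - B) = S" using B by auto
  show "(\<lambda>(ss, ts). map2 (\<circ>) ss ts) ` ({ss \<in> tups m B. reach ss r = B} \<times> tups m (S - B)) \<subseteq> {ss \<in> tups m S. reach ss r = B}"
  proof (rule image_subsetI)
    fix q assume "q \<in> {ss \<in> tups m B. reach ss r = B} \<times> tups m (S - B)"
    then obtain ss ts where q: "q = (ss, ts)" and a: "ss \<in> tups m B" "ts \<in> tups m (S - B)" "reach ss r = B" by auto
    have "\<sigma> \<circ> \<tau> permutes S" if "\<sigma> permutes B" "\<tau> permutes (S - B)" for \<sigma> \<tau>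
      using that B by (intro permutes_compose) (auto intro: permutes_subset)
    then have "map2 (\<circ>) ss ts \<in> tups m S"
    proof -
      have "\<rho> permutes S" if "\<rho> \<in> set (map2 (\<circ>) ss ts)" for \<rho>
      proof -
        have "\<rho> \<in> (\<lambda>(x, y). x \<circ> y) ` set (zip ss ts)" using that by (simp only: set_map)
        then obtain q where q: "\<rho> = (\<lambda>(x, y). x \<circ> y) q" "q \<in> set (zip ss ts)" by (rule imageE)
        define \<sigma> \<tau> where "\<sigma> = fst q" and "\<tau> = snd q"
        then have \<sigma>\<tau>: "(\<sigma>, \<tau>) \<in> set (zip ss ts)" "\<rho> = \<sigma> \<circ> \<tau>"
          using q by (simp_all add: split_beta)
        have "\<sigma> \<in> set ss" "\<tau> \<in> set ts"
          using set_zip_leftD[OF \<sigma>\<tau>(1)] set_zip_rightD[OF \<sigma>\<tau>(1)] by auto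
        then show ?thesis using a(1,2) \<sigma>\<tau>(2) \<open>\<And>\<sigma> \<tau>. \<lbrakk>\<sigma> permutes B; \<tau> permutes (S - B)\<rbrakk> \<Longrightarrow> \<sigma> \<circ> \<tau> permutes S\<close>
          by (simp add: tups_def)
      qed
      then show ?thesis using a(1,2) by (simp add: tups_def)
    qed
    then show "(case q of (ss, ts) \<Rightarrow> map2 (\<circ>) ss ts) \<in> {ss \<in> tups m S. reach ss r = B}"
      using reach_map2_comp[OF a(1,2) dis r] a(3) by (simp only: q prod.case mem_Collect_eq simp_thms)
  qed
  show "(\<lambda>ss. (map (\<lambda>\<sigma>. perm_restrict \<sigma> B) ss, map (\<lambda>\<sigma>. perm_restrict \<sigma> (S - B)) ss)) ` {ss \<in> tups m S. reach ss r = B}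
     \<subseteq> {ss \<in> tups m B. reach ss r = B} \<times> tups m (S - B)"
  proof (rule image_subsetI)
    fix ss assume ss: "ss \<in> {ss \<in> tups m S. reach ss r = B}"
    let ?s1 = "map (\<lambda>\<sigma>. perm_restrict \<sigma> B) ss" and ?s2 = "map (\<lambda>\<sigma>. perm_restrict \<sigma> (S - B)) ss"
    have cl: "\<sigma> x \<in> B \<longleftrightarrow> x \<in> B" if "\<sigma> \<in> set ss" for \<sigma> x using closed ss that by blast
    have pm: "\<sigma> permutes S" if "\<sigma> \<in> set ss" for \<sigma> using ss that by (auto simp: tups_def)
    have s1: "?s1 \<in> tups m B"
      using ss perm_restrict_permutes[OF pm B cl] by (auto simp: tups_def)
    have "\<sigma> x \<in> S - B \<longleftrightarrow> x \<in> S - B" if "\<sigma> \<in> set ss" for \<sigma> x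
      using cl[OF that] permutes_in_image[OF pm[OF that]] by auto
    then have s2: "?s2 \<in> tups m (S - B)"
      using ss perm_restrict_permutes[OF pm, of _ "S - B"] by (auto simp: tups_def)
    have "reach ?s1 r = reach ss r"
    proof (intro equalityI subsetI)
      fix x assume "x \<in> reach ?s1 r"
      then show "x \<in> reach ss r"
      proof induction
        case (step x \<sigma>)
        then show ?case by (auto simp: perm_restrict_def intro: reach.step)
      qed (rule reach.base)
    next
      fix x assume "x \<in> reach ss r"
      then show "x \<in> reach ?s1 r"
      proof induction
        case (step x \<sigma>)
        then have "x \<in> B" using ss by auto
        then have "\<sigma> x = perm_restrict \<sigma> B x" by (simp add: perm_restrict_def)
        moreover have "perm_restrict \<sigma> B \<in> set ?s1" using step by auto
        ultimately show ?case using reach.step[OF step.IH, of "perm_restrict \<sigma> B"] by simp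
      qed (rule reach.base)
    qed
    then show "(?s1, ?s2) \<in> {ss \<in> tups m B. reach ss r = B} \<times> tups m (S - B)"
      using s1 s2 ss by simp
  qed
qed

definition tsum :: "nat \<Rightarrow> real \<Rightarrow> 'a set \<Rightarrow> real" where
  "tsum m u S = (\<Sum>ss\<in>tups m S. u ^ wt S ss)"

definition csum :: "nat \<Rightarrow> real \<Rightarrow> 'a \<Rightarrow> 'a set \<Rightarrow> real" where
  "csum m u r S = (\<Sum>ss | ss \<in> tups m S \<and> reach ss r = S. u ^ wt S ss)"

text \<open>The exponential formula in its pointed form: tuples are sorted by the orbit of one
  marked point, and the weight is multiplicative since cycles do not cross between the two
  parts.\<close>

lemma tsum_split:
  assumes fin: "finite S" and r: "r \<in> S"
  shows "tsum m u S = (\<Sum>B | r \<in> B \<and> B \<subseteq> S. csum m u r B * tsum m u (S - B))"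
proof -
  have finB: "finite {B. r \<in> B \<and> B \<subseteq> S}" using fin by (auto intro: finite_subset[of _ "Pow S"])
  have "tsum m u S = (\<Sum>B | r \<in> B \<and> B \<subseteq> S. \<Sum>ss | ss \<in> tups m S \<and> reach ss r = B. u ^ wt S ss)"
    unfolding tsum_def
  proof (rule sum.group[OF finite_tups[OF fin] finB, symmetric])
    show "(\<lambda>ss. reach ss r) ` tups m S \<subseteq> {B. r \<in> B \<and> B \<subseteq> S}"
    proof (rule image_subsetI)
      fix ss assume "ss \<in> tups m S"
      then show "reach ss r \<in> {B. r \<in> B \<and> B \<subseteq> S}"
        using reach_subset[OF _ r, of ss m] reach.base[of r ss] by simp
    qed
  qed
  also have "\<dots> = (\<Sum>B | r \<in> B \<and> B \<subseteq> S. csum m u r B * tsum m u (S - B))"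
  proof (rule sum.cong[OF refl], clarify)
    fix B assume B: "r \<in> B" "B \<subseteq> S"
    have finB: "finite B" using B fin finite_subset by auto
    have "(\<Sum>ss | ss \<in> tups m S \<and> reach ss r = B. u ^ wt S ss) =
      (\<Sum>q\<in>{ss \<in> tups m B. reach ss r = B} \<times> tups m (S - B). u ^ wt S (case q of (ss, ts) \<Rightarrow> map2 (\<circ>) ss ts))"
      by (rule sum.reindex_bij_betw[OF split_tups[OF fin B], symmetric])
    also have "\<dots> = (\<Sum>(ss, ts)\<in>{ss \<in> tups m B. reach ss r = B} \<times> tups m (S - B). u ^ wt B ss * u ^ wt (S - B) ts)"
    proof (rule sum.cong[OF refl])
      fix q assume "q \<in> {ss \<in> tups m B. reach ss r = B} \<times> tups m (S - B)"
      then obtain ss ts where q: "q = (ss, ts)" "ss \<in> tups m B" "ts \<in> tups m (S - B)" by auto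
      then have "wt (B \<union> (S - B)) (map2 (\<circ>) ss ts) = wt B ss + wt (S - B) ts"
        using fin finB by (intro wt_map2_comp) auto
      moreover have "B \<union> (S - B) = S" using B by auto
      ultimately show "u ^ wt S (case q of (ss, ts) \<Rightarrow> map2 (\<circ>) ss ts) = (case q of (ss, ts) \<Rightarrow> u ^ wt B ss * u ^ wt (S - B) ts)"
        by (simp only: q prod.case power_add)
    qed
    also have "\<dots> = csum m u r B * tsum m u (S - B)"
      by (simp add: csum_def tsum_def sum_product sum.cartesian_product)
    finally show "(\<Sum>ss | ss \<in> tups m S \<and> reach ss r = B. u ^ wt S ss) = csum m u r B * tsum m u (S - B)" .
  qed
  finally show ?thesis .
qed


section \<open>Invariance under relabelling the points\<close>

definition relabel :: "('a \<Rightarrow> 'a) \<Rightarrow> ('a \<Rightarrow> 'a) \<Rightarrow> 'a \<Rightarrow> 'a" where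
  "relabel \<rho> \<sigma> = \<rho> \<circ> \<sigma> \<circ> inv_into UNIV \<rho>"

lemma relabel_apply: "bij \<rho> \<Longrightarrow> relabel \<rho> \<sigma> (\<rho> x) = \<rho> (\<sigma> x)"
  by (simp add: relabel_def bij_is_inj)

lemma relabel_permutes:
  assumes "bij \<rho>" "\<sigma> permutes S" shows "relabel \<rho> \<sigma> permutes \<rho> ` S"
proof -
  have "bij (relabel \<rho> \<sigma>)"
    unfolding relabel_def by (intro bij_comp bij_imp_bij_inv assms(1) permutes_bij[OF assms(2)])
  moreover have "relabel \<rho> \<sigma> x = x" if "x \<notin> \<rho> ` S" for x
  proof -
    obtain y where y: "x = \<rho> y" using assms(1) by (meson bij_pointE)
    then have "\<sigma> y = y" using that permutes_not_in[OF assms(2)] by blast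
    then show ?thesis using relabel_apply[OF assms(1)] y by simp
  qed
  ultimately show ?thesis by (simp add: permutes_def bij_iff)
qed

lemma relabel_inverse: "bij \<rho> \<Longrightarrow> relabel (inv_into UNIV \<rho>) (relabel \<rho> \<sigma>) = \<sigma>"
  by (rule ext) (simp add: relabel_def inv_inv_eq bij_is_inj)

lemma relabel_inverse': "bij \<rho> \<Longrightarrow> relabel \<rho> (relabel (inv_into UNIV \<rho>) \<sigma>) = \<sigma>"
  using relabel_inverse[OF bij_imp_bij_inv, of \<rho>] by (simp add: inv_inv_eq)

lemma relabel_comp: "bij \<rho> \<Longrightarrow> relabel \<rho> (\<sigma> \<circ> \<tau>) = relabel \<rho> \<sigma> \<circ> relabel \<rho> \<tau>"
  by (rule ext) (simp add: relabel_def bij_is_inj)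

lemma relabel_id: "bij \<rho> \<Longrightarrow> relabel \<rho> id = id"
  unfolding relabel_def by (rule ext) (simp add: bij_is_surj surj_f_inv_f)

lemma lprod_relabel: "bij \<rho> \<Longrightarrow> lprod (map (relabel \<rho>) ss) = relabel \<rho> (lprod ss)"
proof (induction ss)
  case (Cons \<sigma> ss)
  then show ?case by (simp only: list.map lprod_Cons relabel_comp)
qed (simp add: lprod_def relabel_id)

lemma ncyc_relabel:
  assumes \<rho>: "bij \<rho>" and p: "\<sigma> permutes S" and fin: "finite S"
  shows "ncyc (\<rho> ` S) (relabel \<rho> \<sigma>) = ncyc S \<sigma>"
proof -
  have perm: "permutation \<sigma>" using p fin by (auto simp: permutation_permutes)
  have "\<rho> ` orbit \<sigma> x = orbit (relabel \<rho> \<sigma>) (\<rho> x)" for x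
    by (rule orbit_inverse[OF permutation_self_in_orbit[OF perm]]) (rule relabel_apply[OF \<rho>])
  then have "orbit (relabel \<rho> \<sigma>) ` \<rho> ` S = (`) \<rho> ` orbit \<sigma> ` S"
    by (simp add: image_image)
  moreover have "inj_on ((`) \<rho>) (orbit \<sigma> ` S)"
    using bij_is_inj[OF \<rho>] by (auto simp: inj_on_def inj_image_eq_iff)
  ultimately show ?thesis by (simp add: ncyc_def card_image)
qed

lemma tups_relabel: "bij \<rho> \<Longrightarrow> ss \<in> tups m S \<Longrightarrow> map (relabel \<rho>) ss \<in> tups m (\<rho> ` S)"
  by (auto simp: tups_def intro: relabel_permutes)

lemma wt_relabel:
  assumes \<rho>: "bij \<rho>" and ss: "ss \<in> tups m S" and fin: "finite S"
  shows "wt (\<rho> ` S) (map (relabel \<rho>) ss) = wt S ss"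
proof -
  have "map (ncyc (\<rho> ` S)) (map (relabel \<rho>) ss) = map (ncyc S) ss"
    using ss fin by (simp add: tups_def ncyc_relabel[OF \<rho>])
  then show ?thesis
    unfolding wt_def lprod_relabel[OF \<rho>] ncyc_relabel[OF \<rho> lprod_permutes[OF ss] fin] by (simp only:)
qed

lemma reach_relabel:
  assumes \<rho>: "bij \<rho>"
  shows "reach (map (relabel \<rho>) ss) (\<rho> r) = \<rho> ` reach ss r"
proof (intro equalityI subsetI)
  fix x assume "x \<in> reach (map (relabel \<rho>) ss) (\<rho> r)"
  then show "x \<in> \<rho> ` reach ss r"
  proof induction
    case base
    then show ?case by (intro imageI reach.base)
  next
    case (step x \<sigma>)
    then obtain \<tau> y where "\<tau> \<in> set ss" "\<sigma> = relabel \<rho> \<tau>" "y \<in> reach ss r" "x = \<rho> y" by auto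
    then show ?case using reach.step[of y ss r \<tau>] relabel_apply[OF \<rho>] by auto
  qed
next
  fix x assume "x \<in> \<rho> ` reach ss r"
  then obtain y where "x = \<rho> y" "y \<in> reach ss r" by auto
  from this(2) have "\<rho> y \<in> reach (map (relabel \<rho>) ss) (\<rho> r)"
  proof induction
    case (step y \<sigma>)
    then show ?case using reach.step[OF step.IH, of "relabel \<rho> \<sigma>"] relabel_apply[OF \<rho>, of \<sigma> y] by simp
  qed (rule reach.base)
  then show "x \<in> reach (map (relabel \<rho>) ss) (\<rho> r)" using \<open>x = \<rho> y\<close> by simp
qed

lemma bij_betw_tups_relabel:
  assumes \<rho>: "bij \<rho>"
  shows "bij_betw (map (relabel \<rho>)) (tups m S) (tups m (\<rho> ` S))"
proof (rule bij_betw_byWitness[where f' = "map (relabel (inv_into UNIV \<rho>))"])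
  show "map (relabel (inv_into UNIV \<rho>)) ` tups m (\<rho> ` S) \<subseteq> tups m S"
    using tups_relabel[OF bij_imp_bij_inv[OF \<rho>], of _ m "\<rho> ` S"] bij_is_inj[OF \<rho>] by (auto simp: image_inv_f_f)
  show "map (relabel \<rho>) ` tups m S \<subseteq> tups m (\<rho> ` S)"
    using tups_relabel[OF \<rho>] by auto
qed (auto simp: relabel_inverse[OF \<rho>] relabel_inverse'[OF \<rho>] o_def)

lemma tsum_relabel:
  fixes \<rho> :: "'a \<Rightarrow> 'a"
  assumes \<rho>: "bij \<rho>" and fin: "finite S"
  shows "tsum m u (\<rho> ` S) = tsum m u S"
proof -
  have "tsum m u (\<rho> ` S) = (\<Sum>ss\<in>tups m S. u ^ wt (\<rho> ` S) (map (relabel \<rho>) ss))"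
    unfolding tsum_def by (rule sum.reindex_bij_betw[OF bij_betw_tups_relabel[OF \<rho>], symmetric])
  also have "\<dots> = tsum m u S"
    unfolding tsum_def by (intro sum.cong refl) (simp add: wt_relabel[OF \<rho> _ fin])
  finally show ?thesis .
qed

lemma csum_relabel:
  fixes \<rho> :: "'a \<Rightarrow> 'a"
  assumes \<rho>: "bij \<rho>" and fin: "finite S"
  shows "csum m u (\<rho> r) (\<rho> ` S) = csum m u r S"
proof -
  have "bij_betw (map (relabel \<rho>)) {ss \<in> tups m S. reach ss r = S}
     {ss \<in> tups m (\<rho> ` S). reach ss (\<rho> r) = \<rho> ` S}"
    unfolding bij_betw_def
  proof
    show "inj_on (map (relabel \<rho>)) {ss \<in> tups m S. reach ss r = S}"
      using bij_betw_imp_inj_on[OF bij_betw_tups_relabel[OF \<rho>, of m S]] by (rule inj_on_subset) auto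
    have im: "map (relabel \<rho>) ` tups m S = tups m (\<rho> ` S)"
      by (rule bij_betw_imp_surj_on[OF bij_betw_tups_relabel[OF \<rho>]])
    have "reach (map (relabel \<rho>) ss) (\<rho> r) = \<rho> ` S \<longleftrightarrow> reach ss r = S" for ss
      unfolding reach_relabel[OF \<rho>] using bij_is_inj[OF \<rho>] by (simp add: inj_image_eq_iff)
    then show "map (relabel \<rho>) ` {ss \<in> tups m S. reach ss r = S} = {ss \<in> tups m (\<rho> ` S). reach ss (\<rho> r) = \<rho> ` S}"
      unfolding im[symmetric] by auto
  qed
  then have "csum m u (\<rho> r) (\<rho> ` S) = (\<Sum>ss | ss \<in> tups m S \<and> reach ss r = S. u ^ wt (\<rho> ` S) (map (relabel \<rho>) ss))"
    unfolding csum_def by (rule sum.reindex_bij_betw[symmetric])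
  also have "\<dots> = csum m u r S"
    unfolding csum_def
  proof (rule sum.cong[OF refl])
    fix ss assume "ss \<in> {ss \<in> tups m S. reach ss r = S}"
    then have "ss \<in> tups m S" by simp
    then show "u ^ wt (\<rho> ` S) (map (relabel \<rho>) ss) = u ^ wt S ss"
      by (simp only: wt_relabel[OF \<rho> _ fin])
  qed
  finally show ?thesis .
qed

text \<open>The sets \<open>S\<close> and \<open>{0..<card S}\<close> have complements of equal size
  in their union, so a bijection between them extends to a permutation of the union. A transposition
  afterwards puts the marked point at 0.\<close>

lemma ex_bij_initial_segment:
  fixes S :: "nat set"
  assumes fin: "finite S"
  shows "\<exists>\<rho>. bij \<rho> \<and> \<rho> ` S = {0..<card S} \<and> (r \<in> S \<longrightarrow> \<rho> r = 0)"
proof -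
  let ?n = "card S"
  let ?U = "S \<union> {0..<?n}"
  obtain g where g: "bij_betw g S {0..<?n}" using ex_bij_betw_finite_nat[OF fin] by auto
  have "card (?U - S) = card (?U - {0..<?n})"
    using fin by (simp add: card_Diff_subset)
  then obtain h where h: "bij_betw h (?U - S) (?U - {0..<?n})"
    using fin finite_same_card_bij[of "?U - S" "?U - {0..<?n}"] by auto
  define f where "f x = (if x \<in> S then g x else if x \<in> ?U then h x else x)" for x
  have "bij_betw f S {0..<?n}" using g by (rule bij_betw_cong[THEN iffD1, rotated]) (simp add: f_def)
  moreover have "bij_betw f (?U - S) (?U - {0..<?n})"
    using h by (rule bij_betw_cong[THEN iffD1, rotated]) (auto simp: f_def)
  ultimately have "bij_betw f (S \<union> (?U - S)) ({0..<?n} \<union> (?U - {0..<?n}))"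
    by (rule bij_betw_combine) auto
  moreover have "S \<union> (?U - S) = ?U" "{0..<?n} \<union> (?U - {0..<?n}) = ?U" by auto
  ultimately have "bij_betw f ?U ?U" by simp
  then have "f permutes ?U" by (rule bij_imp_permutes) (auto simp: f_def)
  then have f: "bij f" by (rule permutes_bij)
  have fS: "f ` S = {0..<?n}" using \<open>bij_betw f S {0..<?n}\<close> by (rule bij_betw_imp_surj_on)
  show ?thesis
  proof (cases "r \<in> S")
    case True
    then have fr: "f r \<in> {0..<?n}" using fS by auto
    then have t: "transpose (f r) 0 permutes {0..<?n}" by (intro permutes_swap_id) auto
    have "bij (transpose (f r) 0 \<circ> f)" using f permutes_bij[OF t] by (rule bij_comp)
    moreover have "(transpose (f r) 0 \<circ> f) ` S = {0..<?n}"
      unfolding image_comp[symmetric] fS by (rule permutes_image[OF t])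
    ultimately show ?thesis by (intro exI[of _ "transpose (f r) 0 \<circ> f"]) simp
  next
    case False
    then show ?thesis using f fS by auto
  qed
qed

definition conn :: "nat \<Rightarrow> real \<Rightarrow> nat \<Rightarrow> real" where
  "conn m u n = csum m u 0 {0..<n}"

lemma tsum_card: "finite S \<Longrightarrow> tsum m u S = total m u (card S)" for S :: "nat set"
  using ex_bij_initial_segment[of S] tsum_relabel[of _ S m u] by (fastforce simp: total_def tsum_def)

lemma csum_card: "finite S \<Longrightarrow> r \<in> S \<Longrightarrow> csum m u r S = conn m u (card S)" for S :: "nat set"
  using ex_bij_initial_segment[of S r] csum_relabel[of _ S m u r] by (fastforce simp: conn_def)

text \<open>The orbit of the marked point 0 contains \<open>k\<close> of the other \<open>n\<close>
  points.\<close>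

lemma total_rec:
  "total m u (Suc n) = (\<Sum>k=0..n. real (n choose k) * conn m u (Suc k) * total m u (n - k))"
proof -
  let ?S = "{0..<Suc n}"
  let ?f = "\<lambda>c. conn m u c * total m u (Suc n - c)"
  have "total m u (Suc n) = tsum m u ?S" by (simp add: total_def tsum_def)
  also have "\<dots> = (\<Sum>B | 0 \<in> B \<and> B \<subseteq> ?S. csum m u 0 B * tsum m u (?S - B))"
    by (rule tsum_split) auto
  also have "\<dots> = (\<Sum>B | 0 \<in> B \<and> B \<subseteq> ?S. ?f (card B))"
  proof (rule sum.cong[OF refl], clarify)
    fix B assume B: "0 \<in> B" "B \<subseteq> ?S"
    then have fin: "finite B" using finite_subset by blast
    then have "card (?S - B) = Suc n - card B" using B by (simp add: card_Diff_subset)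
    then show "csum m u 0 B * tsum m u (?S - B) = ?f (card B)"
      using csum_card[OF fin B(1)] tsum_card[of "?S - B"] by simp
  qed
  also have "\<dots> = (\<Sum>B'\<in>Pow {1..<Suc n}. ?f (Suc (card B')))"
  proof (rule sum.reindex_bij_witness[of _ "insert 0" "\<lambda>B. B - {0}"], goal_cases)
    case (5 B)
    then have "finite B" using finite_subset by blast
    then show ?case using 5 by (simp add: card_Suc_Diff1 del: card_Diff_insert)
  qed auto
  also have "\<dots> = (\<Sum>k=0..n. \<Sum>B' | B' \<in> Pow {1..<Suc n} \<and> card B' = k. ?f (Suc (card B')))"
  proof (rule sum.group[symmetric])
    have "card B' \<le> n" if "B' \<subseteq> {1..<Suc n}" for B' using card_mono[OF _ that] by simp
    then show "card ` Pow {1..<Suc n} \<subseteq> {0..n}" by auto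
  qed auto
  also have "\<dots> = (\<Sum>k=0..n. real (n choose k) * ?f (Suc k))"
  proof (rule sum.cong[OF refl])
    fix k
    have "card {B'. B' \<subseteq> {1..<Suc n} \<and> card B' = k} = n choose k"
      by (subst n_subsets) auto
    then show "(\<Sum>B' | B' \<in> Pow {1..<Suc n} \<and> card B' = k. ?f (Suc (card B'))) = real (n choose k) * ?f (Suc k)"
      by simp
  qed
  finally show ?thesis by (simp add: mult.assoc)
qed

text \<open>The operator z d/dz applied to the exponential generating function of transitive tuples;
  it multiplies the coefficient by \<open>n\<close>, whence the factorial of \<open>n - 1\<close>.
  It is also the logarithmic derivative of \<open>Zser\<close>.\<close>

definition Aser :: "nat \<Rightarrow> real \<Rightarrow> real fps" where
  "Aser m u = Abs_fps (\<lambda>n. if n = 0 then 0 else conn m u n / fact (n - 1))"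

lemma fps_theta_Zser: "fps_theta (Zser m u) = Zser m u * Aser m u"
proof (rule fps_ext)
  fix n
  show "fps_nth (fps_theta (Zser m u)) n = fps_nth (Zser m u * Aser m u) n"
  proof (cases n)
    case (Suc k)
    have "fps_nth (Aser m u * Zser m u) (Suc k) = (\<Sum>i=0..Suc k. fps_nth (Aser m u) i * fps_nth (Zser m u) (Suc k - i))"
      by (simp add: fps_mult_nth)
    also have "\<dots> = (\<Sum>i=0..k. fps_nth (Aser m u) (Suc i) * fps_nth (Zser m u) (k - i))"
      by (subst sum.atLeast0_atMost_Suc_shift) (simp add: Aser_def)
    also have "\<dots> = (\<Sum>i=0..k. real (k choose i) * conn m u (Suc i) * total m u (k - i)) / fact k"
      unfolding sum_divide_distrib
      by (intro sum.cong refl) (simp add: Aser_def Zser_def binomial_fact)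
    also have "\<dots> = total m u (Suc k) / fact k" by (simp add: total_rec)
    also have "\<dots> = fps_nth (fps_theta (Zser m u)) (Suc k)" by (simp add: Zser_def)
    finally show ?thesis using Suc by (simp add: mult.commute)
  qed (simp add: Aser_def)
qed

text \<open>In terms of logarithmic derivatives the Toda equation reads
  \<open>c * fps_X * (P * Q) = Z * Z * ?t A\<close>. Differentiating it once more and using it a
  second time to replace the left-hand side leaves the common factor \<open>Z * Z\<close>, which
  cancels.\<close>

lemma Aser_toda:
  "fps_theta (fps_theta (Aser m (real (Suc n)))) - fps_theta (Aser m (real (Suc n))) =
   fps_theta (Aser m (real (Suc n))) * (Aser m (real (n + 2)) + Aser m (real n) - 2 * Aser m (real (Suc n)))"
proof -
  define Z P Q where "Z = Zser m (real (Suc n))" and "P = Zser m (real (n + 2))" and "Q = Zser m (real n)"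
  define A B C where "A = Aser m (real (Suc n))" and "B = Aser m (real (n + 2))" and "C = Aser m (real n)"
  define c where "c = fps_const (real (Suc n) ^ Suc m)"
  let ?t = fps_theta
  have tZ: "?t Z = Z * A" "?t P = P * B" "?t Q = Q * C"
    unfolding Z_def P_def Q_def A_def B_def C_def by (rule fps_theta_Zser)+
  have tc: "?t c = 0" "?t fps_X = fps_X" by (simp_all add: c_def fps_theta_def)
  have "c * fps_X * (P * Q) = Z * ?t (?t Z) - (?t Z)\<^sup>2"
    unfolding c_def Z_def P_def Q_def by (rule toda_Suc)
  also have "\<dots> = Z * Z * ?t A"
    by (simp add: tZ fps_theta_mult power2_eq_square algebra_simps)
  finally have toda: "c * fps_X * (P * Q) = Z * Z * ?t A" .
  \<comment> \<open>The 1 is the logarithmic derivative of \<open>fps_X\<close>; the constant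
    \<open>c\<close>, which depends on \<open>N\<close> and \<open>m\<close>, disappears.\<close>
  have "c * fps_X * (P * Q) * (1 + B + C) = ?t (c * fps_X * (P * Q))"
    by (simp add: tZ tc fps_theta_mult algebra_simps)
  also have "\<dots> = Z * Z * (2 * A * ?t A + ?t (?t A))"
    unfolding toda by (simp add: tZ fps_theta_mult algebra_simps)
  finally have "Z * Z * (?t A * (1 + B + C)) = Z * Z * (2 * A * ?t A + ?t (?t A))"
    unfolding toda by (simp add: mult_ac)
  moreover have "Z * Z \<noteq> 0" using Zser_nonzero[of m "real (Suc n)"] by (simp add: Z_def)
  ultimately have "?t A * (1 + B + C) = 2 * A * ?t A + ?t (?t A)" by (simp only: mult_cancel_left) simp
  then have "?t (?t A) - ?t A = ?t A * (B + C - 2 * A)" by (simp add: algebra_simps)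
  then show ?thesis unfolding A_def B_def C_def .
qed

section \<open>Recursion for polynomials in N\<close>

definition conn_tups :: "nat \<Rightarrow> nat \<Rightarrow> (nat \<Rightarrow> nat) list set" where
  "conn_tups m n = {ss \<in> tups m {0..<n}. reach ss 0 = {0..<n}}"

lemma finite_conn_tups [simp]: "finite (conn_tups m n)"
  unfolding conn_tups_def using finite_tups[of "{0..<n}" m] by simp

definition cpoly :: "nat \<Rightarrow> nat \<Rightarrow> real poly" where
  "cpoly m n = (\<Sum>ss\<in>conn_tups m n. monom (1 / fact (n - 1)) (wt {0..<n} ss))"

lemma cpoly_0: "cpoly m 0 = 0"
proof -
  have "0 \<in> reach ss (0::nat)" for ss by (rule reach.base)
  then have "conn_tups m 0 = {}" by (auto simp: conn_tups_def)
  then show ?thesis by (simp add: cpoly_def)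
qed

lemma poly_cpoly: "poly (cpoly m n) u = fps_nth (Aser m u) n"
proof (cases "n = 0")
  case True
  then show ?thesis by (simp add: cpoly_0 Aser_def)
next
  case False
  then show ?thesis
    by (simp add: Aser_def cpoly_def conn_def csum_def conn_tups_def poly_sum poly_monom sum_divide_distrib)
qed

definition second_diff :: "real poly \<Rightarrow> real poly" where
  "second_diff p = pcompose p [:1, 1:] + pcompose p [:-1, 1:] - smult 2 p"

text \<open>For each \<open>n\<close> both sides are polynomials, and \<open>Aser_toda\<close> makes
  them agree at every positive integer.\<close>

lemma cpoly_rec:
  "smult (real n * (real n - 1)) (cpoly m n) =
   (\<Sum>k=0..n. smult (real k) (cpoly m k * second_diff (cpoly m (n - k))))" (is "?L = ?R")
proof -
  have eq: "poly ?L (real (Suc N)) = poly ?R (real (Suc N))" for N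
  proof -
    let ?u = "real (Suc N)"
    have u: "1 + ?u = real (N + 2)" "- 1 + ?u = real N" by auto
    have sd: "poly (second_diff (cpoly m k)) ?u = fps_nth (Aser m (real (N + 2)) + Aser m (real N) - 2 * Aser m ?u) k" for k
    proof -
      have "fps_nth (2 * Aser m ?u) k = 2 * fps_nth (Aser m ?u) k"
        by (simp add: fps_numeral_fps_const)
      moreover have "poly (second_diff (cpoly m k)) ?u =
         poly (cpoly m k) (1 + ?u) + poly (cpoly m k) (- 1 + ?u) - 2 * poly (cpoly m k) ?u"
        by (simp add: second_diff_def poly_pcompose)
      ultimately show ?thesis unfolding u poly_cpoly by simp
    qed
    have "poly ?R ?u = fps_nth (fps_theta (Aser m ?u) * (Aser m (real (N + 2)) + Aser m (real N) - 2 * Aser m ?u)) n"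
      by (simp add: poly_sum sd poly_cpoly fps_mult_nth mult.assoc del: of_nat_Suc)
    also have "\<dots> = fps_nth (fps_theta (fps_theta (Aser m ?u)) - fps_theta (Aser m ?u)) n"
      by (simp only: Aser_toda)
    also have "\<dots> = poly ?L ?u" by (simp add: poly_cpoly algebra_simps del: of_nat_Suc)
    finally show ?thesis by simp
  qed
  have "?L - ?R = 0"
  proof (rule ccontr)
    assume "?L - ?R \<noteq> 0"
    then have "finite {x. poly (?L - ?R) x = 0}" by (rule poly_roots_finite)
    moreover have "range (\<lambda>N. real (Suc N)) \<subseteq> {x. poly (?L - ?R) x = 0}" using eq by auto
    ultimately have "finite (range (\<lambda>N. real (Suc N)))" by (rule finite_subset[rotated])
    moreover have "inj (\<lambda>N. real (Suc N))" by (auto simp: inj_def)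
    ultimately show False using finite_imageD infinite_UNIV_nat by blast
  qed
  then show ?thesis by simp
qed

lemma second_diff_add: "second_diff (p + q) = second_diff p + second_diff q"
  by (simp add: second_diff_def pcompose_add smult_add_right)

lemma second_diff_sum: "second_diff (sum f A) = (\<Sum>a\<in>A. second_diff (f a))"
proof (induction A rule: infinite_finite_induct)
  case (insert a A)
  then show ?case by (simp add: second_diff_add)
qed (simp_all add: second_diff_def)

lemma coeff_linear_power: "coeff ([:a, 1:] ^ e) k = (if k \<le> e then real (e choose k) * a ^ (e - k) else 0)"
  for a :: real
proof (cases "k \<le> e")
  case True
  then show ?thesis by (subst coeff_linear_poly_power) auto
next
  case False
  have "degree ([:a, 1:] ^ e) = e" by (simp add: degree_power_eq)
  then show ?thesis using False by (simp add: coeff_eq_0)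
qed

text \<open>In the two shifted powers the terms with an odd power of the shift cancel and the even
  ones double; the subtracted middle term removes the power 0. The bound \<open>G\<close> is only
  required to be large: summands with \<open>2 * h + 2 > E\<close> vanish through their binomial
  coefficient, although truncated subtraction gives them exponent 0.\<close>

lemma second_diff_monom:
  assumes G: "E \<le> G"
  shows "second_diff (monom c E) = (\<Sum>h=0..G. monom (c * 2 * real (E choose (2 * h + 2))) (E - (2 * h + 2)))"
proof (rule poly_eqI)
  fix k
  have pc: "pcompose (monom c E) [:a, 1:] = smult c ([:a, 1:] ^ E)" for a
    by (intro poly_eq_poly_eq_iff[THEN iffD1] ext) (simp add: poly_pcompose poly_monom)
  have "coeff (\<Sum>h=0..G. monom (c * 2 * real (E choose (2 * h + 2))) (E - (2 * h + 2))) k =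
     (\<Sum>h=0..G. if E - (2 * h + 2) = k then c * 2 * real (E choose (2 * h + 2)) else 0)"
    by (simp add: coeff_sum cong: if_cong)
  also have "\<dots> = c * ((if k \<le> E then real (E choose k) * 1 ^ (E - k) else 0)
      + (if k \<le> E then real (E choose k) * (-1) ^ (E - k) else 0) - 2 * (if k = E then 1 else 0))"
  proof (cases "k < E \<and> even (E - k)")
    case True
    then obtain j where j: "E - k = 2 * j" by (blast elim: evenE)
    then have "j > 0" using True by auto
    then obtain h where h: "j = Suc h" by (cases j) auto
    then have E: "E = k + 2 * h + 2" using j True by simp
    have "(\<Sum>h'=0..G. if E - (2 * h' + 2) = k then c * 2 * real (E choose (2 * h' + 2)) else 0) =
        (\<Sum>h'=0..G. if h' = h then c * 2 * real (E choose (2 * h + 2)) else 0)"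
    proof (rule sum.cong[OF refl])
      fix h'
      show "(if E - (2 * h' + 2) = k then c * 2 * real (E choose (2 * h' + 2)) else 0) =
        (if h' = h then c * 2 * real (E choose (2 * h + 2)) else 0)"
      proof (cases "2 * h' + 2 \<le> E")
        case True
        then have "E - (2 * h' + 2) = k \<longleftrightarrow> h' = h" using E by auto
        then show ?thesis by simp
      next
        case False
        then have "E choose (2 * h' + 2) = 0" "h' \<noteq> h" using E by (auto simp: binomial_eq_0)
        then show ?thesis by (simp del: One_nat_def)
      qed
    qed
    also have "\<dots> = c * 2 * real (E choose (2 * h + 2))" using E G by simp
    also have "E choose (2 * h + 2) = E choose k"
      using binomial_symmetric[of k E] E by simp
    finally show ?thesis using True j by (simp add: power_mult)
  next
    case False
    have "(\<Sum>h=0..G. if E - (2 * h + 2) = k then c * 2 * real (E choose (2 * h + 2)) else 0) = 0"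
    proof (rule sum.neutral, rule ballI)
      fix h
      show "(if E - (2 * h + 2) = k then c * 2 * real (E choose (2 * h + 2)) else 0) = 0"
      proof (cases "2 * h + 2 \<le> E")
        case True
        then have "E - (2 * h + 2) \<noteq> k" using False by auto
        then show ?thesis by simp
      next
        case False
        then have "E choose (2 * h + 2) = 0" by (auto simp: binomial_eq_0)
        then show ?thesis by simp
      qed
    qed
    moreover have "k = E \<or> k > E \<or> (k < E \<and> odd (E - k))" using False by linarith
    ultimately show ?thesis by (auto simp: )
  qed
  also have "\<dots> = coeff (second_diff (monom c E)) k"
    by (simp only: second_diff_def pc coeff_add coeff_diff coeff_smult coeff_linear_power coeff_monom) (simp add: algebra_simps)
  finally show "coeff (second_diff (monom c E)) k =
     coeff (\<Sum>h=0..G. monom (c * 2 * real (E choose (2 * h + 2))) (E - (2 * h + 2))) k" by simp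
qed

section \<open>Coefficients of the recursion\<close>

text \<open>The weight of a tuple of genus 0, by Euler's formula; the weight drops by 2 with each handle.\<close>

definition dtop :: "nat \<Rightarrow> nat \<Rightarrow> nat" where
  "dtop m n = (m - 1) * n + 2"

text \<open>The surplus 2 is absorbed by the second difference, which lowers the degree by
  \<open>2 * h + 2\<close>. This is why the genera and \<open>h\<close> add up to
  \<open>g\<close>.\<close>

lemma dtop_add: "dtop m k + dtop m l = dtop m (k + l) + 2"
  by (simp add: dtop_def distrib_left)

text \<open>Without the guard, truncated subtraction would return the constant coefficient when the
  genus is too large.\<close>

definition ccoef :: "nat \<Rightarrow> nat \<Rightarrow> nat \<Rightarrow> real" where
  "ccoef m n g = (if 2 * g \<le> dtop m n then coeff (cpoly m n) (dtop m n - 2 * g) else 0)"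

lemma tups_singleton: "tups m {a} = {replicate m id}"
proof (intro equalityI subsetI)
  fix ss assume "ss \<in> tups m {a}"
  then have "length ss = m" "\<forall>\<sigma>\<in>set ss. \<sigma> = id" by (auto simp: tups_def permutes_sing)
  then show "ss \<in> {replicate m id}" by (metis replicate_length_same singletonI)
qed (auto simp: tups_def permutes_id)

lemma cpoly_1: "cpoly m 1 = monom 1 (Suc m)"
proof -
  have s: "{0..<1::nat} = {0}" by auto
  have "reach (replicate m id) (0::nat) = {0}"
  proof (intro equalityI subsetI)
    fix x assume "x \<in> reach (replicate m id) (0::nat)"
    then show "x \<in> {0}" by induction auto
  qed (auto intro: reach.base)
  then have "conn_tups m 1 = {replicate m id}"
    unfolding conn_tups_def s by (auto simp: tups_singleton)
  moreover have "lprod (replicate m (id :: nat \<Rightarrow> nat)) = id"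
    by (induction m) (auto simp: lprod_def)
  ultimately show ?thesis
    unfolding cpoly_def s by (simp add: wt_def ncyc_def sum_list_replicate)
qed

lemma cpoly_expand_of_support:
  assumes supp: "\<And>e. coeff (cpoly m n) e \<noteq> 0 \<Longrightarrow> \<exists>g. e + 2 * g = dtop m n" and G: "dtop m n \<le> G"
  shows "cpoly m n = (\<Sum>g=0..G. monom (ccoef m n g) (dtop m n - 2 * g))"
proof (rule poly_eqI)
  fix e
  have "coeff (\<Sum>g=0..G. monom (ccoef m n g) (dtop m n - 2 * g)) e =
     (\<Sum>g=0..G. if dtop m n - 2 * g = e then ccoef m n g else 0)"
    by (simp add: coeff_sum)
  also have "\<dots> = coeff (cpoly m n) e"
  proof (cases "\<exists>g. e + 2 * g = dtop m n")
    case True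
    then obtain g where g: "e + 2 * g = dtop m n" by auto
    have "(\<Sum>g'=0..G. if dtop m n - 2 * g' = e then ccoef m n g' else 0) =
        (\<Sum>g'=0..G. if g' = g then coeff (cpoly m n) e else 0)"
      using g by (intro sum.cong refl) (auto simp: ccoef_def)
    then show ?thesis using g G by simp
  next
    case False
    then have "coeff (cpoly m n) e = 0" using supp by blast
    moreover have "(\<Sum>g=0..G. if dtop m n - 2 * g = e then ccoef m n g else 0) = 0"
    proof (rule sum.neutral, rule ballI)
      fix g
      have "e + 2 * g \<noteq> dtop m n" using False by blast
      then show "(if dtop m n - 2 * g = e then ccoef m n g else 0) = 0" by (auto simp: ccoef_def)
    qed
    ultimately show ?thesis by simp
  qed
  finally show "coeff (cpoly m n) e = coeff (\<Sum>g=0..G. monom (ccoef m n g) (dtop m n - 2 * g)) e" by simp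
qed

lemma cpoly_mult_second_diff:
  assumes k: "cpoly m k = (\<Sum>g=0..G. monom (ccoef m k g) (dtop m k - 2 * g))"
    and l: "cpoly m l = (\<Sum>g=0..G. monom (ccoef m l g) (dtop m l - 2 * g))"
    and G: "dtop m l \<le> G"
  shows "coeff (cpoly m k * second_diff (cpoly m l)) e =
    (\<Sum>(g1, g2, h)\<in>{0..G} \<times> {0..G} \<times> {0..G}. if e + 2 * (g1 + g2 + h) = dtop m (k + l)
       then ccoef m k g1 * ccoef m l g2 * 2 * real ((dtop m l - 2 * g2) choose (2 * h + 2)) else 0)"
proof -
  have "second_diff (cpoly m l) = (\<Sum>g2=0..G. \<Sum>h=0..G.
     monom (ccoef m l g2 * 2 * real ((dtop m l - 2 * g2) choose (2 * h + 2))) (dtop m l - 2 * g2 - (2 * h + 2)))"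
    unfolding l second_diff_sum by (intro sum.cong refl second_diff_monom) (use G in auto)
  then have "cpoly m k * second_diff (cpoly m l) = (\<Sum>g1=0..G. \<Sum>g2=0..G. \<Sum>h=0..G.
     monom (ccoef m k g1) (dtop m k - 2 * g1) *
     monom (ccoef m l g2 * 2 * real ((dtop m l - 2 * g2) choose (2 * h + 2))) (dtop m l - 2 * g2 - (2 * h + 2)))"
    by (subst k, subst sum_distrib_right) (simp only: sum_distrib_left)
  also have "\<dots> = (\<Sum>(g1, g2, h)\<in>{0..G} \<times> {0..G} \<times> {0..G}.
     monom (ccoef m k g1 * (ccoef m l g2 * 2 * real ((dtop m l - 2 * g2) choose (2 * h + 2))))
       (dtop m k - 2 * g1 + (dtop m l - 2 * g2 - (2 * h + 2))))"
    by (simp only: mult_monom sum.cartesian_product split_beta)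
  finally have "coeff (cpoly m k * second_diff (cpoly m l)) e = (\<Sum>(g1, g2, h)\<in>{0..G} \<times> {0..G} \<times> {0..G}.
     if dtop m k - 2 * g1 + (dtop m l - 2 * g2 - (2 * h + 2)) = e
     then ccoef m k g1 * (ccoef m l g2 * 2 * real ((dtop m l - 2 * g2) choose (2 * h + 2))) else 0)"
    by (simp add: coeff_sum split_beta cong: if_cong)
  also have "\<dots> = (\<Sum>(g1, g2, h)\<in>{0..G} \<times> {0..G} \<times> {0..G}. if e + 2 * (g1 + g2 + h) = dtop m (k + l)
       then ccoef m k g1 * ccoef m l g2 * 2 * real ((dtop m l - 2 * g2) choose (2 * h + 2)) else 0)"
  proof (intro sum.cong refl, clarify)
    fix g1 g2 h
    show "(if dtop m k - 2 * g1 + (dtop m l - 2 * g2 - (2 * h + 2)) = e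
     then ccoef m k g1 * (ccoef m l g2 * 2 * real ((dtop m l - 2 * g2) choose (2 * h + 2))) else 0) =
     (if e + 2 * (g1 + g2 + h) = dtop m (k + l)
       then ccoef m k g1 * ccoef m l g2 * 2 * real ((dtop m l - 2 * g2) choose (2 * h + 2)) else 0)"
    \<comment> \<open>Inside this region no subtraction is truncated and the two conditions on the
      exponents are equivalent. Outside it one of the factors is zero, so the conditions may
      differ.\<close>
    proof (cases "2 * g1 \<le> dtop m k \<and> 2 * g2 \<le> dtop m l \<and> 2 * h + 2 \<le> dtop m l - 2 * g2")
      case True
      obtain a where a: "dtop m k = 2 * g1 + a" using True le_Suc_ex by blast
      obtain b where b: "dtop m l - 2 * g2 = 2 * h + 2 + b" using True le_Suc_ex by blast
      have "dtop m l = 2 * g2 + (2 * h + 2 + b)" using True b by simp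
      then have "dtop m k - 2 * g1 + (dtop m l - 2 * g2 - (2 * h + 2)) = e \<longleftrightarrow> e + 2 * (g1 + g2 + h) = dtop m (k + l)"
        using a b dtop_add[of m k l] by auto
      then show ?thesis by (simp only: mult.assoc)
    next
      case False
      then have "ccoef m k g1 = 0 \<or> ccoef m l g2 = 0 \<or> (dtop m l - 2 * g2) choose (2 * h + 2) = 0"
        by (auto simp: ccoef_def binomial_eq_0)
      then show ?thesis by auto
    qed
  qed
  finally show ?thesis .
qed

text \<open>Given the claim for smaller indices, the right side of the recursion is a sum over
  \<open>(g1, g2, h)\<close>, and a nonzero term at exponent \<open>e\<close> exhibits
  \<open>g1 + g2 + h\<close> as the witness. The case \<open>n = 1\<close> is computed by hand, for
  there the factor \<open>n * (n - 1)\<close> on the left vanishes.\<close>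

lemma cpoly_support:
  assumes m: "m \<ge> 1"
  shows "coeff (cpoly m n) e \<noteq> 0 \<Longrightarrow> \<exists>g. e + 2 * g = dtop m n"
proof (induction n arbitrary: e rule: less_induct)
  case (less n)
  consider "n = 0" | "n = 1" | "n \<ge> 2" by linarith
  then show ?case
  proof cases
    case 1
    then show ?thesis using less.prems by (simp add: cpoly_0)
  next
    case 2
    then show ?thesis using less.prems m by (auto simp: cpoly_1[simplified] dtop_def split: if_splits)
  next
    case 3
    have "real n * (real n - 1) * coeff (cpoly m n) e \<noteq> 0" using less.prems 3 by auto
    moreover have "real n * (real n - 1) * coeff (cpoly m n) e =
       (\<Sum>k=0..n. real k * coeff (cpoly m k * second_diff (cpoly m (n - k))) e)"
      using arg_cong[OF cpoly_rec[of n m], of "\<lambda>p. coeff p e"] by (simp add: coeff_sum)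
    ultimately have "(\<Sum>k=0..n. real k * coeff (cpoly m k * second_diff (cpoly m (n - k))) e) \<noteq> 0"
      by (simp only:) simp
    then obtain k where k: "k \<le> n" "real k * coeff (cpoly m k * second_diff (cpoly m (n - k))) e \<noteq> 0"
      by (metis (no_types, lifting) atLeastAtMost_iff sum.neutral)
    \<comment> \<open>The end terms drop out, \<open>k = 0\<close> by its factor and
      \<open>k = n\<close> since \<open>cpoly m 0 = 0\<close>; hence the induction hypothesis covers
      both indices.\<close>
    have "n - k \<noteq> 0" using k(2) by (cases "n - k = 0") (auto simp: cpoly_0 second_diff_def)
    then have lt: "k < n" "n - k < n" using k by (auto intro: Nat.gr0I)
    let ?G = "dtop m k + dtop m (n - k)"
    have "coeff (cpoly m k * second_diff (cpoly m (n - k))) e =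
      (\<Sum>(g1, g2, h)\<in>{0..?G} \<times> {0..?G} \<times> {0..?G}. if e + 2 * (g1 + g2 + h) = dtop m (k + (n - k))
       then ccoef m k g1 * ccoef m (n - k) g2 * 2 * real ((dtop m (n - k) - 2 * g2) choose (2 * h + 2)) else 0)"
      using less.IH[OF lt(1)] less.IH[OF lt(2)]
      by (intro cpoly_mult_second_diff cpoly_expand_of_support) auto
    then have "(\<Sum>(g1, g2, h)\<in>{0..?G} \<times> {0..?G} \<times> {0..?G}. if e + 2 * (g1 + g2 + h) = dtop m n
       then ccoef m k g1 * ccoef m (n - k) g2 * 2 * real ((dtop m (n - k) - 2 * g2) choose (2 * h + 2)) else 0) \<noteq> 0"
      using k by simp
    then obtain q where "(case q of (g1, g2, h) \<Rightarrow> if e + 2 * (g1 + g2 + h) = dtop m n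
       then ccoef m k g1 * ccoef m (n - k) g2 * 2 * real ((dtop m (n - k) - 2 * g2) choose (2 * h + 2)) else 0) \<noteq> 0"
      by (metis (no_types, lifting) sum.neutral)
    then show ?thesis
      by (cases q) (auto split: if_splits intro!: exI[of _ "fst q + fst (snd q) + snd (snd q)"])
  qed
qed

lemma cpoly_expand:
  assumes "m \<ge> 1" "dtop m n \<le> G"
  shows "cpoly m n = (\<Sum>g=0..G. monom (ccoef m n g) (dtop m n - 2 * g))"
  using cpoly_support[OF assms(1)] assms(2) by (intro cpoly_expand_of_support) auto

lemma ccoef_rec:
  assumes m: "m \<ge> 1"
  shows "real n * (real n - 1) * ccoef m n g =
    (\<Sum>k=0..n. real k * (\<Sum>(g1, g2, h) | g1 + g2 + h = g.
       ccoef m k g1 * ccoef m (n - k) g2 * 2 * real ((dtop m (n - k) - 2 * g2) choose (2 * h + 2))))"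
proof -
  let ?t = "\<lambda>k (g1, g2, h). ccoef m k g1 * ccoef m (n - k) g2 * 2 * real ((dtop m (n - k) - 2 * g2) choose (2 * h + 2))"
  have fin: "finite {(g1, g2, h). g1 + g2 + h = g}"
    by (rule finite_subset[of _ "{0..g} \<times> {0..g} \<times> {0..g}"]) auto
  show ?thesis
  proof (cases "2 * g \<le> dtop m n")
    case True
    define e where "e = dtop m n - 2 * g"
    have e: "e + 2 * g = dtop m n" using True by (simp add: e_def)
    have "real n * (real n - 1) * ccoef m n g = coeff (smult (real n * (real n - 1)) (cpoly m n)) e"
      using True by (simp add: ccoef_def e_def)
    also have "\<dots> = (\<Sum>k=0..n. real k * coeff (cpoly m k * second_diff (cpoly m (n - k))) e)"
      unfolding cpoly_rec by (simp add: coeff_sum)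
    also have "\<dots> = (\<Sum>k=0..n. real k * (\<Sum>q | (\<lambda>(g1, g2, h). g1 + g2 + h = g) q. ?t k q))"
    proof (intro sum.cong refl arg_cong2[of _ _ _ _ "(*)"])
      fix k assume k: "k \<in> {0..n}"
      let ?G = "dtop m k + dtop m (n - k) + g"
      have "coeff (cpoly m k * second_diff (cpoly m (n - k))) e =
        (\<Sum>(g1, g2, h)\<in>{0..?G} \<times> {0..?G} \<times> {0..?G}. if e + 2 * (g1 + g2 + h) = dtop m (k + (n - k))
         then ccoef m k g1 * ccoef m (n - k) g2 * 2 * real ((dtop m (n - k) - 2 * g2) choose (2 * h + 2)) else 0)"
        using m by (intro cpoly_mult_second_diff cpoly_expand) auto
      also have "\<dots> = (\<Sum>q\<in>{0..?G} \<times> {0..?G} \<times> {0..?G}. if (\<lambda>(g1, g2, h). g1 + g2 + h = g) q then ?t k q else 0)"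
      proof (intro sum.cong refl)
        fix q :: "nat \<times> nat \<times> nat"
        obtain g1 g2 h where q: "q = (g1, g2, h)" by (cases q) auto
        have "e + 2 * (g1 + g2 + h) = dtop m (k + (n - k)) \<longleftrightarrow> g1 + g2 + h = g" using e k by auto
        then show "(case q of (g1, g2, h) \<Rightarrow> if e + 2 * (g1 + g2 + h) = dtop m (k + (n - k))
         then ccoef m k g1 * ccoef m (n - k) g2 * 2 * real ((dtop m (n - k) - 2 * g2) choose (2 * h + 2)) else 0)
         = (if (\<lambda>(g1, g2, h). g1 + g2 + h = g) q then ?t k q else 0)"
          by (simp add: q)
      qed
      also have "\<dots> = (\<Sum>q | q \<in> {0..?G} \<times> {0..?G} \<times> {0..?G} \<and> (\<lambda>(g1, g2, h). g1 + g2 + h = g) q. ?t k q)"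
        by (rule sum.inter_filter[symmetric]) simp
      also have "{q. q \<in> {0..?G} \<times> {0..?G} \<times> {0..?G} \<and> (\<lambda>(g1, g2, h). g1 + g2 + h = g) q} = {q. (\<lambda>(g1, g2, h). g1 + g2 + h = g) q}"
        by auto
      finally show "coeff (cpoly m k * second_diff (cpoly m (n - k))) e = (\<Sum>q | (\<lambda>(g1, g2, h). g1 + g2 + h = g) q. ?t k q)" .
    qed
    finally show ?thesis by simp
  next
    case False
    \<comment> \<open>The genus is too large for the left side. A nonzero term on the right would
      bound \<open>2 * g + 2\<close> by \<open>dtop m k + dtop m (n - k)\<close>, which is
      \<open>dtop m n + 2\<close>.\<close>
    have "ccoef m k g1 * ccoef m (n - k) g2 * 2 * real ((dtop m (n - k) - 2 * g2) choose (2 * h + 2)) = 0"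
      if "g1 + g2 + h = g" "k \<le> n" for g1 g2 h k
    proof (rule ccontr)
      assume "\<not> ?thesis"
      then have "2 * g1 \<le> dtop m k" "2 * g2 \<le> dtop m (n - k)" "2 * h + 2 \<le> dtop m (n - k) - 2 * g2"
        by (auto simp: ccoef_def split: if_splits)
      moreover have "dtop m k + dtop m (n - k) = dtop m n + 2" using dtop_add[of m k "n - k"] that by simp
      ultimately show False using that False by linarith
    qed
    then have "(\<Sum>(g1, g2, h) | g1 + g2 + h = g.
       ccoef m k g1 * ccoef m (n - k) g2 * 2 * real ((dtop m (n - k) - 2 * g2) choose (2 * h + 2))) = 0" if "k \<le> n" for k
      using that by (intro sum.neutral) auto
    then show ?thesis using False by (simp add: ccoef_def)
  qed
qed

text \<open>A way to count orbits: replace the orbit of a dart by a simpler label that distinguishes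
  the same darts.\<close>

lemma card_image_eq_if_same_kernel:
  assumes "\<And>x y. x \<in> D \<Longrightarrow> y \<in> D \<Longrightarrow> F x = F y \<longleftrightarrow> G x = G y"
  shows "card (F ` D) = card (G ` D)"
proof -
  have "bij_betw (\<lambda>c. G (SOME x. x \<in> D \<and> F x = c)) (F ` D) (G ` D)"
  proof -
    have pick: "(SOME y. y \<in> D \<and> F y = F x) \<in> D \<and> F (SOME y. y \<in> D \<and> F y = F x) = F x" if "x \<in> D" for x
      using that by (intro someI[of "\<lambda>y. y \<in> D \<and> F y = F x" x]) simp
    then have "G (SOME y. y \<in> D \<and> F y = F x) = G x" if "x \<in> D" for x
      using that assms by blast
    then show ?thesis unfolding bij_betw_def inj_on_def image_image using assms by auto
  qed
  then show ?thesis by (rule bij_betw_same_card)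
qed

section \<open>Constellations as tuples of permutations\<close>

text \<open>A dart \<open>(s, i, b)\<close> lies on the edge from the star \<open>s\<close> to its neighbour of colour \<open>i + 1\<close>, at the
  coloured end iff \<open>b\<close>.\<close>

definition dset :: "nat \<Rightarrow> nat \<Rightarrow> (nat \<times> nat \<times> bool) set" where
  "dset m n = {0..<n} \<times> {0..<m} \<times> UNIV"

text \<open>The two clauses produce the two kinds of vertices: a star is one turn through the
  colours, and a vertex of colour \<open>i + 1\<close> is a cycle of \<open>ss ! i\<close>.\<close>

fun rotD :: "nat \<Rightarrow> (nat \<Rightarrow> nat) list \<Rightarrow> nat \<times> nat \<times> bool \<Rightarrow> nat \<times> nat \<times> bool" where
  "rotD m ss (s, i, False) = (s, Suc i mod m, False)"
| "rotD m ss (s, i, True) = ((ss ! i) s, i, True)"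

fun oppD :: "nat \<times> nat \<times> bool \<Rightarrow> nat \<times> nat \<times> bool" where
  "oppD (s, i, b) = (s, i, \<not> b)"

lemma dset_iff: "(s, i, b) \<in> dset m n \<longleftrightarrow> s < n \<and> i < m"
  by (auto simp: dset_def)

lemma finite_dset [simp]: "finite (dset m n)"
  by (simp add: dset_def)

lemma orbit_Suc_mod:
  assumes "i < m"
  shows "orbit (\<lambda>j. Suc j mod m) i = {0..<m}"
proof -
  have pow: "((\<lambda>j. Suc j mod m) ^^ k) i = (i + k) mod m" for k
    using assms by (induction k) (auto simp: mod_Suc_eq)
  show ?thesis
  proof (intro equalityI subsetI)
    fix j assume "j \<in> orbit (\<lambda>j. Suc j mod m) i"
    then show "j \<in> {0..<m}" using assms by (auto simp: orbit_altdef pow)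
  next
    fix j assume j: "j \<in> {0..<m}"
    \<comment> \<open>The exponent has to be positive and \<open>j - i\<close> may be negative, so a
      full turn of length \<open>m\<close> is added.\<close>
    have "j = ((\<lambda>j. Suc j mod m) ^^ (m - i + j)) i" using assms j by (simp add: pow)
    moreover have "m - i + j > 0" using assms by simp
    ultimately show "j \<in> orbit (\<lambda>j. Suc j mod m) i" unfolding orbit_altdef by blast
  qed
qed

locale ptup =
  fixes m n :: nat and ss :: "(nat \<Rightarrow> nat) list"
  assumes m_pos: "0 < m" and n_pos: "0 < n" and ss_tups: "ss \<in> tups m {0..<n}"
begin

lemma len: "length ss = m"
  using ss_tups by (simp add: tups_def)

lemma perm: "i < m \<Longrightarrow> ss ! i permutes {0..<n}"
  using ss_tups by (auto simp: tups_def)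

lemma perm_less: "i < m \<Longrightarrow> (ss ! i) s < n \<longleftrightarrow> s < n"
  using permutes_in_image[OF perm, of i s] by simp

lemma permutation: "i < m \<Longrightarrow> permutation (ss ! i)"
  using perm by (auto simp: permutation_permutes)

lemma rotD_dset: "x \<in> dset m n \<Longrightarrow> rotD m ss x \<in> dset m n"
proof -
  assume x: "x \<in> dset m n"
  obtain s i b where "x = (s, i, b)" by (cases x) auto
  then show ?thesis using x m_pos by (cases b) (auto simp: dset_iff perm_less)
qed

lemma oppD_dset: "oppD x \<in> dset m n \<longleftrightarrow> x \<in> dset m n"
  by (cases x) (auto simp: dset_iff)

lemma orbit_rotD_False:
  assumes "i < m"
  shows "orbit (rotD m ss) (s, i, False) = (\<lambda>j. (s, j, False)) ` {0..<m}"
proof -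
  have "(\<lambda>j. (s, j, False)) ` orbit (\<lambda>j. Suc j mod m) i = orbit (rotD m ss) (s, i, False)"
    by (rule orbit_inverse) (use assms in \<open>auto simp: orbit_Suc_mod\<close>)
  then show ?thesis by (simp add: orbit_Suc_mod[OF assms])
qed

lemma orbit_rotD_True:
  assumes "i < m"
  shows "orbit (rotD m ss) (s, i, True) = (\<lambda>t. (t, i, True)) ` orbit (ss ! i) s"
proof -
  have "(\<lambda>t. (t, i, True)) ` orbit (ss ! i) s = orbit (rotD m ss) (s, i, True)"
    by (rule orbit_inverse[OF permutation_self_in_orbit[OF permutation[OF assms]]]) simp
  then show ?thesis by simp
qed

lemma card_vertices: "card (orbit (rotD m ss) ` dset m n) = n + (\<Sum>i=0..<m. ncyc {0..<n} (ss ! i))"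
proof -
  \<comment> \<open>The label of a vertex: the star itself, or the colour together with a cycle of
    its permutation.\<close>
  define \<psi> where "\<psi> x = (case x of (s, i, b) \<Rightarrow> if b then Inr (i, orbit (ss ! i) s) else Inl s)" for x :: "nat \<times> nat \<times> bool"
  have "card (orbit (rotD m ss) ` dset m n) = card (\<psi> ` dset m n)"
  proof (rule card_image_eq_if_same_kernel)
    fix x y assume xy: "x \<in> dset m n" "y \<in> dset m n"
    obtain s i b t j c where x: "x = (s, i, b)" and y: "y = (t, j, c)" by (cases x, cases y) auto
    have ij: "i < m" "j < m" using xy by (auto simp: x y dset_iff)
    have self: "s \<in> orbit (ss ! i) s" for s by (rule permutation_self_in_orbit[OF permutation[OF ij(1)]])
    have self': "t \<in> orbit (ss ! j) t" by (rule permutation_self_in_orbit[OF permutation[OF ij(2)]])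
    show "orbit (rotD m ss) x = orbit (rotD m ss) y \<longleftrightarrow> \<psi> x = \<psi> y"
    proof (cases b; cases c)
      assume bc: b c
      have "(\<lambda>t. (t, i, True)) ` orbit (ss ! i) s = (\<lambda>t. (t, j, True)) ` orbit (ss ! j) t \<longleftrightarrow>
         i = j \<and> orbit (ss ! i) s = orbit (ss ! j) t" (is "?L \<longleftrightarrow> ?R")
      proof
        assume L: ?L
        then have "(s, i, True) \<in> (\<lambda>t. (t, j, True)) ` orbit (ss ! j) t" using self by blast
        then have "i = j" by auto
        moreover have "inj (\<lambda>t :: nat. (t, j, True))" by (auto simp: inj_def)
        ultimately show ?R using L inj_image_eq_iff[of "\<lambda>t :: nat. (t, j, True)" "orbit (ss ! j) s" "orbit (ss ! j) t"] by auto
      next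
        assume ?R
        then show ?L by auto
      qed
      then show ?thesis using bc ij by (simp add: x y \<psi>_def orbit_rotD_True)
    next
      assume bc: b "\<not> c"
      have "(s, i, True) \<in> orbit (rotD m ss) x" using bc self ij by (simp add: x orbit_rotD_True)
      moreover have "(s, i, True) \<notin> orbit (rotD m ss) y" using bc ij by (auto simp: y orbit_rotD_False)
      ultimately have "orbit (rotD m ss) x \<noteq> orbit (rotD m ss) y" by metis
      then show ?thesis using bc by (simp add: x y \<psi>_def)
    next
      assume bc: "\<not> b" c
      have "(t, j, True) \<in> orbit (rotD m ss) y" using bc self' ij by (simp add: y orbit_rotD_True)
      moreover have "(t, j, True) \<notin> orbit (rotD m ss) x" using bc ij by (auto simp: x orbit_rotD_False)
      ultimately have "orbit (rotD m ss) x \<noteq> orbit (rotD m ss) y" by metis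
      then show ?thesis using bc by (simp add: x y \<psi>_def)
    next
      assume bc: "\<not> b" "\<not> c"
      have "(\<lambda>j. (s, j, False)) ` {0..<m} = (\<lambda>j. (t, j, False)) ` {0..<m} \<longleftrightarrow> s = t"
        using m_pos by (auto simp: set_eq_iff image_iff)
      then show ?thesis using bc ij by (simp add: x y \<psi>_def orbit_rotD_False)
    qed
  qed
  also have "\<psi> ` dset m n = Inl ` {0..<n} \<union> Inr ` (Sigma {0..<m} (\<lambda>i. orbit (ss ! i) ` {0..<n}))"
    (is "_ = ?R")
  proof (intro equalityI subsetI)
    fix y assume "y \<in> \<psi> ` dset m n"
    then show "y \<in> ?R" by (auto simp: \<psi>_def dset_def)
  next
    fix y assume "y \<in> ?R"
    then consider s where "s < n" "y = Inl s" | i s where "i < m" "s < n" "y = Inr (i, orbit (ss ! i) s)" by auto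
    then show "y \<in> \<psi> ` dset m n"
    proof cases
      case 1
      then show ?thesis using m_pos by (intro image_eqI[of _ _ "(s, 0, False)"]) (auto simp: \<psi>_def dset_iff)
    next
      case 2
      then show ?thesis by (intro image_eqI[of _ _ "(s, i, True)"]) (auto simp: \<psi>_def dset_iff)
    qed
  qed
  also have "card \<dots> = card (Inl ` {0..<n} :: (nat + nat \<times> nat set) set) + card (Inr ` (Sigma {0..<m} (\<lambda>i. orbit (ss ! i) ` {0..<n})) :: (nat + nat \<times> nat set) set)"
    by (rule card_Un_disjoint) auto
  also have "\<dots> = n + (\<Sum>i=0..<m. ncyc {0..<n} (ss ! i))"
    by (simp add: card_image card_SigmaI ncyc_def)
  finally show ?thesis .
qed

lemma card_edges: "card ((\<lambda>x. {x, oppD x}) ` dset m n) = m * n"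
proof -
  have "card ((\<lambda>x. {x, oppD x}) ` dset m n) = card ((\<lambda>(s, i, b). (s, i)) ` dset m n)"
  proof (rule card_image_eq_if_same_kernel)
    fix x y :: "nat \<times> nat \<times> bool"
    show "{x, oppD x} = {y, oppD y} \<longleftrightarrow> (\<lambda>(s, i, b). (s, i)) x = (\<lambda>(s, i, b). (s, i)) y"
      by (cases x, cases y) (auto simp: doubleton_eq_iff)
  qed
  also have "(\<lambda>(s, i, b). (s, i)) ` dset m n = {0..<n} \<times> {0..<m}" by (force simp: dset_def)
  finally show ?thesis by (simp add: mult.commute)
qed

abbreviation faceD :: "nat \<times> nat \<times> bool \<Rightarrow> nat \<times> nat \<times> bool" where
  "faceD \<equiv> rotD m ss \<circ> oppD"

lemma faceD_dset: "x \<in> dset m n \<Longrightarrow> faceD x \<in> dset m n"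
  by (simp add: rotD_dset oppD_dset)

lemma faceD_self:
  assumes x: "x \<in> dset m n"
  shows "x \<in> orbit faceD x"
proof -
  have injR: "inj_on faceD (dset m n)"
  proof (rule inj_onI)
    fix x y assume xy: "x \<in> dset m n" "y \<in> dset m n" "faceD x = faceD y"
    obtain s i b t j c where x: "x = (s, i, b)" and y: "y = (t, j, c)" by (cases x, cases y) auto
    have ij: "i < m" "j < m" using xy by (auto simp: x y dset_iff)
    show "x = y"
    proof (cases b; cases c)
      assume bc: b c
      then have "Suc i mod m = Suc j mod m" "s = t" using xy(3) by (auto simp: x y)
      moreover have "Suc k mod m = (if Suc k = m then 0 else Suc k)" if "k < m" for k using that by auto
      ultimately show ?thesis using bc ij by (auto simp: x y split: if_splits)
    next
      assume bc: "\<not> b" "\<not> c"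
      then show ?thesis using xy(3) ij permutes_inj[OF perm, of i] by (auto simp: x y dest: injD)
    qed (use xy(3) in \<open>auto simp: x y\<close>)
  qed
  have "faceD ` dset m n = dset m n"
    using faceD_dset injR by (intro endo_inj_surj) auto
  then have bij: "bij_betw faceD (dset m n) (dset m n)" using injR by (simp add: bij_betw_def)
  \<comment> \<open>\<open>faceD\<close> is a bijection on \<open>dset m n\<close> only. Continued
    by the identity it is a permutation of the whole type, and for those each point lies on its own
    orbit.\<close>
  define F where "F y = (if y \<in> dset m n then faceD y else y)" for y
  have "bij_betw F (dset m n) (dset m n)"
    using bij by (rule bij_betw_cong[THEN iffD1, rotated]) (simp add: F_def)
  then have "F permutes dset m n" by (rule bij_imp_permutes) (auto simp: F_def)
  then have "permutation F" unfolding permutation_permutes using finite_dset by blast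
  then have "x \<in> orbit F x" by (rule permutation_self_in_orbit)
  moreover have "orbit faceD x = orbit F x"
    using x faceD_dset by (intro orbit_cong0[of _ "dset m n"]) (auto simp: F_def)
  ultimately show ?thesis by simp
qed

lemma lprod_take_Suc: "i < m \<Longrightarrow> lprod (take (Suc i) ss) = ss ! i \<circ> lprod (take i ss)"
proof -
  have app: "lprod (xs @ [\<sigma>]) = \<sigma> \<circ> lprod xs" for xs :: "(nat \<Rightarrow> nat) list" and \<sigma>
  proof (induction xs)
    case (Cons \<tau> xs)
    then show ?case by (simp only: append_Cons lprod_Cons o_assoc)
  qed (simp add: lprod_def)
  assume "i < m"
  then have "take (Suc i) ss = take i ss @ [ss ! i]" by (simp add: take_Suc_conv_app_nth len)
  then show ?thesis by (simp only: app)
qed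

lemma lprod_take_permutes: "lprod (take i ss) permutes {0..<n}"
proof -
  have "take i ss \<in> tups (length (take i ss)) {0..<n}"
    using ss_tups by (auto simp: tups_def dest: in_set_takeD)
  then show ?thesis by (rule lprod_permutes)
qed

text \<open>Two steps along a face lead from \<open>(s, i, False)\<close> to the next colour at the
  star \<open>(ss ! i) s\<close>. After \<open>2 * m\<close> steps all entries have been applied in
  the order of the list, so the face returns to colour index 0 at \<open>lprod ss s\<close>; faces
  correspond to cycles of the product.\<close>

lemma card_faces: "card (orbit faceD ` dset m n) = ncyc {0..<n} (lprod ss)"
proof -
  let ?\<pi> = "lprod ss" and ?p = "\<lambda>i. lprod (take i ss)"
  have \<pi>: "?\<pi> permutes {0..<n}" using lprod_permutes[OF ss_tups] .
  have perm\<pi>: "permutation ?\<pi>" using \<pi> by (auto simp: permutation_permutes)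
  have pm: "?p m = ?\<pi>" by (simp add: len)
  define q where "q i = inv_into UNIV (?p i)" for i
  have qp: "q i (?p i s) = s" for i s
    unfolding q_def using permutes_inj[OF lprod_take_permutes] by simp
  have pq: "?p i (q i s) = s" for i s
    unfolding q_def using permutes_surj[OF lprod_take_permutes] by (simp add: surj_f_inv_f)
  have qless: "q i s < n \<longleftrightarrow> s < n" for i s
    using permutes_in_image[OF lprod_take_permutes, of i "q i s"] pq[of i s] by simp
  have qSuc: "q (Suc i) ((ss ! i) s) = q i s" if "i < m" for i s
  proof -
    have "?p (Suc i) (q i s) = (ss ! i) s" using lprod_take_Suc[OF that] pq by simp
    then show ?thesis using qp[of "Suc i" "q i s"] by simp
  qed
  \<comment> \<open>The label of a face: a dart is carried back to colour index 0 by undoing the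
    permutations passed on the way, and the cycle found there is recorded. At a coloured end the
    permutation of the colour itself has already been applied, hence \<open>Suc i\<close>.\<close>
  define \<kappa> where "\<kappa> x = (case x of (s, i, b) \<Rightarrow> orbit ?\<pi> (q (if b then Suc i else i) s))" for x :: "nat \<times> nat \<times> bool"
  have q0: "q 0 s = s" for s using qp[of 0 s] by (simp add: lprod_def)
  have inv\<kappa>: "\<kappa> (faceD x) = \<kappa> x" if "x \<in> dset m n" for x
  proof -
    obtain s i b where x: "x = (s, i, b)" by (cases x) auto
    have i: "i < m" using that by (simp add: x dset_iff)
    show ?thesis
    proof (cases b)
      case False
      then show ?thesis by (simp add: x \<kappa>_def qSuc[OF i])
    next
      case True
      show ?thesis
      proof (cases "Suc i = m")
        case True
        have "orbit ?\<pi> (q m s) = orbit ?\<pi> (?\<pi> (q m s))"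
          by (rule permutation_orbit_step[OF perm\<pi>, symmetric])
        also have "?\<pi> (q m s) = s" using pq[of m s] by (simp add: pm)
        finally have "orbit ?\<pi> (q m s) = orbit ?\<pi> s" .
        then show ?thesis using True \<open>b\<close> by (simp add: x \<kappa>_def q0)
      next
        case False
        then show ?thesis using \<open>b\<close> i by (simp add: x \<kappa>_def)
      qed
    qed
  qed
  have const\<kappa>: "\<kappa> y = \<kappa> x \<and> y \<in> dset m n" if "x \<in> dset m n" "y \<in> orbit faceD x" for x y
    using that(2)
  proof induction
    case base
    then show ?case using inv\<kappa>[OF that(1)] faceD_dset[OF that(1)] by blast
  next
    case (step y)
    then have y: "\<kappa> y = \<kappa> x" "y \<in> dset m n" by auto
    show ?case using inv\<kappa>[OF y(2)] faceD_dset[OF y(2)] y(1) by (simp only: simp_thms)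
  qed
  note self = faceD_self
  have orbit_eq: "orbit faceD y = orbit faceD x" if "x \<in> dset m n" "y \<in> orbit faceD x" for x y
  proof (intro equalityI subsetI)
    fix z
    show "z \<in> orbit faceD x" if "z \<in> orbit faceD y" using orbit_trans[OF that \<open>y \<in> orbit faceD x\<close>] .
    have "x \<in> orbit faceD y" by (rule orbit_swap[OF self[OF \<open>x \<in> dset m n\<close>] \<open>y \<in> orbit faceD x\<close>])
    then show "z \<in> orbit faceD y" if "z \<in> orbit faceD x" using orbit_trans[OF that] by blast
  qed
  have two: "faceD (faceD (s, i, False)) = ((ss ! i) s, Suc i mod m, False)" if "i < m" for s i
    by simp
  have pow: "(faceD ^^ (2 * i)) (s, 0, False) = (?p i s, i mod m, False)" if "i \<le> m" for i s
    using that
  proof (induction i)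
    case 0
    then show ?case by (simp add: lprod_def)
  next
    case (Suc i)
    have "(faceD ^^ (2 * Suc i)) (s, 0, False) = faceD (faceD ((faceD ^^ (2 * i)) (s, 0, False)))"
      by simp
    also have "(faceD ^^ (2 * i)) (s, 0, False) = (?p i s, i mod m, False)" by (rule Suc.IH) (use Suc.prems in simp)
    also have "i mod m = i" using Suc.prems by simp
    also have "faceD (faceD (?p i s, i, False)) = ((ss ! i) (?p i s), Suc i mod m, False)" by (rule two) (use Suc.prems in simp)
    finally show ?case using lprod_take_Suc[of i] Suc.prems by simp
  qed
  have one: "(?\<pi> s, 0, False) \<in> orbit faceD (s, 0, False)" for s
  proof -
    have "(faceD ^^ (2 * m)) (s, 0, False) = (?\<pi> s, 0, False)" using pow[of m s] pm by simp
    moreover have "2 * m > 0" using m_pos by simp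
    ultimately show ?thesis unfolding orbit_altdef by (intro CollectI exI[of _ "2 * m"]) (simp only: simp_thms)
  qed
  have lift: "(t, 0, False) \<in> orbit faceD (s, 0, False)" if "t \<in> orbit ?\<pi> s" for s t
    using that
  proof induction
    case (step t)
    show ?case by (rule orbit_trans[OF one step.IH])
  qed (rule one)
  \<comment> \<open>Every face passes through some \<open>(t, 0, False)\<close>, so it is enough to
    compare such darts.\<close>
  have down: "\<exists>t<n. orbit faceD x = orbit faceD (t, 0, False)" if x: "x \<in> dset m n" for x
  proof -
    have F: "\<exists>t<n. orbit faceD (s, i, False) = orbit faceD (t, 0, False)" if si: "s < n" "i < m" for s i
    proof -
      have "q i s < n" using qless si by simp
      have eq: "(faceD ^^ (2 * i)) (q i s, 0, False) = (s, i, False)" using pow[of i "q i s"] si pq by simp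
      have d: "(q i s, 0, False) \<in> dset m n" using \<open>q i s < n\<close> m_pos by (simp add: dset_iff)
      have "(s, i, False) \<in> orbit faceD (q i s, 0, False)"
        using funpow_in_orbit[OF self[OF d], of "2 * i"] eq by simp
      then have "orbit faceD (s, i, False) = orbit faceD (q i s, 0, False)" by (rule orbit_eq[OF d])
      then show ?thesis using \<open>q i s < n\<close> by blast
    qed
    obtain s i b where xs: "x = (s, i, b)" by (cases x) auto
    have si: "s < n" "i < m" using x by (auto simp: xs dset_iff)
    show ?thesis
    proof (cases b)
      case True
      have "faceD x \<in> orbit faceD x" by (rule orbit.base)
      then have "orbit faceD (faceD x) = orbit faceD x" by (rule orbit_eq[OF x])
      moreover have "faceD x = (s, Suc i mod m, False)" using True by (simp add: xs)
      ultimately show ?thesis using F[of s "Suc i mod m"] si m_pos by auto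
    next
      case False
      then show ?thesis using F[OF si] by (simp add: xs)
    qed
  qed
  have "card (orbit faceD ` dset m n) = card (\<kappa> ` dset m n)"
  proof (rule card_image_eq_if_same_kernel, rule iffI)
    fix x y assume x: "x \<in> dset m n" and y: "y \<in> dset m n"
    show "\<kappa> x = \<kappa> y" if eq: "orbit faceD x = orbit faceD y"
    proof -
      have "x \<in> orbit faceD y" using self[OF x] eq by simp
      then show ?thesis using const\<kappa>[OF y] by simp
    qed
    show "orbit faceD x = orbit faceD y" if eq: "\<kappa> x = \<kappa> y"
    proof -
      obtain s t where st: "s < n" "orbit faceD x = orbit faceD (s, 0, False)" "t < n" "orbit faceD y = orbit faceD (t, 0, False)"
        using down[OF x] down[OF y] by auto
      have d: "(s, 0, False) \<in> dset m n" "(t, 0, False) \<in> dset m n" using st m_pos by (auto simp: dset_iff)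
      have "(s, 0, False) \<in> orbit faceD x" "(t, 0, False) \<in> orbit faceD y"
        using self[OF d(1)] self[OF d(2)] st by auto
      then have "\<kappa> (s, 0, False) = \<kappa> x" "\<kappa> (t, 0, False) = \<kappa> y" using const\<kappa>[OF x] const\<kappa>[OF y] by auto
      then have "orbit ?\<pi> s = orbit ?\<pi> t" using eq by (simp add: \<kappa>_def q0)
      then have "t \<in> orbit ?\<pi> s" using permutation_self_in_orbit[OF perm\<pi>, of t] by simp
      then have "orbit faceD (t, 0, False) = orbit faceD (s, 0, False)"
        using orbit_eq[OF d(1)] lift by blast
      then show ?thesis using st by simp
    qed
  qed
  also have "\<kappa> ` dset m n = orbit ?\<pi> ` {0..<n}"
  proof (intro equalityI subsetI)
    fix c assume "c \<in> \<kappa> ` dset m n"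
    then show "c \<in> orbit ?\<pi> ` {0..<n}" using qless by (auto simp: \<kappa>_def dset_def)
  next
    fix c assume "c \<in> orbit ?\<pi> ` {0..<n}"
    then obtain s where "s < n" "c = orbit ?\<pi> s" by auto
    then show "c \<in> \<kappa> ` dset m n"
      using m_pos by (intro image_eqI[of _ _ "(s, 0, False)"]) (auto simp: \<kappa>_def dset_iff q0)
  qed
  finally show ?thesis unfolding ncyc_def .
qed

end

section \<open>Presentations of maps by tuples\<close>

context ptup
begin

lemma rotD_self: "x \<in> dset m n \<Longrightarrow> x \<in> orbit (rotD m ss) x"
proof -
  assume x: "x \<in> dset m n"
  obtain s i b where xs: "x = (s, i, b)" by (cases x) auto
  have "i < m" using x by (simp add: xs dset_iff)
  then show ?thesis
    using permutation_self_in_orbit[OF permutation, of i s]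
    by (cases b) (auto simp: xs orbit_rotD_True orbit_rotD_False)
qed

lemma orbit_dset:
  assumes "x \<in> dset m n" "\<And>y. y \<in> dset m n \<Longrightarrow> h y \<in> dset m n"
  shows "orbit h x \<subseteq> dset m n"
proof
  fix y assume "y \<in> orbit h x"
  then show "y \<in> dset m n" by induction (use assms in auto)
qed

lemma inj_rotD: "inj_on (rotD m ss) (dset m n)"
proof (rule inj_onI)
  fix x y assume xy: "x \<in> dset m n" "y \<in> dset m n" "rotD m ss x = rotD m ss y"
  obtain s i b t j c where x: "x = (s, i, b)" and y: "y = (t, j, c)" by (cases x, cases y) auto
  have ij: "i < m" "j < m" using xy by (auto simp: x y dset_iff)
  show "x = y"
  proof (cases b; cases c)
    assume bc: "\<not> b" "\<not> c"
    then have "Suc i mod m = Suc j mod m" "s = t" using xy(3) by (auto simp: x y)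
    moreover have "Suc k mod m = (if Suc k = m then 0 else Suc k)" if "k < m" for k using that by auto
    ultimately show ?thesis using bc ij by (auto simp: x y split: if_splits)
  next
    assume bc: b c
    then show ?thesis using xy(3) ij permutes_inj[OF perm, of i] by (auto simp: x y dest: injD)
  qed (use xy(3) in \<open>auto simp: x y\<close>)
qed

lemma bij_rotD: "bij_betw (rotD m ss) (dset m n) (dset m n)"
  unfolding bij_betw_def using inj_rotD rotD_dset
  by (intro conjI endo_inj_surj finite_dset image_subsetI)

lemma bij_oppD: "bij_betw oppD (dset m n) (dset m n)"
  by (rule bij_betw_byWitness[where f' = oppD]) (auto simp: dset_iff)

text \<open>By \<open>reach_closed\<close>, membership in \<open>reach ss s\<close> does not change
  along the steps from 0 to \<open>s\<close>. So 0 is reachable from \<open>s\<close>, and then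
  everything is.\<close>

lemma reach_all:
  assumes r: "reach ss 0 = {0..<n}" and s: "s < n"
  shows "reach ss s = {0..<n}"
proof -
  have s0: "s \<in> {0..<n}" using s by simp
  have iff: "x \<in> reach ss s \<longleftrightarrow> 0 \<in> reach ss s" if "x \<in> reach ss 0" for x
    using that
  proof induction
    case (step x \<sigma>)
    have "\<sigma> x \<in> reach ss s \<longleftrightarrow> x \<in> reach ss s"
      by (rule reach_closed[OF ss_tups _ step.hyps(2) s0]) simp
    then show ?case using step.IH by (simp only:)
  qed simp
  have z: "0 \<in> reach ss s" using iff[of s] reach.base[of s ss] s0 unfolding r by simp
  have "reach ss 0 \<subseteq> reach ss s" by (rule subsetI) (rule reach_trans[OF z])
  then have "{0..<n} \<subseteq> reach ss s" unfolding r .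
  then show ?thesis using reach_subset[OF ss_tups s0] by blast
qed

end

text \<open>The map \<open>f\<close> names the darts of \<open>M\<close> by triples in such a way
  that \<open>M\<close> becomes the model of \<open>ss\<close>. The standard map of a tuple and an
  arbitrary given constellation are both instances, so one set of lemmas serves both directions of
  the correspondence.\<close>

locale pres = ptup +
  fixes M :: "'d rkmap" and f :: "nat \<times> nat \<times> bool \<Rightarrow> 'd"
  assumes inj_f: "inj_on f (dset m n)"
    and darts_f: "darts M = f ` dset m n"
    and rot_permutes: "rot M permutes darts M"
    and opp_permutes: "opp M permutes darts M"
    and rot_f: "x \<in> dset m n \<Longrightarrow> rot M (f x) = f (rotD m ss x)"
    and opp_f: "x \<in> dset m n \<Longrightarrow> opp M (f x) = f (oppD x)"
    and kind_False: "s < n \<Longrightarrow> i < m \<Longrightarrow> kind M (vertex_of M (f (s, i, False))) = Star"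
    and kind_True: "s < n \<Longrightarrow> i < m \<Longrightarrow> kind M (vertex_of M (f (s, i, True))) = Colored (Suc i)"
    and root_f: "root_star M = vertex_of M (f (0, 0, False))"
begin

lemma dartE:
  assumes "d \<in> darts M"
  obtains s i b where "d = f (s, i, b)" "s < n" "i < m"
proof -
  obtain x where x: "d = f x" "x \<in> dset m n" using assms unfolding darts_f by blast
  obtain s i b where xs: "x = (s, i, b)" by (cases x) auto
  show ?thesis by (rule that[of s i b]) (use x in \<open>auto simp: xs dset_iff\<close>)
qed

lemma vertexE:
  assumes "v \<in> map_vertices M"
  obtains s i b where "v = vertex_of M (f (s, i, b))" "s < n" "i < m"
proof -
  obtain d where d: "d \<in> darts M" "v = vertex_of M d" using assms unfolding map_vertices_def by blast
  show ?thesis by (rule dartE[OF d(1)], rule that) (simp_all add: d(2))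
qed

lemma orbit_f:
  assumes x: "x \<in> dset m n" and self: "x \<in> orbit h x"
    and h: "\<And>y. y \<in> dset m n \<Longrightarrow> h y \<in> dset m n" and k: "\<And>y. y \<in> dset m n \<Longrightarrow> k (f y) = f (h y)"
  shows "orbit k (f x) = f ` orbit h x"
proof (rule orbit_inverse[OF self, symmetric])
  have sub: "orbit h x \<subseteq> dset m n" by (rule orbit_dset[OF x h])
  show "k (f y) = f (h y)" if "y \<in> orbit h x" for y by (rule k[OF subsetD[OF sub that]])
qed

lemma vertex_of_f: "x \<in> dset m n \<Longrightarrow> vertex_of M (f x) = f ` orbit (rotD m ss) x"
  unfolding vertex_of_def by (rule orbit_f[OF _ rotD_self rotD_dset rot_f])

lemma card_image_f:
  assumes "\<And>x. x \<in> dset m n \<Longrightarrow> F x \<subseteq> dset m n"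
  shows "card ((\<lambda>x. f ` F x) ` dset m n) = card (F ` dset m n)"
  using assms by (intro card_image_eq_if_same_kernel) (simp add: inj_on_image_eq_iff[OF inj_f])

lemma card_map_vertices: "card (map_vertices M) = n + (\<Sum>i=0..<m. ncyc {0..<n} (ss ! i))"
proof -
  have "map_vertices M = (\<lambda>x. f ` orbit (rotD m ss) x) ` dset m n"
    unfolding map_vertices_def darts_f image_image by (intro image_cong refl vertex_of_f)
  then show ?thesis using card_image_f[of "orbit (rotD m ss)"] orbit_dset[OF _ rotD_dset] card_vertices by simp
qed

lemma card_map_edges: "card (map_edges M) = m * n"
proof -
  have "map_edges M = (\<lambda>x. f ` {x, oppD x}) ` dset m n"
    unfolding map_edges_def darts_f image_image by (intro image_cong refl) (simp add: opp_f)
  then show ?thesis using card_image_f[of "\<lambda>x. {x, oppD x}"] card_edges oppD_dset by simp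
qed

lemma card_map_faces: "card (map_faces M) = ncyc {0..<n} (lprod ss)"
proof -
  have fo: "(rot M \<circ> opp M) (f y) = f (faceD y)" if "y \<in> dset m n" for y
    using that by (simp add: opp_f rot_f oppD_dset)
  have "map_faces M = (\<lambda>x. f ` orbit faceD x) ` dset m n"
    unfolding map_faces_def darts_f image_image
    by (intro image_cong refl orbit_f[OF _ faceD_self faceD_dset fo])
  then show ?thesis using card_image_f[of "orbit faceD"] orbit_dset[OF _ faceD_dset] card_faces by simp
qed

text \<open>Of the \<open>m * n\<close> edges, \<open>n\<close> are offset by the star vertices; the
  remaining vertices and the faces make up \<open>wt\<close>.\<close>

lemma has_genus_iff: "has_genus M g \<longleftrightarrow> wt {0..<n} ss + 2 * g = (m - 1) * n + 2"
proof -
  have "sum_list (map (ncyc {0..<n}) ss) = (\<Sum>i=0..<m. ncyc {0..<n} (ss ! i))"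
    by (simp add: sum_list_sum_nth len)
  moreover have "m * n = (m - 1) * n + n" using m_pos by (cases m) auto
  ultimately show ?thesis
    unfolding has_genus_def card_map_vertices card_map_edges card_map_faces wt_def by linarith
qed

lemma star_vertices_f: "star_vertices M = (\<lambda>s. vertex_of M (f (s, 0, False))) ` {0..<n}"
proof (intro equalityI subsetI)
  fix v assume "v \<in> star_vertices M"
  then obtain x where x: "x \<in> dset m n" "v = vertex_of M (f x)" "kind M v = Star"
    by (auto simp: star_vertices_def map_vertices_def darts_f)
  obtain s i b where xs: "x = (s, i, b)" by (cases x) auto
  have si: "s < n" "i < m" using x by (auto simp: xs dset_iff)
  then have "b = False" using kind_True[of s i] x by (cases b) (auto simp: xs)
  have "vertex_of M (f x) = vertex_of M (f (s, 0, False))"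
    using si m_pos \<open>b = False\<close> by (simp add: xs vertex_of_f dset_iff orbit_rotD_False)
  then show "v \<in> (\<lambda>s. vertex_of M (f (s, 0, False))) ` {0..<n}" using x si by auto
next
  fix v assume "v \<in> (\<lambda>s. vertex_of M (f (s, 0, False))) ` {0..<n}"
  then obtain s where "s < n" "v = vertex_of M (f (s, 0, False))" by auto
  then show "v \<in> star_vertices M"
    using m_pos kind_False[of s 0] by (auto simp: star_vertices_def map_vertices_def darts_f dset_iff)
qed

lemma star_vertex_eq: "s < n \<Longrightarrow> vertex_of M (f (s, 0, False)) = (\<lambda>j. f (s, j, False)) ` {0..<m}"
  using m_pos by (simp add: vertex_of_f dset_iff orbit_rotD_False image_image)

lemma inj_star_vertex: "inj_on (\<lambda>s. vertex_of M (f (s, 0, False))) {0..<n}"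
proof (rule inj_onI)
  fix s t assume st: "s \<in> {0..<n}" "t \<in> {0..<n}" "vertex_of M (f (s, 0, False)) = vertex_of M (f (t, 0, False))"
  then have "f (s, 0, False) \<in> (\<lambda>j. f (t, j, False)) ` {0..<m}"
    using m_pos star_vertex_eq[of s] star_vertex_eq[of t] by auto
  then obtain j where "j < m" "f (s, 0, False) = f (t, j, False)" by auto
  then show "s = t" using inj_onD[OF inj_f, of "(s, 0, False)" "(t, j, False)"] st m_pos by (auto simp: dset_iff)
qed

lemma card_star_vertices: "card (star_vertices M) = n"
  unfolding star_vertices_f by (simp add: card_image[OF inj_star_vertex])

lemma rot_pow_f: "s < n \<Longrightarrow> i < m \<Longrightarrow> (rot M ^^ k) (f (s, i, False)) = f (s, (i + k) mod m, False)"
proof (induction k)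
  case (Suc k)
  then show ?case using m_pos by (simp add: rot_f dset_iff mod_Suc_eq)
qed simp

abbreviation rel :: "'d \<Rightarrow> 'd \<Rightarrow> bool" where
  "rel \<equiv> \<lambda>x y. y = rot M x \<or> y = opp M x"

lemma rel_rot_pow: "rel\<^sup>*\<^sup>* d ((rot M ^^ k) d)"
  by (induction k) (auto intro: rtranclp.rtrancl_into_rtrancl)

lemma rel_star: "s < n \<Longrightarrow> i < m \<Longrightarrow> j < m \<Longrightarrow> rel\<^sup>*\<^sup>* (f (s, i, False)) (f (s, j, False))"
  using rel_rot_pow[of "f (s, i, False)" "m - i + j"] by (simp add: rot_pow_f)

lemma rel_opp: "s < n \<Longrightarrow> i < m \<Longrightarrow> rel\<^sup>*\<^sup>* (f (s, i, b)) (f (s, i, \<not> b))"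
  using opp_f[of "(s, i, b)"] by (intro r_into_rtranclp) (simp add: dset_iff)

text \<open>One application of \<open>ss ! i\<close> is a walk in the map: turn at the star to
  colour index \<open>i\<close>, cross the edge, rotate about the coloured vertex, cross back and
  turn to colour index 0.\<close>

lemma rel_reach:
  assumes "t \<in> reach ss s" "s < n"
  shows "rel\<^sup>*\<^sup>* (f (s, 0, False)) (f (t, 0, False)) \<and> t < n"
  using assms(1)
proof induction
  case (step t \<sigma>)
  then have t: "t < n" by simp
  obtain i where i: "i < m" "\<sigma> = ss ! i" using step.hyps(2) len by (auto simp: in_set_conv_nth)
  have st: "\<sigma> t < n" using i t by (simp add: perm_less)
  have "rel\<^sup>*\<^sup>* (f (t, 0, False)) (f (t, i, False))" using t i m_pos by (intro rel_star)
  also have "rel\<^sup>*\<^sup>* (f (t, i, False)) (f (t, i, True))" using rel_opp[of t i False] t i by simp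
  also have "rel (f (t, i, True)) (f (\<sigma> t, i, True))" using rot_f[of "(t, i, True)"] t i by (simp add: dset_iff)
  also have "rel\<^sup>*\<^sup>* (f (\<sigma> t, i, True)) (f (\<sigma> t, i, False))" using rel_opp[of "\<sigma> t" i True] st i by simp
  also have "rel\<^sup>*\<^sup>* (f (\<sigma> t, i, False)) (f (\<sigma> t, 0, False))" using st i m_pos by (intro rel_star)
  finally have "rel\<^sup>*\<^sup>* (f (t, 0, False)) (f (\<sigma> t, 0, False))" .
  then show ?case using rtranclp_trans[of rel "f (s, 0, False)" "f (t, 0, False)"] step.IH st by (intro conjI) simp_all
qed (use assms in simp)

lemma is_rooted_constellation:
  assumes reach: "reach ss 0 = {0..<n}"
  shows "is_rooted_constellation m M"
proof -
  have to_base: "rel\<^sup>*\<^sup>* (f (s, i, b)) (f (s, 0, False))" if "s < n" "i < m" for s i b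
  proof (cases b)
    case True
    then have bT: "b = True" by simp
    have "rel\<^sup>*\<^sup>* (f (s, i, True)) (f (s, i, False))" using rel_opp[of s i True] that by simp
    then show ?thesis unfolding bT by (rule rtranclp_trans[OF _ rel_star[OF that m_pos]])
  next
    case False
    then show ?thesis using that m_pos rel_star[of s i 0] by auto
  qed
  have from_base: "rel\<^sup>*\<^sup>* (f (s, 0, False)) (f (s, i, b))" if "s < n" "i < m" for s i b
  proof (cases b)
    case True
    then have bT: "b = True" by simp
    have "rel\<^sup>*\<^sup>* (f (s, i, False)) (f (s, i, True))" using rel_opp[of s i False] that by simp
    then show ?thesis unfolding bT by (rule rtranclp_trans[OF rel_star[OF that(1) m_pos that(2)]])
  next
    case False
    then show ?thesis using that m_pos rel_star[of s 0 i] by auto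
  qed
  have conn: "rel\<^sup>*\<^sup>* d e" if de: "d \<in> darts M" "e \<in> darts M" for d e
  proof -
    obtain s i b where d: "d = f (s, i, b)" "s < n" "i < m" using de(1) by (rule dartE)
    obtain t j c where e: "e = f (t, j, c)" "t < n" "j < m" using de(2) by (rule dartE)
    have "t \<in> reach ss s" using reach_all[OF reach d(2)] e by simp
    then have "rel\<^sup>*\<^sup>* (f (s, 0, False)) (f (t, 0, False))" using rel_reach d by blast
    with to_base[OF d(2,3), of b] have "rel\<^sup>*\<^sup>* d (f (t, 0, False))" unfolding d(1) by (rule rtranclp_trans)
    then show ?thesis using from_base[OF e(2,3), of c] unfolding e(1) by (rule rtranclp_trans)
  qed
  have opp2: "opp M d \<noteq> d \<and> opp M (opp M d) = d" if d: "d \<in> darts M" for d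
  proof -
    obtain s i b where "d = f (s, i, b)" "s < n" "i < m" using d by (rule dartE)
    then have x: "d = f (s, i, b)" "(s, i, b) \<in> dset m n" by (auto simp: dset_iff)
    then have y: "(s, i, \<not> b) \<in> dset m n" by (simp add: dset_iff)
    have "opp M d = f (s, i, \<not> b)" using x opp_f[OF x(2)] by simp
    moreover have "f (s, i, \<not> b) \<noteq> f (s, i, b)" using inj_onD[OF inj_f _ y x(2)] by auto
    moreover have "opp M (f (s, i, \<not> b)) = f (s, i, b)" using opp_f[OF y] by simp
    ultimately show ?thesis using x by simp
  qed
  have "(0, 0, False) \<in> dset m n" using m_pos n_pos by (simp add: dset_iff)
  then have "darts M \<noteq> {}" unfolding darts_f by blast
  then have map: "is_map M"
    unfolding is_map_def using rot_permutes opp_permutes opp2 conn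
    by (intro conjI ballI) (simp_all add: darts_f)
  have kinds: "kind M v = Star \<or> (\<exists>c\<in>{1..m}. kind M v = Colored c)" if v: "v \<in> map_vertices M" for v
  proof -
    obtain s i b where "v = vertex_of M (f (s, i, b))" "s < n" "i < m" using v by (rule vertexE)
    then show ?thesis using kind_False[of s i] kind_True[of s i] by (cases b) auto
  qed
  have bip: "kind M (vertex_of M d) = Star \<longleftrightarrow> kind M (vertex_of M (opp M d)) \<noteq> Star" if d: "d \<in> darts M" for d
  proof -
    obtain s i b where x: "d = f (s, i, b)" "s < n" "i < m" using d by (rule dartE)
    then have "opp M d = f (s, i, \<not> b)" using opp_f[of "(s, i, b)"] by (simp add: dset_iff)
    then show ?thesis using x kind_False[of s i] kind_True[of s i] by (cases b) auto
  qed
  have stars: "card v = m \<and> (\<exists>d\<in>v. \<forall>i<m. kind M (vertex_of M (opp M ((rot M ^^ i) d))) = Colored (i + 1))"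
    if v: "v \<in> star_vertices M" for v
  proof -
    obtain s where s: "s < n" "v = vertex_of M (f (s, 0, False))" using v by (auto simp: star_vertices_f)
    have vs: "v = (\<lambda>j. f (s, j, False)) ` {0..<m}" using s star_vertex_eq by simp
    have "inj_on (\<lambda>j. f (s, j, False)) {0..<m}"
    proof (rule inj_onI)
      fix i j assume "i \<in> {0..<m}" "j \<in> {0..<m}" "f (s, i, False) = f (s, j, False)"
      then show "i = j" using inj_onD[OF inj_f, of "(s, i, False)" "(s, j, False)"] s by (auto simp: dset_iff)
    qed
    then have "card v = m" by (simp add: vs card_image)
    moreover have "f (s, 0, False) \<in> v" using m_pos by (auto simp: vs)
    moreover have "kind M (vertex_of M (opp M ((rot M ^^ i) (f (s, 0, False))))) = Colored (i + 1)" if "i < m" for i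
      using that s m_pos opp_f[of "(s, i, False)"] kind_True[of s i] by (simp add: rot_pow_f dset_iff)
    ultimately show ?thesis by blast
  qed
  have "is_constellation m M" unfolding is_constellation_def
    by (intro conjI ballI map) (rule kinds bip stars[THEN conjunct1] stars[THEN conjunct2]; assumption)+
  moreover have "root_star M \<in> star_vertices M" using n_pos by (auto simp: root_f star_vertices_f)
  ultimately show ?thesis by (simp add: is_rooted_constellation_def)
qed

lemma reach_if_connected:
  assumes conn: "\<forall>d\<in>darts M. \<forall>e\<in>darts M. rel\<^sup>*\<^sup>* d e"
  shows "reach ss 0 = {0..<n}"
proof -
  \<comment> \<open>The darts whose star label is reachable. Both moves preserve this set: crossing
    an edge keeps the label, and rotation keeps it or applies an entry of \<open>ss\<close>.\<close>
  define P where "P d \<longleftrightarrow> (\<exists>s i b. d = f (s, i, b) \<and> (s, i, b) \<in> dset m n \<and> s \<in> reach ss 0)" for d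
  have P_step: "P e" if Pd: "P d" and de: "rel d e" for d e
  proof -
    obtain s i b where x: "d = f (s, i, b)" "(s, i, b) \<in> dset m n" "s \<in> reach ss 0" using Pd unfolding P_def by blast
    have i: "i < m" using x by (simp add: dset_iff)
    show ?thesis
    proof (cases "e = opp M d")
      case True
      then have "e = f (s, i, \<not> b)" using opp_f[OF x(2)] x(1) by simp
      then show ?thesis unfolding P_def using x by (intro exI[of _ s] exI[of _ i] exI[of _ "\<not> b"]) (simp add: dset_iff)
    next
      case False
      then have e: "e = f (rotD m ss (s, i, b))" using de rot_f[OF x(2)] x(1) by simp
      have d: "rotD m ss (s, i, b) \<in> dset m n" by (rule rotD_dset[OF x(2)])
      have "fst (rotD m ss (s, i, b)) \<in> reach ss 0"
        using x i len reach.step[OF x(3), of "ss ! i"] by (cases b) simp_all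
      then show ?thesis unfolding P_def using e d
        by (intro exI[of _ "fst (rotD m ss (s, i, b))"] exI[of _ "fst (snd (rotD m ss (s, i, b)))"]
            exI[of _ "snd (snd (rotD m ss (s, i, b)))"]) simp
    qed
  qed
  have P0: "P (f (0, 0, False))" unfolding P_def using m_pos n_pos by (auto simp: dset_iff intro: reach.base)
  have "s \<in> reach ss 0" if s: "s < n" for s
  proof -
    have d: "(0, 0, False) \<in> dset m n" "(s, 0, False) \<in> dset m n" using s m_pos n_pos by (auto simp: dset_iff)
    then have "rel\<^sup>*\<^sup>* (f (0, 0, False)) (f (s, 0, False))" using conn by (simp add: darts_f)
    then have "P (f (s, 0, False))"
    proof (induction rule: rtranclp_induct)
      case base
      show ?case by (rule P0)
    next
      case (step d e)
      show ?case by (rule P_step[OF step.IH step.hyps(2)])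
    qed
    then obtain t i b where t: "f (s, 0, False) = f (t, i, b)" "(t, i, b) \<in> dset m n" "t \<in> reach ss 0" by (auto simp: P_def)
    then have "(s, 0, False) = (t, i, b)" using inj_onD[OF inj_f t(1) d(2) t(2)] by simp
    then show ?thesis using t by simp
  qed
  then show ?thesis using reach_subset[OF ss_tups, of 0] n_pos by auto
qed

end

section \<open>The standard map of a tuple and isomorphisms\<close>

lemma image_vertex_of:
  assumes g: "\<And>d. d \<in> darts M \<Longrightarrow> g (rot M d) = rot M' (g d)"
    and p: "rot M permutes darts M" "finite (darts M)" and d: "d \<in> darts M"
  shows "g ` vertex_of M d = vertex_of M' (g d)"
  unfolding vertex_of_def
proof (rule orbit_inverse)
  have "permutation (rot M)" unfolding permutation_permutes using p by blast
  then show "d \<in> orbit (rot M) d" by (rule permutation_self_in_orbit)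
  fix x assume "x \<in> orbit (rot M) d"
  then have "x \<in> darts M" using permutes_orbit_subset[OF p(1) d] by blast
  then show "rot M' (g x) = g (rot M x)" by (simp add: g)
qed

text \<open>The triples are coded as natural numbers, and outside the darts \<open>rot\<close> and
  \<open>opp\<close> are the identity, as \<open>permutes\<close> demands. The kind is read off any
  dart of the vertex, since these all agree in the end they lie at and, at a coloured vertex, in the
  colour.\<close>

definition std_map :: "nat \<Rightarrow> nat \<Rightarrow> (nat \<Rightarrow> nat) list \<Rightarrow> nat rkmap" where
  "std_map m n ss = \<lparr>darts = to_nat ` dset m n,
     rot = (\<lambda>d. if d \<in> to_nat ` dset m n then to_nat (rotD m ss (from_nat d)) else d),
     opp = (\<lambda>d. if d \<in> to_nat ` dset m n then to_nat (oppD (from_nat d)) else d),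
     kind = (\<lambda>v. case (from_nat (SOME d. d \<in> v) :: nat \<times> nat \<times> bool) of
        (s, i, b) \<Rightarrow> if b then Colored (Suc i) else Star),
     root_star = to_nat ` orbit (rotD m ss) (0, 0, False)\<rparr>"

lemma bij_betw_conj_to_nat:
  assumes "bij_betw h D D"
  shows "(\<lambda>d. if d \<in> to_nat ` D then to_nat (h (from_nat d)) else d) permutes to_nat ` (D :: 'a::countable set)"
proof (rule bij_imp_permutes)
  let ?k = "\<lambda>d. if d \<in> to_nat ` D then to_nat (h (from_nat d)) else d"
  have "bij_betw (to_nat \<circ> h \<circ> from_nat) (to_nat ` D) (to_nat ` D)"
  proof (intro bij_betw_trans)
    show "bij_betw from_nat (to_nat ` D) D" by (rule bij_betw_byWitness[where f' = to_nat]) auto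
    show "bij_betw h D D" by fact
    show "bij_betw to_nat D (to_nat ` D)" by (simp add: bij_betw_def)
  qed
  then show "bij_betw ?k (to_nat ` D) (to_nat ` D)"
    by (rule bij_betw_cong[THEN iffD1, rotated]) simp
qed simp

lemma (in ptup) pres_std_map: "pres m n ss (std_map m n ss) to_nat"
proof -
  let ?M = "std_map m n ss"
  have rot: "rot ?M (to_nat x) = to_nat (rotD m ss x)" if "x \<in> dset m n" for x
    using that by (simp add: std_map_def)
  have v: "vertex_of ?M (to_nat x) = to_nat ` orbit (rotD m ss) x" if x: "x \<in> dset m n" for x
    unfolding vertex_of_def
  proof (rule orbit_inverse[OF rotD_self[OF x], symmetric])
    fix y assume "y \<in> orbit (rotD m ss) x"
    moreover have "orbit (rotD m ss) x \<subseteq> dset m n" by (rule orbit_dset[OF x]) (rule rotD_dset)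
    ultimately have "y \<in> dset m n" by blast
    then show "rot ?M (to_nat y) = to_nat (rotD m ss y)" by (rule rot)
  qed
  have pick: "\<exists>y\<in>orbit (rotD m ss) x. (SOME d. d \<in> to_nat ` orbit (rotD m ss) x) = to_nat y" if x: "x \<in> dset m n" for x
  proof -
    have "to_nat x \<in> to_nat ` orbit (rotD m ss) x" using rotD_self[OF x] by simp
    then have "(SOME d. d \<in> to_nat ` orbit (rotD m ss) x) \<in> to_nat ` orbit (rotD m ss) x" by (rule someI)
    then show ?thesis by blast
  qed
  show ?thesis
  proof (unfold_locales)
    show "inj_on to_nat (dset m n)" by simp
    show "darts ?M = to_nat ` dset m n" by (simp add: std_map_def)
    show "rot ?M permutes darts ?M"
      using bij_betw_conj_to_nat[OF bij_rotD] by (simp add: std_map_def)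
    show "opp ?M permutes darts ?M"
      using bij_betw_conj_to_nat[OF bij_oppD] by (simp add: std_map_def)
    show "rot ?M (to_nat x) = to_nat (rotD m ss x)" if "x \<in> dset m n" for x using that by (rule rot)
    show "opp ?M (to_nat x) = to_nat (oppD x)" if "x \<in> dset m n" for x using that by (simp add: std_map_def)
    show "kind ?M (vertex_of ?M (to_nat (s, i, False))) = Star" if "s < n" "i < m" for s i
    proof -
      have x: "(s, i, False) \<in> dset m n" using that by (simp add: dset_iff)
      obtain y where y: "y \<in> orbit (rotD m ss) (s, i, False)"
        "(SOME d. d \<in> to_nat ` orbit (rotD m ss) (s, i, False)) = to_nat y" using pick[OF x] by blast
      obtain j where "y = (s, j, False)" using y(1) \<open>i < m\<close> by (auto simp: orbit_rotD_False)
      then show ?thesis unfolding v[OF x] using y(2) by (simp add: std_map_def)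
    qed
    show "kind ?M (vertex_of ?M (to_nat (s, i, True))) = Colored (Suc i)" if "s < n" "i < m" for s i
    proof -
      have x: "(s, i, True) \<in> dset m n" using that by (simp add: dset_iff)
      obtain y where y: "y \<in> orbit (rotD m ss) (s, i, True)"
        "(SOME d. d \<in> to_nat ` orbit (rotD m ss) (s, i, True)) = to_nat y" using pick[OF x] by blast
      obtain t where "y = (t, i, True)" using y(1) \<open>i < m\<close> by (auto simp: orbit_rotD_True)
      then show ?thesis unfolding v[OF x] using y(2) by (simp add: std_map_def)
    qed
    have z: "(0, 0, False) \<in> dset m n" using m_pos n_pos by (simp add: dset_iff)
    have "root_star ?M = to_nat ` orbit (rotD m ss) (0, 0, False)" by (simp add: std_map_def)
    then show "root_star ?M = vertex_of ?M (to_nat (0 :: nat, 0 :: nat, False))" by (rule trans) (rule v[OF z, symmetric])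
  qed
qed

text \<open>Simultaneous conjugation, that is, renumbering the stars. The root star carries the
  number 0, so a rooted isomorphism has to fix it.\<close>

definition eqv :: "nat \<Rightarrow> (nat \<Rightarrow> nat) list \<Rightarrow> (nat \<Rightarrow> nat) list \<Rightarrow> bool" where
  "eqv n ss ss' \<longleftrightarrow> (\<exists>\<rho>. \<rho> permutes {0..<n} \<and> \<rho> 0 = 0 \<and> ss' = map (relabel \<rho>) ss)"

lemma rooted_iso_if_eqv:
  assumes "pres m n ss M f" "pres m n ss' M' f'" "eqv n ss ss'"
  shows "rooted_iso M M'"
proof -
  interpret A: pres m n ss M f by fact
  interpret B: pres m n ss' M' f' by fact
  obtain \<rho> where \<rho>: "\<rho> permutes {0..<n}" "\<rho> 0 = 0" "ss' = map (relabel \<rho>) ss" using assms(3) by (auto simp: eqv_def)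
  have bij: "bij \<rho>" using \<rho>(1) by (rule permutes_bij)
  have lt: "\<rho> s < n \<longleftrightarrow> s < n" for s using permutes_in_image[OF \<rho>(1), of s] by simp
  \<comment> \<open>Renumbering changes only the star of a dart; its colour and its end
    stay.\<close>
  define P where "P = (\<lambda>(s, i :: nat, b :: bool). (\<rho> s, i, b))"
  define g where "g d = f' (P (inv_into (dset m n) f d))" for d
  have gf: "g (f x) = f' (P x)" if "x \<in> dset m n" for x
    using that by (simp add: g_def inv_into_f_f[OF A.inj_f])
  have Pd: "P x \<in> dset m n \<longleftrightarrow> x \<in> dset m n" for x by (cases x) (simp add: P_def dset_iff lt)
  have P_rot: "P (rotD m ss x) = rotD m ss' (P x)" if x: "x \<in> dset m n" for x
  proof -
    obtain s i b where xs: "x = (s, i, b)" by (cases x) auto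
    have "i < m" using x by (simp add: xs dset_iff)
    then have "(ss' ! i) (\<rho> s) = \<rho> ((ss ! i) s)" using \<rho>(3) A.len relabel_apply[OF bij] by simp
    then show ?thesis by (cases b) (simp_all add: xs P_def)
  qed
  have P_opp: "P (oppD x) = oppD (P x)" for x by (cases x) (simp add: P_def)
  have Pinj: "inj P" using bij_is_inj[OF bij] by (auto simp: P_def inj_def)
  have "P ` dset m n = dset m n"
    using Pd inj_on_subset[OF Pinj] by (intro endo_inj_surj) auto
  have bijg: "bij_betw g (darts M) (darts M')"
    unfolding bij_betw_def
  proof
    show "inj_on g (darts M)"
    proof (rule inj_onI)
      fix d e assume de: "d \<in> darts M" "e \<in> darts M" "g d = g e"
      obtain x y where x: "x \<in> dset m n" "d = f x" and y: "y \<in> dset m n" "e = f y"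
        using de(1,2) unfolding A.darts_f by blast
      have "f' (P x) = f' (P y)" using de(3) x y gf by simp
      then have "P x = P y" using inj_onD[OF B.inj_f] Pd x y by blast
      then show "d = e" using injD[OF Pinj] x y by blast
    qed
    show "g ` darts M = darts M'"
    proof -
      have "g ` darts M = f' ` P ` dset m n" unfolding A.darts_f image_image using gf by (intro image_cong) auto
      then show ?thesis unfolding \<open>P ` dset m n = dset m n\<close> B.darts_f .
    qed
  qed
  have gr: "g (rot M d) = rot M' (g d)" if "d \<in> darts M" for d
  proof -
    obtain x where x: "x \<in> dset m n" "d = f x" using \<open>d \<in> darts M\<close> unfolding A.darts_f by blast
    have "g (rot M d) = f' (P (rotD m ss x))" using x A.rot_f gf A.rotD_dset by simp
    also have "\<dots> = rot M' (g d)" using x gf P_rot B.rot_f Pd by simp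
    finally show ?thesis .
  qed
  have go: "g (opp M d) = opp M' (g d)" if "d \<in> darts M" for d
  proof -
    obtain x where x: "x \<in> dset m n" "d = f x" using \<open>d \<in> darts M\<close> unfolding A.darts_f by blast
    have "g (opp M d) = f' (P (oppD x))" using x A.opp_f gf A.oppD_dset by simp
    also have "\<dots> = opp M' (g d)" using x gf P_opp B.opp_f Pd by simp
    finally show ?thesis .
  qed
  have fin: "finite (darts M)" unfolding A.darts_f by simp
  have vert: "g ` vertex_of M d = vertex_of M' (g d)" if "d \<in> darts M" for d
    by (rule image_vertex_of[where g = g and M = M and M' = M', OF _ A.rot_permutes fin that]) (rule gr)
  have "kind M' (g ` v) = kind M v" if v: "v \<in> map_vertices M" for v
  proof -
    obtain s i b where x: "v = vertex_of M (f (s, i, b))" and si: "s < n" "i < m" using v by (rule A.vertexE)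
    have d: "(s, i, b) \<in> dset m n" using si by (simp add: dset_iff)
    then have "f (s, i, b) \<in> darts M" unfolding A.darts_f by blast
    then have "g ` v = vertex_of M' (f' (\<rho> s, i, b))" unfolding x using vert gf[OF d] by (simp add: P_def)
    then show ?thesis
      using A.kind_False[OF si] A.kind_True[OF si] B.kind_False[of "\<rho> s" i] B.kind_True[of "\<rho> s" i] si lt
      by (cases b) (simp_all add: x)
  qed
  moreover have "g ` root_star M = root_star M'"
  proof -
    have d: "(0, 0, False) \<in> dset m n" using A.m_pos A.n_pos by (simp add: dset_iff)
    then have "f (0, 0, False) \<in> darts M" unfolding A.darts_f by blast
    then show ?thesis unfolding A.root_f B.root_f using vert gf[OF d] \<rho>(2) by (simp add: P_def)
  qed
  ultimately show ?thesis unfolding rooted_iso_def using bijg gr go by (intro exI[of _ g]) simp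
qed

text \<open>Since kinds are preserved, the dart from a star towards colour 1 goes to a dart of the
  same type, which defines the renumbering \<open>\<rho>\<close>. Compatibility with
  \<open>rot\<close> and \<open>opp\<close> spreads this to all darts, and at the coloured ends it
  says that \<open>\<rho>\<close> conjugates the entries.\<close>

lemma eqv_if_rooted_iso:
  assumes "pres m n ss M f" "pres m n ss' M' f'" "rooted_iso M M'"
  shows "eqv n ss ss'"
proof -
  interpret A: pres m n ss M f by fact
  interpret B: pres m n ss' M' f' by fact
  obtain g where bijg: "bij_betw g (darts M) (darts M')"
    and gro: "\<forall>d\<in>darts M. g (rot M d) = rot M' (g d) \<and> g (opp M d) = opp M' (g d)"
    and gk: "\<forall>v\<in>map_vertices M. kind M' (g ` v) = kind M v"
    and groot: "g ` root_star M = root_star M'"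
    using assms(3) unfolding rooted_iso_def by blast
  have fin: "finite (darts M)" unfolding A.darts_f by simp
  have gr: "g (rot M d) = rot M' (g d)" and go: "g (opp M d) = opp M' (g d)" if "d \<in> darts M" for d
    using gro that by auto
  have fd: "f x \<in> darts M" if "x \<in> dset m n" for x using that unfolding A.darts_f by blast
  have kv: "kind M' (vertex_of M' (g d)) = kind M (vertex_of M d)" if d: "d \<in> darts M" for d
  proof -
    have "vertex_of M d \<in> map_vertices M" using d by (simp add: map_vertices_def)
    moreover have "g ` vertex_of M d = vertex_of M' (g d)"
      by (rule image_vertex_of[where g = g and M = M and M' = M', OF _ A.rot_permutes fin d]) (rule gr)
    ultimately show ?thesis using gk by metis
  qed
  have ex: "\<exists>t. t < n \<and> g (f (s, 0, False)) = f' (t, 0, False)" if s: "s < n" for s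
  proof -
    have d: "f (s, 0, False) \<in> darts M" "f (s, 0, True) \<in> darts M"
      using s A.m_pos by (auto intro!: fd simp: dset_iff)
    have "g (f (s, 0, False)) \<in> darts M'" using bij_betwE[OF bijg] d(1) by blast
    then obtain t j c where t: "g (f (s, 0, False)) = f' (t, j, c)" "t < n" "j < m" by (rule B.dartE)
    have "kind M' (vertex_of M' (f' (t, j, c))) = Star"
      using kv[OF d(1)] t(1) A.kind_False[OF s A.m_pos] by simp
    then have c: "c = False" using B.kind_True[OF t(2,3)] by (cases c) simp_all
    have "f (s, 0, True) = opp M (f (s, 0, False))"
      using A.opp_f[of "(s, 0, False)"] s A.m_pos by (simp add: dset_iff)
    then have "g (f (s, 0, True)) = f' (t, j, True)"
      using go[OF d(1)] t B.opp_f[of "(t, j, False)"] by (simp add: c dset_iff)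
    \<comment> \<open>The opposite darts lie at vertices of colour 1 and colour
      \<open>j + 1\<close>, and these colours must agree.\<close>
    then have "j = 0" using kv[OF d(2)] B.kind_True[OF t(2,3)] A.kind_True[OF s A.m_pos] by simp
    then show ?thesis using t c by blast
  qed
  define \<rho> where "\<rho> s = (if s < n then (SOME t. t < n \<and> g (f (s, 0, False)) = f' (t, 0, False)) else s)" for s
  have \<rho>0: "\<rho> s < n \<and> g (f (s, 0, False)) = f' (\<rho> s, 0, False)" if "s < n" for s
    using someI_ex[OF ex[OF that]] that by (simp add: \<rho>_def)
  have gF: "g (f (s, i, False)) = f' (\<rho> s, i, False)" if s: "s < n" and i: "i < m" for s i
    using i
  proof (induction i)
    case 0
    then show ?case using \<rho>0[OF s] by simp
  next
    case (Suc i)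
    have "f (s, Suc i, False) = rot M (f (s, i, False))"
      using A.rot_f[of "(s, i, False)"] s Suc.prems by (simp add: dset_iff)
    then have "g (f (s, Suc i, False)) = rot M' (f' (\<rho> s, i, False))"
      using gr[OF fd[of "(s, i, False)"]] Suc s by (simp add: dset_iff)
    also have "\<dots> = f' (\<rho> s, Suc i, False)"
      using B.rot_f[of "(\<rho> s, i, False)"] \<rho>0[OF s] Suc.prems by (simp add: dset_iff)
    finally show ?case .
  qed
  have gT: "g (f (s, i, True)) = f' (\<rho> s, i, True)" if s: "s < n" and i: "i < m" for s i
  proof -
    have "f (s, i, True) = opp M (f (s, i, False))" using A.opp_f[of "(s, i, False)"] s i by (simp add: dset_iff)
    then have "g (f (s, i, True)) = opp M' (f' (\<rho> s, i, False))"
      using go[OF fd[of "(s, i, False)"]] gF[OF s i] s i by (simp add: dset_iff)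
    also have "\<dots> = f' (\<rho> s, i, True)" using B.opp_f[of "(\<rho> s, i, False)"] \<rho>0[OF s] i by (simp add: dset_iff)
    finally show ?thesis .
  qed
  have comm: "(ss' ! i) (\<rho> s) = \<rho> ((ss ! i) s)" if s: "s < n" and i: "i < m" for s i
  proof -
    have s': "(ss ! i) s < n" using A.perm_less[OF i] s by simp
    have "f ((ss ! i) s, i, True) = rot M (f (s, i, True))" using A.rot_f[of "(s, i, True)"] s i by (simp add: dset_iff)
    then have "f' (\<rho> ((ss ! i) s), i, True) = rot M' (f' (\<rho> s, i, True))"
      using gr[OF fd[of "(s, i, True)"]] gT[OF s i] gT[OF s' i] s i by (simp add: dset_iff)
    also have "\<dots> = f' ((ss' ! i) (\<rho> s), i, True)" using B.rot_f[of "(\<rho> s, i, True)"] \<rho>0[OF s] i by (simp add: dset_iff)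
    finally have "(\<rho> ((ss ! i) s), i, True) = ((ss' ! i) (\<rho> s), i, True)"
      using \<rho>0[OF s] \<rho>0[OF s'] i B.perm_less[OF i] by (intro inj_onD[OF B.inj_f]) (simp_all add: dset_iff)
    then show ?thesis by simp
  qed
  have "inj_on \<rho> {0..<n}"
  proof (rule inj_onI)
    fix s t assume st: "s \<in> {0..<n}" "t \<in> {0..<n}" "\<rho> s = \<rho> t"
    then have "g (f (s, 0, False)) = g (f (t, 0, False))" using \<rho>0[of s] \<rho>0[of t] by simp
    moreover have x: "(s, 0, False) \<in> dset m n" "(t, 0, False) \<in> dset m n" using st A.m_pos by (auto simp: dset_iff)
    ultimately have "f (s, 0, False) = f (t, 0, False)"
      using bij_betw_imp_inj_on[OF bijg] fd by (meson inj_onD)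
    then show "s = t" using inj_onD[OF A.inj_f, of "(s, 0, False)" "(t, 0, False)"] x by simp
  qed
  moreover have "\<rho> ` {0..<n} = {0..<n}"
    using \<rho>0 calculation by (intro endo_inj_surj) auto
  ultimately have "bij_betw \<rho> {0..<n} {0..<n}" by (simp add: bij_betw_def)
  then have \<rho>: "\<rho> permutes {0..<n}" by (rule bij_imp_permutes) (simp add: \<rho>_def)
  have bij: "bij \<rho>" using \<rho> by (rule permutes_bij)
  have "\<rho> 0 = 0"
  proof -
    have x: "(0, 0, False) \<in> dset m n" using A.m_pos A.n_pos by (simp add: dset_iff)
    have "f (0, 0, False) \<in> root_star M"
      unfolding A.root_f A.star_vertex_eq[OF A.n_pos] using A.m_pos by simp
    then have "f' (\<rho> 0, 0, False) \<in> root_star M'" using \<rho>0[OF A.n_pos] groot by (metis imageI)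
    then obtain j where j: "j < m" "f' (\<rho> 0, 0, False) = f' (0, j, False)"
      unfolding B.root_f B.star_vertex_eq[OF B.n_pos] by auto
    have "(\<rho> 0, 0, False) = (0, j, False)"
      using j \<rho>0[OF A.n_pos] A.m_pos A.n_pos by (intro inj_onD[OF B.inj_f j(2)]) (simp_all add: dset_iff)
    then show ?thesis by simp
  qed
  moreover have "ss' = map (relabel \<rho>) ss"
  proof (rule nth_equalityI)
    show "length ss' = length (map (relabel \<rho>) ss)" by (simp add: A.len B.len)
    fix i assume "i < length ss'"
    then have i: "i < m" by (simp add: B.len)
    have r: "relabel \<rho> (ss ! i) permutes {0..<n}"
      using relabel_permutes[OF bij A.perm[OF i]] permutes_image[OF \<rho>] by simp
    have "(ss' ! i) y = relabel \<rho> (ss ! i) y" for y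
    proof (cases "y < n")
      case True
      then have "y \<in> \<rho> ` {0..<n}" using permutes_image[OF \<rho>] by simp
      then obtain s where "s < n" "y = \<rho> s" by auto
      then show ?thesis using comm[OF _ i] relabel_apply[OF bij] by simp
    next
      case False
      then show ?thesis using permutes_not_in[OF r, of y] permutes_not_in[OF B.perm[OF i], of y] by simp
    qed
    then show "ss' ! i = map (relabel \<rho>) ss ! i" using i A.len by (simp add: fun_eq_iff)
  qed
  ultimately show ?thesis unfolding eqv_def using \<rho> by blast
qed

lemma eqv_refl: "eqv n ss ss"
proof -
  have "relabel id \<sigma> = \<sigma>" for \<sigma> :: "nat \<Rightarrow> nat" by (simp add: relabel_def fun_eq_iff)
  then have "map (relabel id) ss = ss" by (simp add: map_idI)
  then show ?thesis unfolding eqv_def by (intro exI[of _ id]) (simp add: permutes_id)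
qed

lemma eqv_sym: "eqv n ss ss' \<Longrightarrow> eqv n ss' ss"
proof -
  assume "eqv n ss ss'"
  then obtain \<rho> where \<rho>: "\<rho> permutes {0..<n}" "\<rho> 0 = 0" "ss' = map (relabel \<rho>) ss" by (auto simp: eqv_def)
  have bij: "bij \<rho>" using \<rho>(1) by (rule permutes_bij)
  have "map (relabel (inv_into UNIV \<rho>)) ss' = ss" unfolding \<rho>(3) by (simp add: relabel_inverse[OF bij] map_idI)
  moreover have "inv_into UNIV \<rho> permutes {0..<n}" by (rule permutes_inv[OF \<rho>(1)])
  moreover have "inv_into UNIV \<rho> 0 = 0" using \<rho>(2) bij_is_inj[OF bij] by (metis inv_f_f)
  ultimately show ?thesis unfolding eqv_def by (intro exI[of _ "inv_into UNIV \<rho>"]) simp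
qed

lemma eqv_trans: "eqv n ss ss' \<Longrightarrow> eqv n ss' ss'' \<Longrightarrow> eqv n ss ss''"
proof -
  assume "eqv n ss ss'" "eqv n ss' ss''"
  then obtain \<rho> \<rho>' where \<rho>: "\<rho> permutes {0..<n}" "\<rho> 0 = 0" "ss' = map (relabel \<rho>) ss"
    and \<rho>': "\<rho>' permutes {0..<n}" "\<rho>' 0 = 0" "ss'' = map (relabel \<rho>') ss'" by (auto simp: eqv_def)
  have b: "bij \<rho>" "bij \<rho>'" using \<rho>(1) \<rho>'(1) by (auto intro: permutes_bij)
  have "relabel \<rho>' (relabel \<rho> \<sigma>) = relabel (\<rho>' \<circ> \<rho>) \<sigma>" for \<sigma>
    by (simp only: relabel_def o_inv_distrib[OF b(2,1)] o_assoc)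
  then have "ss'' = map (relabel (\<rho>' \<circ> \<rho>)) ss" unfolding \<rho>' \<rho> by simp
  moreover have "\<rho>' \<circ> \<rho> permutes {0..<n}" using \<rho>(1) \<rho>'(1) by (rule permutes_compose)
  ultimately show ?thesis unfolding eqv_def using \<rho>(2) \<rho>'(2) by (intro exI[of _ "\<rho>' \<circ> \<rho>"]) simp
qed


lemma orbit_of_card:
  assumes p: "permutation h" and c: "card (orbit h x) = m"
  shows "orbit h x = (\<lambda>i. (h ^^ i) x) ` {0..<m}" "inj_on (\<lambda>i. (h ^^ i) x) {0..<m}" "(h ^^ m) x = x"
proof -
  have self: "x \<in> orbit h x" by (rule permutation_self_in_orbit[OF p])
  let ?k = "funpow_dist1 h x x"
  have o: "orbit h x = (\<lambda>n. (h ^^ n) x) ` {0..<?k}" by (rule orbit_conv_funpow_dist1[OF self])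
  have i: "inj_on (\<lambda>n. (h ^^ n) x) {0..<?k}" by (rule inj_on_funpow_dist1[OF self])
  have "card (orbit h x) = ?k" unfolding o card_image[OF i] by simp
  then have k: "?k = m" using c by simp
  show "orbit h x = (\<lambda>i. (h ^^ i) x) ` {0..<m}" using o unfolding k .
  show "inj_on (\<lambda>i. (h ^^ i) x) {0..<m}" using i unfolding k .
  show "(h ^^ m) x = x" using funpow_dist1_prop[OF self] unfolding k .
qed

text \<open>Number the stars, and at each choose the dart \<open>\<beta> s\<close> after which the
  neighbours have colours 1, 2, and so on. The darts at stars are then the rotations of the
  \<open>\<beta> s\<close>, the others are their opposites, and rotation about the vertices of
  colour \<open>i + 1\<close> becomes the \<open>i\<close>-th permutation.\<close>

lemma ex_pres:
  fixes M :: "'d rkmap"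
  assumes m: "m \<ge> 1" and M: "is_rooted_constellation m M" and n: "card (star_vertices M) = n"
  shows "\<exists>ss f. pres m n ss M f \<and> reach ss 0 = {0..<n}"
proof -
  have con: "is_constellation m M" and rootV: "root_star M \<in> star_vertices M"
    using M by (auto simp: is_rooted_constellation_def)
  have map: "is_map M" using con by (simp add: is_constellation_def)
  have fin: "finite (darts M)" and rotp: "rot M permutes darts M" and oppp: "opp M permutes darts M"
    using map by (auto simp: is_map_def)
  have opp2: "opp M (opp M d) = d" if "d \<in> darts M" for d using map that by (auto simp: is_map_def)
  have bip: "kind M (vertex_of M d) = Star \<longleftrightarrow> kind M (vertex_of M (opp M d)) \<noteq> Star" if "d \<in> darts M" for d
    using con that by (auto simp: is_constellation_def)
  have stars: "card v = m \<and> (\<exists>d\<in>v. \<forall>i<m. kind M (vertex_of M (opp M ((rot M ^^ i) d))) = Colored (i + 1))"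
    if "v \<in> star_vertices M" for v using con that unfolding is_constellation_def by blast
  have perm: "permutation (rot M)" unfolding permutation_permutes using fin rotp by blast
  have self: "d \<in> vertex_of M d" for d unfolding vertex_of_def by (rule permutation_self_in_orbit[OF perm])
  have vert_eq: "vertex_of M e = vertex_of M d" if "e \<in> vertex_of M d" for d e
    using orbit_cyclic_eq3[OF cyclic_on_orbit'[OF perm]] that unfolding vertex_of_def by blast
  have vsub: "vertex_of M d \<subseteq> darts M" if "d \<in> darts M" for d
    unfolding vertex_of_def by (rule permutes_orbit_subset[OF rotp that])
  have od: "opp M d \<in> darts M \<longleftrightarrow> d \<in> darts M" for d by (rule permutes_in_image[OF oppp])
  have rd: "rot M d \<in> darts M \<longleftrightarrow> d \<in> darts M" for d by (rule permutes_in_image[OF rotp])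
  let ?V = "star_vertices M"
  have finV: "finite ?V" using fin by (simp add: star_vertices_def map_vertices_def)
  obtain h where h: "bij_betw h {0..<n} ?V" using ex_bij_betw_nat_finite[OF finV] n by auto
  obtain k where k: "k < n" "h k = root_star M" using rootV unfolding bij_betw_imp_surj_on[OF h, symmetric] by auto
  have npos: "0 < n" using k by simp
  \<comment> \<open>The transposition moves the root star to position 0.\<close>
  define v where "v = h \<circ> transpose 0 k"
  have "transpose 0 k permutes {0..<n}" using k by (intro permutes_swap_id) auto
  then have v: "bij_betw v {0..<n} ?V" unfolding v_def using h permutes_imp_bij bij_betw_trans by blast
  have v0: "v 0 = root_star M" using k by (simp add: v_def)
  have vV: "v s \<in> ?V" if "s < n" for s using bij_betwE[OF v] that by simp
  have vinj: "s = t" if "v s = v t" "s < n" "t < n" for s t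
    using inj_onD[OF bij_betw_imp_inj_on[OF v] that(1)] that(2,3) by simp
  define \<beta> where "\<beta> s = (SOME d. d \<in> v s \<and> (\<forall>i<m. kind M (vertex_of M (opp M ((rot M ^^ i) d))) = Colored (i + 1)))" for s
  have \<beta>: "\<beta> s \<in> v s \<and> (\<forall>i<m. kind M (vertex_of M (opp M ((rot M ^^ i) (\<beta> s)))) = Colored (i + 1))" if s: "s < n" for s
  proof -
    have "\<exists>d. d \<in> v s \<and> (\<forall>i<m. kind M (vertex_of M (opp M ((rot M ^^ i) d))) = Colored (i + 1))"
      using stars[OF vV[OF s]] by blast
    then show ?thesis unfolding \<beta>_def by (rule someI_ex)
  qed
  have v\<beta>: "v s = vertex_of M (\<beta> s)" and \<beta>d: "\<beta> s \<in> darts M" if s: "s < n" for s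
  proof -
    obtain d where d: "d \<in> darts M" "v s = vertex_of M d"
      using vV[OF s] unfolding star_vertices_def map_vertices_def by blast
    show "v s = vertex_of M (\<beta> s)" using vert_eq[of "\<beta> s" d] \<beta>[OF s] d by simp
    show "\<beta> s \<in> darts M" using vsub[OF d(1)] \<beta>[OF s] d(2) by blast
  qed
  have vkind: "kind M (v s) = Star" if "s < n" for s using vV[OF that] by (simp add: star_vertices_def)
  have cardv: "card (orbit (rot M) (\<beta> s)) = m" if s: "s < n" for s
    using stars[OF vV[OF s]] v\<beta>[OF s] by (simp add: vertex_of_def)
  note orb = orbit_of_card[OF perm cardv]
  define F where "F s i = (rot M ^^ i) (\<beta> s)" for s i
  define f where "f = (\<lambda>(s, i, b). if b then opp M (F s i) else F s i)"
  have f_simps: "f (s, i, False) = F s i" "f (s, i, True) = opp M (F s i)" for s i by (simp_all add: f_def)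
  have vF: "v s = F s ` {0..<m}" if s: "s < n" for s
    using orb(1)[OF s] v\<beta>[OF s] unfolding vertex_of_def F_def by simp
  have Fv: "F s i \<in> v s" if "s < n" "i < m" for s i using vF[OF that(1)] that(2) by simp
  have Fd: "F s i \<in> darts M" if "s < n" "i < m" for s i
    using Fv[OF that] vsub[OF \<beta>d[OF that(1)]] v\<beta>[OF that(1)] by blast
  have Fvert: "vertex_of M (F s i) = v s" if "s < n" "i < m" for s i
    using vert_eq[of "F s i" "\<beta> s"] Fv[OF that] v\<beta>[OF that(1)] by simp
  have kF: "kind M (vertex_of M (f (s, i, False))) = Star" if "s < n" "i < m" for s i
    using Fvert[OF that] vkind[OF that(1)] by (simp add: f_simps)
  have kT: "kind M (vertex_of M (f (s, i, True))) = Colored (Suc i)" if "s < n" "i < m" for s i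
    using \<beta>[OF that(1)] that(2) by (simp add: f_simps F_def)
  have Finj: "s = t \<and> i = j" if eq: "F s i = F t j" and si: "s < n" "i < m" and tj: "t < n" "j < m" for s i t j
  proof -
    have "v s = v t" using Fvert[OF si] Fvert[OF tj] eq by simp
    then have st: "s = t" using si tj by (intro vinj)
    then have "i = j" using inj_onD[OF orb(2)[OF si(1)], of i j] eq si tj unfolding F_def by simp
    then show ?thesis using st by simp
  qed
  have inj_f: "inj_on f (dset m n)"
  proof (rule inj_onI)
    fix x y assume xy: "x \<in> dset m n" "y \<in> dset m n" "f x = f y"
    obtain s i b where x: "x = (s, i, b)" by (cases x) auto
    obtain t j c where y: "y = (t, j, c)" by (cases y) auto
    have si: "s < n" "i < m" and tj: "t < n" "j < m" using xy by (auto simp: x y dset_iff)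
    have bc: "b = c"
      using kF[OF si] kT[OF si] kF[OF tj] kT[OF tj] xy(3) unfolding x y by (cases b; cases c) simp_all
    have "F s i = F t j"
    proof (cases b)
      case True
      then have "opp M (F s i) = opp M (F t j)" using xy(3) bc by (simp add: x y f_simps)
      then show ?thesis using opp2[OF Fd[OF si]] opp2[OF Fd[OF tj]] by metis
    next
      case False
      then show ?thesis using xy(3) bc by (simp add: x y f_simps)
    qed
    then show "x = y" using Finj[OF _ si tj] bc by (simp add: x y)
  qed
  have star_dart: "\<exists>s i. s < n \<and> i < m \<and> d = F s i" if d: "d \<in> darts M" and star: "kind M (vertex_of M d) = Star" for d
  proof -
    have "vertex_of M d \<in> ?V" using d star by (simp add: star_vertices_def map_vertices_def)
    then obtain s where s: "s < n" "vertex_of M d = v s" unfolding bij_betw_imp_surj_on[OF v, symmetric] by auto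
    then have "d \<in> F s ` {0..<m}" using self[of d] vF[OF s(1)] by simp
    then obtain i where "i < m" "d = F s i" by auto
    then show ?thesis using s(1) by blast
  qed
  have dsetI: "(s, i, b) \<in> dset m n" if "s < n" "i < m" for s i b using that by (simp add: dset_iff)
  have darts_f: "darts M = f ` dset m n"
  proof (intro equalityI subsetI)
    fix d assume d: "d \<in> darts M"
    show "d \<in> f ` dset m n"
    proof (cases "kind M (vertex_of M d) = Star")
      case True
      then obtain s i where si: "s < n" "i < m" "d = F s i" using star_dart[OF d] by blast
      show ?thesis by (rule image_eqI[of _ _ "(s, i, False)"]) (use si dsetI in \<open>simp_all add: f_simps\<close>)
    next
      case False
      then have "kind M (vertex_of M (opp M d)) = Star" using bip[OF d] by blast
      then obtain s i where si: "s < n" "i < m" "opp M d = F s i" using star_dart[of "opp M d"] od[of d] d by blast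
      then have "d = opp M (F s i)" using opp2[OF d] by simp
      then show ?thesis by (intro image_eqI[of _ _ "(s, i, True)"]) (use si dsetI in \<open>simp_all add: f_simps\<close>)
    qed
  next
    fix d assume "d \<in> f ` dset m n"
    then obtain s i b where "d = f (s, i, b)" "s < n" "i < m" by (auto simp: dset_def)
    then show "d \<in> darts M" using Fd[of s i] od by (cases b) (simp_all add: f_simps)
  qed
  have ex\<sigma>: "\<exists>t. t < n \<and> rot M (f (s, i, True)) = f (t, i, True)" if si: "s < n" "i < m" for s i
  proof -
    have d: "f (s, i, True) \<in> darts M" using Fd[OF si] od by (simp add: f_simps)
    then have "rot M (f (s, i, True)) \<in> f ` dset m n" using rd darts_f by simp
    then obtain t j c where t: "rot M (f (s, i, True)) = f (t, j, c)" "t < n" "j < m" by (auto simp: dset_def)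
    have "rot M (f (s, i, True)) \<in> vertex_of M (f (s, i, True))" unfolding vertex_of_def by (rule orbit.base)
    \<comment> \<open>Rotation does not leave the coloured vertex, and its kind determines both the
      end and the colour of the new dart.\<close>
    then have "vertex_of M (f (t, j, c)) = vertex_of M (f (s, i, True))" using vert_eq t(1) by simp
    then have "kind M (vertex_of M (f (t, j, c))) = Colored (Suc i)" using kT[OF si] by simp
    then have "c \<and> j = i" using kF[OF t(2,3)] kT[OF t(2,3)] by (cases c) simp_all
    then show ?thesis using t by auto
  qed
  define \<sigma> where "\<sigma> i s = (if s < n then (SOME t. t < n \<and> rot M (f (s, i, True)) = f (t, i, True)) else s)" for i s
  have \<sigma>: "\<sigma> i s < n \<and> rot M (f (s, i, True)) = f (\<sigma> i s, i, True)" if "s < n" "i < m" for s i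
    using someI_ex[OF ex\<sigma>[OF that]] that by (simp add: \<sigma>_def)
  have \<sigma>p: "\<sigma> i permutes {0..<n}" if i: "i < m" for i
  proof (rule bij_imp_permutes)
    have "inj_on (\<sigma> i) {0..<n}"
    proof (rule inj_onI)
      fix s t assume st: "s \<in> {0..<n}" "t \<in> {0..<n}" "\<sigma> i s = \<sigma> i t"
      then have "rot M (f (s, i, True)) = rot M (f (t, i, True))" using \<sigma>[of s i] \<sigma>[of t i] i by simp
      then have "f (s, i, True) = f (t, i, True)" using permutes_inj[OF rotp] by (simp add: inj_eq)
      then show "s = t" using inj_onD[OF inj_f, of "(s, i, True)" "(t, i, True)"] st i by (simp add: dset_iff)
    qed
    moreover have "\<sigma> i ` {0..<n} = {0..<n}"
      using \<sigma>[OF _ i] calculation by (intro endo_inj_surj) auto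
    ultimately show "bij_betw (\<sigma> i) {0..<n} {0..<n}" by (simp add: bij_betw_def)
  qed (simp add: \<sigma>_def)
  define ss where "ss = map \<sigma> [0..<m]"
  have ssn: "ss ! i = \<sigma> i" if "i < m" for i using that by (simp add: ss_def)
  have "ss \<in> tups m {0..<n}" using \<sigma>p by (auto simp: tups_def ss_def)
  then have pt: "ptup m n ss" using m npos by (simp add: ptup_def)
  have P: "pres m n ss M f"
  proof (rule pres.intro[OF pt], unfold_locales)
    show "inj_on f (dset m n)" by (rule inj_f)
    show "darts M = f ` dset m n" by (rule darts_f)
    show "rot M permutes darts M" by (rule rotp)
    show "opp M permutes darts M" by (rule oppp)
    show "rot M (f x) = f (rotD m ss x)" if x: "x \<in> dset m n" for x
    proof -
      obtain s i b where xs: "x = (s, i, b)" by (cases x) auto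
      have si: "s < n" "i < m" using x by (auto simp: xs dset_iff)
      show ?thesis
      proof (cases b)
        case True
        then show ?thesis using \<sigma>[OF si] ssn[OF si(2)] by (simp add: xs)
      next
        case False
        have "rot M (F s i) = F s (Suc i mod m)"
        proof (cases "Suc i = m")
          case True
          have "rot M (F s i) = (rot M ^^ Suc i) (\<beta> s)" by (simp add: F_def)
          also have "\<dots> = \<beta> s" unfolding True by (rule orb(3)[OF si(1)])
          finally show ?thesis using True by (simp add: F_def)
        next
          case False
          then show ?thesis using si by (simp add: F_def)
        qed
        then show ?thesis using False by (simp add: xs f_simps)
      qed
    qed
    show "opp M (f x) = f (oppD x)" if x: "x \<in> dset m n" for x
    proof -
      obtain s i b where xs: "x = (s, i, b)" by (cases x) auto
      have si: "s < n" "i < m" using x by (auto simp: xs dset_iff)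
      show ?thesis using opp2[OF Fd[OF si]] by (cases b) (simp_all add: xs f_simps)
    qed
    show "kind M (vertex_of M (f (s, i, False))) = Star" if "s < n" "i < m" for s i using that by (rule kF)
    show "kind M (vertex_of M (f (s, i, True))) = Colored (Suc i)" if "s < n" "i < m" for s i using that by (rule kT)
    show "root_star M = vertex_of M (f (0, 0, False))"
      using Fvert[of 0 0] npos m v0 by (simp add: f_simps)
  qed
  moreover have "reach ss 0 = {0..<n}"
    by (rule pres.reach_if_connected[OF P]) (use map in \<open>simp add: is_map_def\<close>)
  ultimately show ?thesis by blast
qed


section \<open>Counting isomorphism classes\<close>

lemma conn_tups_relabel:
  assumes \<rho>: "\<rho> permutes {0..<n}" "\<rho> 0 = 0" and ss: "ss \<in> conn_tups m n"
  shows "map (relabel \<rho>) ss \<in> conn_tups m n" "wt {0..<n} (map (relabel \<rho>) ss) = wt {0..<n} ss"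
proof -
  have bij: "bij \<rho>" using \<rho>(1) by (rule permutes_bij)
  have im: "\<rho> ` {0..<n} = {0..<n}" by (rule permutes_image[OF \<rho>(1)])
  have t: "ss \<in> tups m {0..<n}" and r: "reach ss 0 = {0..<n}" using ss by (auto simp: conn_tups_def)
  have "map (relabel \<rho>) ss \<in> tups m {0..<n}" using tups_relabel[OF bij t] unfolding im .
  moreover have "reach (map (relabel \<rho>) ss) 0 = {0..<n}" using reach_relabel[OF bij, of ss 0] unfolding \<rho>(2) r im .
  ultimately show "map (relabel \<rho>) ss \<in> conn_tups m n" by (simp add: conn_tups_def)
  show "wt {0..<n} (map (relabel \<rho>) ss) = wt {0..<n} ss" using wt_relabel[OF bij t] unfolding im by simp
qed

text \<open>A rooted transitive tuple has no automorphisms: two renumberings with the same effect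
  agree at 0, hence at each point reached from it.\<close>

lemma inj_relabel_conn:
  assumes ss: "ss \<in> conn_tups m n"
  shows "inj_on (\<lambda>\<rho>. map (relabel \<rho>) ss) {\<rho>. \<rho> permutes {0..<n} \<and> \<rho> 0 = 0}"
proof (rule inj_onI)
  fix \<rho> \<rho>' assume a: "\<rho> \<in> {\<rho>. \<rho> permutes {0..<n} \<and> \<rho> 0 = 0}" "\<rho>' \<in> {\<rho>. \<rho> permutes {0..<n} \<and> \<rho> 0 = 0}"
    and eq: "map (relabel \<rho>) ss = map (relabel \<rho>') ss"
  have b: "bij \<rho>" "bij \<rho>'" using a by (auto intro: permutes_bij)
  have e: "relabel \<rho> \<sigma> = relabel \<rho>' \<sigma>" if "\<sigma> \<in> set ss" for \<sigma> using eq that by simp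
  have agree: "\<rho> x = \<rho>' x" if "x \<in> reach ss 0" for x
    using that
  proof induction
    case base
    then show ?case using a by simp
  next
    case (step x \<sigma>)
    have "\<rho> (\<sigma> x) = relabel \<rho> \<sigma> (\<rho> x)" by (simp add: relabel_apply[OF b(1)])
    also have "\<dots> = relabel \<rho>' \<sigma> (\<rho>' x)" using e[OF step.hyps(2)] step.IH by simp
    also have "\<dots> = \<rho>' (\<sigma> x)" by (simp add: relabel_apply[OF b(2)])
    finally show ?case .
  qed
  show "\<rho> = \<rho>'"
  proof
    fix x show "\<rho> x = \<rho>' x"
    proof (cases "x < n")
      case True
      then show ?thesis using agree[of x] ss by (simp add: conn_tups_def)
    next
      case False
      then show ?thesis using a permutes_not_in[of \<rho> "{0..<n}" x] permutes_not_in[of \<rho>' "{0..<n}" x] by simp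
    qed
  qed
qed

lemma card_fixing_permutations:
  assumes "0 < n"
  shows "card {\<rho>. \<rho> permutes {0..<n} \<and> \<rho> 0 = 0} = fact (n - 1)"
proof -
  have "{\<rho>. \<rho> permutes {0..<n} \<and> \<rho> 0 = 0} = {\<rho>. \<rho> permutes {1..<n}}"
  proof (intro equalityI subsetI)
    fix \<rho> assume "\<rho> \<in> {\<rho>. \<rho> permutes {0..<n} \<and> \<rho> 0 = 0}"
    then have p: "\<rho> permutes {0..<n}" "\<rho> 0 = 0" by auto
    have fx: "\<rho> x = x" if "x \<in> {0..<n} - {1..<n}" for x
    proof -
      have "x = 0" using that by auto
      then show ?thesis using p(2) by simp
    qed
    have "\<rho> permutes {1..<n}" by (rule permutes_superset[OF p(1)]) (rule fx)
    then show "\<rho> \<in> {\<rho>. \<rho> permutes {1..<n}}" by (simp only: mem_Collect_eq)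
  next
    fix \<rho> assume "\<rho> \<in> {\<rho>. \<rho> permutes {1..<n}}"
    then have p: "\<rho> permutes {1..<n}" by simp
    then have "\<rho> permutes {0..<n}" by (rule permutes_subset) auto
    then show "\<rho> \<in> {\<rho>. \<rho> permutes {0..<n} \<and> \<rho> 0 = 0}" using permutes_not_in[OF p, of 0] by simp
  qed
  then show ?thesis using card_permutations[of "{1..<n}" "n - 1"] by simp
qed

text \<open>The renumberings that fix 0 act freely on the tuples, and their orbits correspond to the
  isomorphism classes. Each class thus stems from as many tuples as there are permutations of the
  other \<open>n - 1\<close> points.\<close>

lemma num_constellations_count:
  assumes m: "m \<ge> 1" and n: "n \<ge> 1"
  shows "fact (n - 1) * num_constellations m g n =
    card {ss \<in> conn_tups m n. wt {0..<n} ss + 2 * g = dtop m n}"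
proof -
  let ?A = "rooted_constellations m g n" and ?R = "rooted_iso_rel m g n"
  define T where "T = {ss \<in> conn_tups m n. wt {0..<n} ss + 2 * g = dtop m n}"
  have finT: "finite T" by (simp add: T_def)
  have pt: "ptup m n ss" if "ss \<in> T" for ss
    using that m n by (simp add: T_def conn_tups_def ptup_def)
  have ps: "pres m n ss (std_map m n ss) to_nat" if "ss \<in> T" for ss
    by (rule ptup.pres_std_map[OF pt[OF that]])
  have stdA: "std_map m n ss \<in> ?A" if ss: "ss \<in> T" for ss
  proof -
    interpret pres m n ss "std_map m n ss" to_nat by (rule ps[OF ss])
    have "is_rooted_constellation m (std_map m n ss)"
      by (rule is_rooted_constellation) (use ss in \<open>simp add: T_def conn_tups_def\<close>)
    moreover have "has_genus (std_map m n ss) g" using ss has_genus_iff by (simp add: T_def dtop_def)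
    ultimately show ?thesis using card_star_vertices by (simp add: rooted_constellations_def)
  qed
  have exA: "\<exists>ss f. ss \<in> T \<and> pres m n ss M f" if M: "M \<in> ?A" for M
  proof -
    have M': "is_rooted_constellation m M" "has_genus M g" "card (star_vertices M) = n"
      using M by (auto simp: rooted_constellations_def)
    obtain ss f where p: "pres m n ss M f" "reach ss 0 = {0..<n}" using ex_pres[OF m M'(1,3)] by blast
    have "ss \<in> tups m {0..<n}" using p(1) by (simp add: pres_def ptup_def)
    moreover have "wt {0..<n} ss + 2 * g = dtop m n"
      using pres.has_genus_iff[OF p(1)] M'(2) by (simp add: dtop_def)
    ultimately show ?thesis using p by (auto simp: T_def conn_tups_def)
  qed
  have iso: "rooted_iso M N \<longleftrightarrow> eqv n ss ss'" if "pres m n ss M f" "pres m n ss' N f'" for ss ss' M N f f'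
    using rooted_iso_if_eqv[OF that] eqv_if_rooted_iso[OF that] by blast
  \<comment> \<open>Each map has a presenting tuple, and through these tuples the three properties
    are inherited from \<open>eqv\<close>.\<close>
  have "equiv ?A ?R"
  proof (rule equivI)
    show "?R \<subseteq> ?A \<times> ?A" by (auto simp: rooted_iso_rel_def)
    show "refl_on ?A ?R"
    proof (rule refl_onI)
      fix M assume M: "M \<in> ?A"
      then obtain ss f where "pres m n ss M f" using exA by blast
      then have "rooted_iso M M" using iso eqv_refl by blast
      then show "(M, M) \<in> ?R" using M by (simp add: rooted_iso_rel_def)
    qed
    show "sym ?R"
    proof (rule symI)
      fix M N assume MN: "(M, N) \<in> ?R"
      then have A: "M \<in> ?A" "N \<in> ?A" "rooted_iso M N" by (auto simp: rooted_iso_rel_def)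
      obtain ss f where s: "pres m n ss M f" using exA[OF A(1)] by blast
      obtain ss' f' where s': "pres m n ss' N f'" using exA[OF A(2)] by blast
      have "rooted_iso N M" using iso[OF s s'] iso[OF s' s] A(3) eqv_sym by blast
      then show "(N, M) \<in> ?R" using A by (simp add: rooted_iso_rel_def)
    qed
    show "trans ?R"
    proof (rule transI)
      fix M N K assume MN: "(M, N) \<in> ?R" "(N, K) \<in> ?R"
      then have A: "M \<in> ?A" "N \<in> ?A" "K \<in> ?A" "rooted_iso M N" "rooted_iso N K" by (auto simp: rooted_iso_rel_def)
      obtain ss f where s: "pres m n ss M f" using exA[OF A(1)] by blast
      obtain ss' f' where s': "pres m n ss' N f'" using exA[OF A(2)] by blast
      obtain ss'' f'' where s'': "pres m n ss'' K f''" using exA[OF A(3)] by blast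
      have "eqv n ss ss''"
        by (rule eqv_trans[of n ss ss']) (use iso[OF s s'] iso[OF s' s''] A(4,5) in blast)+
      then have "rooted_iso M K" using iso[OF s s''] by blast
      then show "(M, K) \<in> ?R" using A by (simp add: rooted_iso_rel_def)
    qed
  qed
  define \<Phi> where "\<Phi> ss = ?R `` {std_map m n ss}" for ss
  have \<Phi>_eq: "\<Phi> ss = \<Phi> ss' \<longleftrightarrow> eqv n ss ss'" if s: "ss \<in> T" "ss' \<in> T" for ss ss'
  proof -
    have "\<Phi> ss = \<Phi> ss' \<longleftrightarrow> (std_map m n ss, std_map m n ss') \<in> ?R"
      unfolding \<Phi>_def by (rule eq_equiv_class_iff[OF \<open>equiv ?A ?R\<close> stdA[OF s(1)] stdA[OF s(2)]])
    also have "\<dots> \<longleftrightarrow> rooted_iso (std_map m n ss) (std_map m n ss')"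
      using stdA[OF s(1)] stdA[OF s(2)] by (simp add: rooted_iso_rel_def)
    also have "\<dots> \<longleftrightarrow> eqv n ss ss'" by (rule iso[OF ps[OF s(1)] ps[OF s(2)]])
    finally show ?thesis .
  qed
  have quot: "?A // ?R = \<Phi> ` T"
  proof (intro equalityI subsetI)
    fix c assume "c \<in> ?A // ?R"
    then obtain M where M: "M \<in> ?A" "c = ?R `` {M}" by (rule quotientE)
    obtain ss f where s: "ss \<in> T" "pres m n ss M f" using exA[OF M(1)] by blast
    have "rooted_iso (std_map m n ss) M" using iso[OF ps[OF s(1)] s(2)] eqv_refl by blast
    then have "(std_map m n ss, M) \<in> ?R" using stdA[OF s(1)] M(1) by (simp add: rooted_iso_rel_def)
    then have "\<Phi> ss = c" unfolding \<Phi>_def M(2) by (rule equiv_class_eq[OF \<open>equiv ?A ?R\<close>])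
    then show "c \<in> \<Phi> ` T" using s(1) by blast
  next
    fix c assume "c \<in> \<Phi> ` T"
    then obtain ss where "ss \<in> T" "c = \<Phi> ss" by blast
    then show "c \<in> ?A // ?R" unfolding \<Phi>_def using quotientI[OF stdA] by blast
  qed
  have fiber: "card {ss' \<in> T. \<Phi> ss' = c} = fact (n - 1)" if c: "c \<in> \<Phi> ` T" for c
  proof -
    obtain ss where ss: "ss \<in> T" "c = \<Phi> ss" using c by blast
    have ssc: "ss \<in> conn_tups m n" using ss by (simp add: T_def)
    let ?P = "{\<rho>. \<rho> permutes {0..<n} \<and> \<rho> 0 = 0}"
    have "{ss' \<in> T. \<Phi> ss' = c} = (\<lambda>\<rho>. map (relabel \<rho>) ss) ` ?P"
    proof (intro equalityI subsetI)
      fix ss' assume "ss' \<in> {ss' \<in> T. \<Phi> ss' = c}"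
      then have "eqv n ss ss'" using \<Phi>_eq[OF ss(1), of ss'] ss(2) by auto
      then show "ss' \<in> (\<lambda>\<rho>. map (relabel \<rho>) ss) ` ?P" unfolding eqv_def by blast
    next
      fix ss' assume "ss' \<in> (\<lambda>\<rho>. map (relabel \<rho>) ss) ` ?P"
      then obtain \<rho> where \<rho>: "\<rho> permutes {0..<n}" "\<rho> 0 = 0" "ss' = map (relabel \<rho>) ss" by blast
      have T': "ss' \<in> T" using conn_tups_relabel[OF \<rho>(1,2) ssc] ss(1) \<rho>(3) by (simp add: T_def)
      have "eqv n ss ss'" unfolding eqv_def using \<rho> by blast
      then show "ss' \<in> {ss' \<in> T. \<Phi> ss' = c}" using \<Phi>_eq[OF ss(1) T'] ss(2) T' by simp
    qed
    then show ?thesis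
      using card_image[OF inj_relabel_conn[OF ssc]] card_fixing_permutations[of n] n by simp
  qed
  have "card T = (\<Sum>c\<in>\<Phi> ` T. card {ss' \<in> T. \<Phi> ss' = c})"
  proof -
    have "(\<Sum>c\<in>\<Phi> ` T. \<Sum>x\<in>{x \<in> T. \<Phi> x = c}. 1) = (\<Sum>x\<in>T. 1 :: nat)"
      by (rule sum.group[OF finT]) (use finT in auto)
    then show ?thesis by simp
  qed
  also have "\<dots> = card (\<Phi> ` T) * fact (n - 1)" using fiber by simp
  finally show ?thesis unfolding num_constellations_def quot T_def[symmetric] by (simp add: mult.commute)
qed

lemma num_constellations_ccoef:
  assumes m: "m \<ge> 1" and n: "n \<ge> 1"
  shows "real (num_constellations m g n) = ccoef m n g"
proof -
  have c: "fact (n - 1) * real (num_constellations m g n) =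
     real (card {ss \<in> conn_tups m n. wt {0..<n} ss + 2 * g = dtop m n})"
    using arg_cong[OF num_constellations_count[OF m n, of g], of real] by simp
  show ?thesis
  proof (cases "2 * g \<le> dtop m n")
    case True
    have "coeff (cpoly m n) (dtop m n - 2 * g) =
      (\<Sum>ss\<in>conn_tups m n. if wt {0..<n} ss = dtop m n - 2 * g then 1 / fact (n - 1) else 0)"
      by (simp add: cpoly_def coeff_sum cong: if_cong)
    also have "\<dots> = (\<Sum>ss | ss \<in> conn_tups m n \<and> wt {0..<n} ss = dtop m n - 2 * g. 1 / fact (n - 1))"
      by (rule sum.inter_filter[symmetric]) simp
    also have "{ss. ss \<in> conn_tups m n \<and> wt {0..<n} ss = dtop m n - 2 * g} =
        {ss \<in> conn_tups m n. wt {0..<n} ss + 2 * g = dtop m n}"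
      using True by auto
    finally have "coeff (cpoly m n) (dtop m n - 2 * g) = real (card {ss \<in> conn_tups m n. wt {0..<n} ss + 2 * g = dtop m n}) / fact (n - 1)"
      by simp
    then show ?thesis using True unfolding c[symmetric] by (simp add: ccoef_def)
  next
    case False
    then have "{ss \<in> conn_tups m n. wt {0..<n} ss + 2 * g = dtop m n} = {}" by auto
    then show ?thesis using c False by (simp add: ccoef_def)
  qed
qed

theorem theorem2:
  fixes m g n :: nat
  assumes "m \<ge> 1" and "n \<ge> 1"
  shows "real (n choose 2) * real (num_constellations m g n) =
    (\<Sum>(n\<^sub>1, n\<^sub>2, g\<^sub>1, g\<^sub>2, h) \<in>
        {(n\<^sub>1, n\<^sub>2, g\<^sub>1, g\<^sub>2, h). n\<^sub>1 + n\<^sub>2 = n \<and> n\<^sub>1 \<ge> 1 \<and> n\<^sub>2 \<ge> 1 \<and> g\<^sub>1 + g\<^sub>2 + h = g}.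
      real n\<^sub>1 * (((real m - 1) * real n\<^sub>2 + 2 - 2 * real g\<^sub>2) gchoose (2 * h + 2))
        * real (num_constellations m g\<^sub>1 n\<^sub>1) * real (num_constellations m g\<^sub>2 n\<^sub>2))"
proof -
  let ?I = "{(n1, n2, g1, g2, h). n1 + n2 = n \<and> n1 \<ge> 1 \<and> n2 \<ge> 1 \<and> g1 + g2 + h = g}"
  let ?G = "{(g1, g2, h). g1 + g2 + h = g}"
  let ?t = "\<lambda>k (g1, g2, h). ccoef m k g1 * ccoef m (n - k) g2 * 2 * real ((dtop m (n - k) - 2 * g2) choose (2 * h + 2))"
  let ?s = "\<lambda>(n1, n2, g1, g2, h). real n1 * (((real m - 1) * real n2 + 2 - 2 * real g2) gchoose (2 * h + 2))
        * real (num_constellations m g1 n1) * real (num_constellations m g2 n2)"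
  have finG: "finite ?G"
    by (rule finite_subset[of _ "{0..g} \<times> {0..g} \<times> {0..g}"]) auto
  have trm: "2 * ?s (k, n - k, q) = real k * ?t k q" if k: "k \<in> {1..<n}" for k q
  proof -
    obtain g1 g2 h where q: "q = (g1, g2, h)" by (cases q) auto
    have C: "real (num_constellations m g1 k) = ccoef m k g1" "real (num_constellations m g2 (n - k)) = ccoef m (n - k) g2"
      using k assms(1) by (auto intro!: num_constellations_ccoef)
    show ?thesis
    \<comment> \<open>If the upper argument is a natural number, the generalised binomial
      coefficient is the ordinary one. If it is negative, no constellation of genus
      \<open>g2\<close> exists and both sides are zero.\<close>
    proof (cases "2 * g2 \<le> dtop m (n - k)")
      case True
      have "(real m - 1) * real (n - k) + 2 - 2 * real g2 = real (dtop m (n - k) - 2 * g2)"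
        using True assms(1) by (simp add: dtop_def of_nat_diff)
      then have "((real m - 1) * real (n - k) + 2 - 2 * real g2) gchoose (2 * h + 2) =
          real ((dtop m (n - k) - 2 * g2) choose (2 * h + 2))"
        by (simp only: binomial_gbinomial)
      then show ?thesis by (simp only: q prod.case C) (simp add: mult_ac)
    next
      case False
      then have "ccoef m (n - k) g2 = 0" by (simp add: ccoef_def)
      then show ?thesis by (simp only: q prod.case C mult_zero_left mult_zero_right)
    qed
  qed
  \<comment> \<open>The 2 in the denominator of \<open>n choose 2\<close> meets the factor 2 by
    which the even terms of the second difference are doubled.\<close>
  have "2 * (real (n choose 2) * real (num_constellations m g n)) = real n * (real n - 1) * ccoef m n g"
    using assms by (simp add: num_constellations_ccoef choose_two real_of_nat_div of_nat_diff)
  also have "\<dots> = (\<Sum>k=0..n. real k * (\<Sum>q\<in>?G. ?t k q))"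
    using ccoef_rec[OF assms(1), of n g] by simp
  also have "\<dots> = (\<Sum>k\<in>{1..<n}. real k * (\<Sum>q\<in>?G. ?t k q))"
  proof (rule sum.mono_neutral_right)
    \<comment> \<open>The recursion also has the terms \<open>k = 0\<close> and
      \<open>k = n\<close>: the first vanishes through its factor \<open>k\<close>, the second
      because the other piece would have no star.\<close>
    have "ccoef m 0 g2 = 0" for g2 by (simp add: ccoef_def cpoly_0)
    then have "real n * (\<Sum>q\<in>?G. ?t n q) = 0" by (simp add: sum.neutral split_beta)
    then show "\<forall>k\<in>{0..n} - {1..<n}. real k * (\<Sum>q\<in>?G. ?t k q) = 0"
    proof (intro ballI)
      fix k assume "k \<in> {0..n} - {1..<n}"
      then have "k = 0 \<or> k = n" by auto
      then show "real k * (\<Sum>q\<in>?G. ?t k q) = 0" using \<open>real n * (\<Sum>q\<in>?G. ?t n q) = 0\<close> by auto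
    qed
  qed auto
  also have "\<dots> = (\<Sum>k\<in>{1..<n}. \<Sum>q\<in>?G. 2 * ?s (k, n - k, q))"
    unfolding sum_distrib_left by (intro sum.cong refl) (rule trm[symmetric])
  also have "\<dots> = (\<Sum>(k, q)\<in>{1..<n} \<times> ?G. 2 * ?s (k, n - k, q))"
    by (rule sum.cartesian_product)
  also have "\<dots> = (\<Sum>x\<in>?I. 2 * ?s x)"
    by (rule sum.reindex_bij_witness[of _ "\<lambda>(n1, n2, q). (n1, q)" "\<lambda>(k, q). (k, n - k, q)"]) auto
  also have "\<dots> = 2 * (\<Sum>x\<in>?I. ?s x)" by (simp only: sum_distrib_left)
  finally show ?thesis by (simp only: mult_cancel_left) simp
qed

end
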